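(* Let $k$ be a commutative ring with unit, $A$ an associative unital $k$-algebra and $B$ a $k$-subalgebra of $\mathrm{End}_k(A)$ containing the multiplication algebra $M(A)$. Let $A$ be $B$-semiprime and $\widehat{A}$ its central closure with respect to $B$. Assume that the following conditions are fulfilled: (i) $\mathrm{l.ann}_A(I)$ and $\mathrm{r.ann}_A(I)$ are $B$-stable for all essential $B$-stable ideals $I$ of $A$. (ii) $\mathrm{l.ann}_{\widehat{A}}(I)$ is $B$-stable for all $B$-submodules $I$ of $\widehat{A}$. Then $\overline{\psi}:\widehat{A}\to Q_0(A)$ is an injective $k$-algebra homomorphism.
   Context: Conventions: all algebras are associative with unit. $L_a(x)=ax$, $R_a(x)=xa$; $M(A)\subseteq\mathrm{End}_k(A)$ is the $k$-subalgebra generated by all $L_a,R_a$. $A$ is identified with $\{L_a\}\subseteq B$, and $A$ is a left $B$-module via $b\cdot a=b(a)$. $B$-submodules of $A$ are automatically two-sided ideals, called $B$-stable ideals; a subset of $\widehat A$ is $B$-stable if it is a $B$-submodule. $A$ is $B$-semiprime if $K^2=0$ implies $K=0$ for all $B$-stable ideals $K$. Standing assumption of the section: the left annihilator in $A$ of a $B$-stable ideal is again $B$-stable. $\mathrm{l.ann}_X(I)=\{x\in X\mid xI=0\}$, $\mathrm{r.ann}_X(I)=\{x\in X\mid Ix=0\}$. For a left $B$-module $N$, $N^B:=\{m\in N\mid b\cdot m=(b\cdot1_A)m\ \forall b\in B\}$. Central closure: $\widehat{A}=\sum_{f\in\mathrm{Hom}_B(A,E(A))}\mathrm{Im}(f)$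 is the self-injective hull of the left $B$-module $A$, where $E(A)$ is the injective hull. The map $\mathrm{End}_B(\widehat{A})\to\widehat{A}^B$, $f\mapsto f(1_A)$, is bijective and $\widehat{A}^B$ carries the transported (commutative) ring structure. For $a\in A$, $s=f(1_A)\in\widehat{A}^B$ write $as:=f(a)$; every element of $\widehat{A}$ is a finite sum of such $as$, and $\widehat{A}$ is a ring with multiplication $(as)(bt)=(ab)st$, containing $A$ as subring. Let $\phi:A\otimes_{A^B}\mathrm{End}_B(\widehat{A})\to\widehat{A}$, $\phi(a\otimes f)=f(a)$, which is a surjective $k$-algebra homomorphism. $Q_0(A)$: let $\mathcal{F}_B$ be the set of $B$-stable ideals of $A$ with zero left and right annihilator in $A$. Then $Q_0(A)=\varinjlim\{\mathrm{Hom}_{-A}(I,A)\mid I\in\mathcal{F}_B\}$ (right $A$-linear maps), i.e. the set of classes $[f:I\to A]$ with $I\in\mathcal F_B$, where $f\sim g$ iff $f$ and $g$ agree on some $K\in\mathcal{F}_B$ contained in both domains. Addition is $[f]+[g]=[f+g:I\cap J\to A]$ and multiplication, for $f:I\to A$, $g:J\to A$, is $[f][g]=[fg:JI\to A]$ with $(fg)(a)=f(g(a))$. Definition of $\overline{\psi}$: for $f\in\mathrm{End}_B(\widehat{A})$ put $I_f:=f^{-1}(A)\cap A$ and $\psi(f):=[f:I_f\to A]\in Q_0(A)$; let $\imath(a)=[L_a:A\to A]$ for $a\in A$. Then $\psi^*:A\otimes_{A^B}\mathrm{End}_B(\widehat{A})\to Q_0(A)$, $\psi^*(a\otimes f)=\imath(a)\psi(f)$,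 is a $k$-algebra homomorphism with $\mathrm{Ker}(\phi)\subseteq\mathrm{Ker}(\psi^* )$, and $\overline{\psi}:\widehat{A}\to Q_0(A)$ is the induced map, $\overline{\psi}(\phi(\gamma))=\psi^*(\gamma)$.
   Formalization: Since JI need not be B-stable, [f][g] in Q_0(A) is taken as the set of all h:K→A with K in F_B and h=fg on K∩JI; this equals [fg:JI→A] whenever JI is B-stable. Q_0(A) need not be closed under this product, so it is not claimed to be a ring. *)

theory Defs
  imports
    "HOL-Algebra.Module"
    "HOL-Algebra.Subrings"
    "HOL-Algebra.Generated_Groups"
    "HOL-Algebra.Ideal_Product"
    "HOL-Algebra.Free_Abelian_Groups"
begin

section \<open>Algebras, modules over noncommutative rings, endomorphisms\<close>

text \<open>
  The library locale \<open>algebra\<close> only covers commutative algebras, and the library locale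
  \<open>module\<close> only covers commutative rings of scalars; the following two locales drop
  these restrictions.
\<close>

locale assoc_algebra = module R A + ring A for R and A (structure) +
  assumes smult_mult_left:
      "\<lbrakk>c \<in> carrier R; x \<in> carrier A; y \<in> carrier A\<rbrakk> \<Longrightarrow> (c \<odot> x) \<otimes> y = c \<odot> (x \<otimes> y)"
    and smult_mult_right:
      "\<lbrakk>c \<in> carrier R; x \<in> carrier A; y \<in> carrier A\<rbrakk> \<Longrightarrow> x \<otimes> (c \<odot> y) = c \<odot> (x \<otimes> y)"

text \<open>Left modules use the record of the library, whose ring multiplication and unit are ignored.\<close>

locale left_module = R?: ring R + M?: abelian_group M
  for R :: "('r, 'p) ring_scheme" and M :: "('r, 'm) module" +
  assumes smult_closed: "\<lbrakk>a \<in> carrier R; x \<in> carrier M\<rbrakk> \<Longrightarrow> a \<odot>\<^bsub>M\<^esub> x \<in> carrier M"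
    and smult_l_distr: "\<lbrakk>a \<in> carrier R; b \<in> carrier R; x \<in> carrier M\<rbrakk> \<Longrightarrow>
      (a \<oplus>\<^bsub>R\<^esub> b) \<odot>\<^bsub>M\<^esub> x = a \<odot>\<^bsub>M\<^esub> x \<oplus>\<^bsub>M\<^esub> b \<odot>\<^bsub>M\<^esub> x"
    and smult_r_distr: "\<lbrakk>a \<in> carrier R; x \<in> carrier M; y \<in> carrier M\<rbrakk> \<Longrightarrow>
      a \<odot>\<^bsub>M\<^esub> (x \<oplus>\<^bsub>M\<^esub> y) = a \<odot>\<^bsub>M\<^esub> x \<oplus>\<^bsub>M\<^esub> a \<odot>\<^bsub>M\<^esub> y"
    and smult_assoc: "\<lbrakk>a \<in> carrier R; b \<in> carrier R; x \<in> carrier M\<rbrakk> \<Longrightarrow>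
      (a \<otimes>\<^bsub>R\<^esub> b) \<odot>\<^bsub>M\<^esub> x = a \<odot>\<^bsub>M\<^esub> (b \<odot>\<^bsub>M\<^esub> x)"
    and smult_one: "x \<in> carrier M \<Longrightarrow> \<one>\<^bsub>R\<^esub> \<odot>\<^bsub>M\<^esub> x = x"

definition Hom_mod ::
    "('r, 'p) ring_scheme \<Rightarrow> ('r, 'm) module \<Rightarrow> ('r, 'n) module \<Rightarrow> ('m \<Rightarrow> 'n) set" where
  "Hom_mod R M N = {f \<in> carrier M \<rightarrow>\<^sub>E carrier N.
     (\<forall>x\<in>carrier M. \<forall>y\<in>carrier M. f (x \<oplus>\<^bsub>M\<^esub> y) = f x \<oplus>\<^bsub>N\<^esub> f y) \<and>
     (\<forall>r\<in>carrier R. \<forall>x\<in>carrier M. f (r \<odot>\<^bsub>M\<^esub> x) = r \<odot>\<^bsub>N\<^esub> f x)}"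

text \<open>
  The ring of endomorphisms. The field \<open>smult\<close> is \<open>(r \<odot> f) x = r \<odot> f x\<close>; this is again an
  endomorphism if \<open>R\<close> is commutative, and more generally whenever \<open>r\<close> acts on \<open>M\<close> by an
  endomorphism.
\<close>

definition End_mod :: "('r, 'p) ring_scheme \<Rightarrow> ('r, 'm) module \<Rightarrow> ('r, 'm \<Rightarrow> 'm) module" where
  "End_mod R M = \<lparr>carrier = Hom_mod R M M,
     mult = (\<lambda>f g. \<lambda>x\<in>carrier M. f (g x)),
     one = (\<lambda>x\<in>carrier M. x),
     ring.zero = (\<lambda>x\<in>carrier M. \<zero>\<^bsub>M\<^esub>),
     add = (\<lambda>f g. \<lambda>x\<in>carrier M. f x \<oplus>\<^bsub>M\<^esub> g x),
     smult = (\<lambda>r f. \<lambda>x\<in>carrier M. r \<odot>\<^bsub>M\<^esub> f x)\<rparr>"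

definition essential_submodule :: "('r, 'p) ring_scheme \<Rightarrow> ('r, 'm) module \<Rightarrow> 'm set \<Rightarrow> bool" where
  "essential_submodule R M N \<longleftrightarrow> submodule N R M \<and>
     (\<forall>L. submodule L R M \<and> L \<inter> N = {\<zero>\<^bsub>M\<^esub>} \<longrightarrow> L = {\<zero>\<^bsub>M\<^esub>})"

definition extends_along_monos ::
    "('r, 'p) ring_scheme \<Rightarrow> ('r, 'm) module \<Rightarrow> ('r, 'x) module \<Rightarrow> ('r, 'y) module \<Rightarrow> bool" where
  "extends_along_monos R E X Y \<longleftrightarrow>
     (\<forall>i\<in>Hom_mod R X Y. inj_on i (carrier X) \<longrightarrow>
        (\<forall>f\<in>Hom_mod R X E. \<exists>g\<in>Hom_mod R Y E. \<forall>x\<in>carrier X. g (i x) = f x))"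

text \<open>
  A definition cannot quantify over modules of all types. The type of the test modules \<open>X\<close>, \<open>Y\<close>
  is chosen to have room for all submodules of \<open>R\<close> (so that, by Baer's criterion, nothing is lost)
  and of \<open>E\<close>; see \<open>injective_module_extends\<close> below for test modules of arbitrary types.
\<close>

definition injective_module :: "('r, 'p) ring_scheme \<Rightarrow> ('r, 'm) module \<Rightarrow> bool" where
  "injective_module R E \<longleftrightarrow> left_module R E \<and>
     (\<forall>(X :: ('r, 'r + 'm) module) (Y :: ('r, 'r + 'm) module). left_module R X \<longrightarrow> left_module R Y \<longrightarrow>
        extends_along_monos R E X Y)"

theorem injective_module_extends:
  fixes R :: "('r, 'p) ring_scheme" and E :: "('r, 'm) module"
    and X :: "('r, 'x) module" and Y :: "('r, 'y) module"
  assumes inj: "injective_module R E" and X: "left_module R X" and Y: "left_module R Y"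
  shows "extends_along_monos R E X Y"
proof -
  interpret E: left_module R E using inj by (simp add: injective_module_def)
  interpret X: left_module R X by fact
  interpret Y: left_module R Y by fact
  have zeroE: "\<zero>\<^bsub>R\<^esub> \<odot>\<^bsub>E\<^esub> x = \<zero>\<^bsub>E\<^esub>" if "x \<in> carrier E" for x
    using E.smult_l_distr[OF E.R.zero_closed E.R.zero_closed that]
      E.smult_closed[OF E.R.zero_closed that] by (simp add: E.M.add.r_cancel_one')
  have zeroY: "\<zero>\<^bsub>R\<^esub> \<odot>\<^bsub>Y\<^esub> x = \<zero>\<^bsub>Y\<^esub>" if "x \<in> carrier Y" for x
    using Y.smult_l_distr[OF E.R.zero_closed E.R.zero_closed that]
      Y.smult_closed[OF E.R.zero_closed that] by (simp add: Y.M.add.r_cancel_one')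
  \<comment> \<open>Homomorphisms from left ideals into \<open>E\<close> are right multiplications by elements of \<open>E\<close>.\<close>
  have ideals: "\<exists>e\<in>carrier E. \<forall>r\<in>L. h r = r \<odot>\<^bsub>E\<^esub> e"
    if L: "L \<subseteq> carrier R" "\<zero>\<^bsub>R\<^esub> \<in> L"
      and Ladd: "\<And>r s. \<lbrakk>r \<in> L; s \<in> L\<rbrakk> \<Longrightarrow> r \<oplus>\<^bsub>R\<^esub> s \<in> L"
      and Lmul: "\<And>r s. \<lbrakk>r \<in> carrier R; s \<in> L\<rbrakk> \<Longrightarrow> r \<otimes>\<^bsub>R\<^esub> s \<in> L"
      and h: "\<And>r. r \<in> L \<Longrightarrow> h r \<in> carrier E"
      and hadd: "\<And>r s. \<lbrakk>r \<in> L; s \<in> L\<rbrakk> \<Longrightarrow> h (r \<oplus>\<^bsub>R\<^esub> s) = h r \<oplus>\<^bsub>E\<^esub> h s"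
      and hmul: "\<And>r s. \<lbrakk>r \<in> carrier R; s \<in> L\<rbrakk> \<Longrightarrow> h (r \<otimes>\<^bsub>R\<^esub> s) = r \<odot>\<^bsub>E\<^esub> h s"
    for L h
  proof -
    define N :: "'r set \<Rightarrow> ('r, 'r + 'm) module" where "N = (\<lambda>C. \<lparr>carrier = Inl ` C,
      mult = (\<lambda>x y. x), one = Inl \<zero>\<^bsub>R\<^esub>, ring.zero = Inl \<zero>\<^bsub>R\<^esub>,
      add = (\<lambda>x y. Inl (projl x \<oplus>\<^bsub>R\<^esub> projl y)), smult = (\<lambda>r x. Inl (r \<otimes>\<^bsub>R\<^esub> projl x))\<rparr>)"
    have N: "left_module R (N C)"
      if C: "C \<subseteq> carrier R" "\<zero>\<^bsub>R\<^esub> \<in> C"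
        and Cadd: "\<And>r s. \<lbrakk>r \<in> C; s \<in> C\<rbrakk> \<Longrightarrow> r \<oplus>\<^bsub>R\<^esub> s \<in> C"
        and Cmul: "\<And>r s. \<lbrakk>r \<in> carrier R; s \<in> C\<rbrakk> \<Longrightarrow> r \<otimes>\<^bsub>R\<^esub> s \<in> C" for C
    proof -
      have neg: "\<exists>y\<in>C. y \<oplus>\<^bsub>R\<^esub> x = \<zero>\<^bsub>R\<^esub>" if "x \<in> C" for x
      proof -
        have x: "x \<in> carrier R" using that C by auto
        have "(\<ominus>\<^bsub>R\<^esub> \<one>\<^bsub>R\<^esub>) \<otimes>\<^bsub>R\<^esub> x \<in> C" using that by (intro Cmul) auto
        moreover have "(\<ominus>\<^bsub>R\<^esub> \<one>\<^bsub>R\<^esub>) \<otimes>\<^bsub>R\<^esub> x = \<ominus>\<^bsub>R\<^esub> x" using x by (simp add: E.R.l_minus)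
        ultimately show ?thesis using x E.R.l_neg by metis
      qed
      have "abelian_group (N C)"
      proof (rule abelian_groupI)
        fix x assume "x \<in> carrier (N C)"
        then obtain u where u: "x = Inl u" "u \<in> C" by (auto simp: N_def)
        then obtain v where "v \<in> C" "v \<oplus>\<^bsub>R\<^esub> u = \<zero>\<^bsub>R\<^esub>" using neg by blast
        then show "\<exists>y\<in>carrier (N C). y \<oplus>\<^bsub>N C\<^esub> x = \<zero>\<^bsub>N C\<^esub>"
          using u by (auto simp: N_def)
      qed (use C Cadd in \<open>auto simp: N_def E.R.a_ac subset_iff\<close>)
      moreover have "left_module_axioms R (N C)"
        by unfold_locales
          (use C Cmul in \<open>auto simp: N_def subset_iff E.R.l_distr E.R.r_distr E.R.m_assoc\<close>)
      ultimately show ?thesis by (simp add: left_module_def E.R.ring_axioms)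
    qed
    have NL: "left_module R (N L)" and NR: "left_module R (N (carrier R))"
      using L Ladd Lmul by (auto intro!: N)
    define i where "i = (\<lambda>x\<in>carrier (N L). x)"
    define h' where "h' = (\<lambda>x\<in>carrier (N L). h (projl x))"
    have i: "i \<in> Hom_mod R (N L) (N (carrier R))" "inj_on i (carrier (N L))"
      using L Ladd Lmul by (auto simp: i_def Hom_mod_def N_def inj_on_def)
    have h': "h' \<in> Hom_mod R (N L) E"
      using h hadd hmul Ladd Lmul by (auto simp: h'_def Hom_mod_def N_def)
    have "extends_along_monos R E (N L) (N (carrier R))"
      using inj NL NR by (simp add: injective_module_def)
    then obtain g where g: "g \<in> Hom_mod R (N (carrier R)) E"
        and gi: "\<And>x. x \<in> carrier (N L) \<Longrightarrow> g (i x) = h' x"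
      using i h' unfolding extends_along_monos_def by blast
    define e where "e = g (Inl \<one>\<^bsub>R\<^esub>)"
    have e: "e \<in> carrier E" using g by (auto simp: e_def Hom_mod_def N_def)
    have "h r = r \<odot>\<^bsub>E\<^esub> e" if "r \<in> L" for r
    proof -
      have r: "r \<in> carrier R" using that L by auto
      from g have gm: "g (s \<odot>\<^bsub>N (carrier R)\<^esub> x) = s \<odot>\<^bsub>E\<^esub> g x"
        if "s \<in> carrier R" "x \<in> carrier (N (carrier R))" for s x
        using that by (simp add: Hom_mod_def)
      have "h r = g (Inl r)" using gi[of "Inl r"] that by (auto simp: N_def i_def h'_def)
      also have "Inl r = r \<odot>\<^bsub>N (carrier R)\<^esub> Inl \<one>\<^bsub>R\<^esub>" using r by (simp add: N_def)
      also have "g \<dots> = r \<odot>\<^bsub>E\<^esub> g (Inl \<one>\<^bsub>R\<^esub>)"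
        using r E.R.one_closed by (intro gm) (auto simp: N_def)
      finally show ?thesis by (simp add: e_def)
    qed
    with e show ?thesis by blast
  qed
  show ?thesis
    unfolding extends_along_monos_def
  proof (intro ballI impI)
    fix i f assume i: "i \<in> Hom_mod R X Y" "inj_on i (carrier X)" and f: "f \<in> Hom_mod R X E"
    define G0 where "G0 = (\<lambda>x. (i x, f x)) ` carrier X"
    define P where "P = (\<lambda>G. G0 \<subseteq> G \<and> G \<subseteq> carrier Y \<times> carrier E \<and>
      (\<forall>y e y' e'. (y, e) \<in> G \<longrightarrow> (y', e') \<in> G \<longrightarrow> (y \<oplus>\<^bsub>Y\<^esub> y', e \<oplus>\<^bsub>E\<^esub> e') \<in> G) \<and>
      (\<forall>r y e. r \<in> carrier R \<longrightarrow> (y, e) \<in> G \<longrightarrow> (r \<odot>\<^bsub>Y\<^esub> y, r \<odot>\<^bsub>E\<^esub> e) \<in> G) \<and>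
      (\<forall>y e e'. (y, e) \<in> G \<longrightarrow> (y, e') \<in> G \<longrightarrow> e = e'))"
    have fm: "f x \<in> carrier E" "i x \<in> carrier Y" if "x \<in> carrier X" for x
      using i f that by (auto simp: Hom_mod_def)
    have hom_add: "f (x \<oplus>\<^bsub>X\<^esub> y) = f x \<oplus>\<^bsub>E\<^esub> f y" "i (x \<oplus>\<^bsub>X\<^esub> y) = i x \<oplus>\<^bsub>Y\<^esub> i y"
      if "x \<in> carrier X" "y \<in> carrier X" for x y
      using i f that by (auto simp: Hom_mod_def)
    have hom_mul: "f (r \<odot>\<^bsub>X\<^esub> x) = r \<odot>\<^bsub>E\<^esub> f x" "i (r \<odot>\<^bsub>X\<^esub> x) = r \<odot>\<^bsub>Y\<^esub> i x"
      if "x \<in> carrier X" "r \<in> carrier R" for x r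
      using i f that by (auto simp: Hom_mod_def)
    have P0: "P G0"
      unfolding P_def
    proof (intro conjI allI impI)
      fix y e y' e' assume "(y, e) \<in> G0" "(y', e') \<in> G0"
      then obtain x x' where "x \<in> carrier X" "x' \<in> carrier X" "y = i x" "e = f x" "y' = i x'" "e' = f x'"
        by (auto simp: G0_def)
      then show "(y \<oplus>\<^bsub>Y\<^esub> y', e \<oplus>\<^bsub>E\<^esub> e') \<in> G0"
        by (auto simp: G0_def hom_add intro!: image_eqI[of _ _ "x \<oplus>\<^bsub>X\<^esub> x'"])
    next
      fix r y e assume "r \<in> carrier R" "(y, e) \<in> G0"
      then obtain x where "x \<in> carrier X" "y = i x" "e = f x" by (auto simp: G0_def)
      with \<open>r \<in> carrier R\<close> show "(r \<odot>\<^bsub>Y\<^esub> y, r \<odot>\<^bsub>E\<^esub> e) \<in> G0"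
        by (auto simp: G0_def hom_mul X.smult_closed intro!: image_eqI[of _ _ "r \<odot>\<^bsub>X\<^esub> x"])
    qed (use i(2) fm in \<open>auto simp: G0_def inj_on_def\<close>)
    have "\<exists>M\<in>Collect P. \<forall>Z\<in>Collect P. M \<subseteq> Z \<longrightarrow> Z = M"
    proof (rule subset_Zorn_nonempty)
      show "Collect P \<noteq> {}" using P0 by auto
    next
      fix C assume C: "C \<noteq> {}" "subset.chain (Collect P) C"
      have PC: "P Z" if "Z \<in> C" for Z using C that by (auto simp: subset.chain_def)
      have two: "\<exists>Z\<in>C. u \<in> Z \<and> v \<in> Z" if "u \<in> \<Union>C" "v \<in> \<Union>C" for u v
      proof -
        from that obtain Z Z' where Z: "Z \<in> C" "u \<in> Z" "Z' \<in> C" "v \<in> Z'" by blast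
        then have "Z \<subseteq> Z' \<or> Z' \<subseteq> Z" using C(2) by (auto simp: subset_chain_def)
        with Z show ?thesis by blast
      qed
      have "P (\<Union>C)"
        unfolding P_def
      proof (intro conjI allI impI)
        obtain Z where "Z \<in> C" using C by blast
        then show "G0 \<subseteq> \<Union>C" using PC[of Z] by (auto simp: P_def)
        show "\<Union>C \<subseteq> carrier Y \<times> carrier E"
        proof (rule Union_least)
          show "Z \<subseteq> carrier Y \<times> carrier E" if "Z \<in> C" for Z using PC[OF that] by (simp add: P_def)
        qed
        show "(y \<oplus>\<^bsub>Y\<^esub> y', e \<oplus>\<^bsub>E\<^esub> e') \<in> \<Union>C" if u: "(y, e) \<in> \<Union>C" "(y', e') \<in> \<Union>C" for y e y' e'
        proof -
          obtain Z where "Z \<in> C" "(y, e) \<in> Z" "(y', e') \<in> Z" using two[OF u] by blast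
          then show ?thesis using PC[of Z] by (intro UnionI[of Z]) (auto simp: P_def)
        qed
        show "(r \<odot>\<^bsub>Y\<^esub> y, r \<odot>\<^bsub>E\<^esub> e) \<in> \<Union>C" if r: "r \<in> carrier R" and u: "(y, e) \<in> \<Union>C" for r y e
        proof -
          obtain Z where "Z \<in> C" "(y, e) \<in> Z" using u by blast
          then show ?thesis using PC[of Z] r by (intro UnionI[of Z]) (auto simp: P_def)
        qed
        show "e = e'" if u: "(y, e) \<in> \<Union>C" "(y, e') \<in> \<Union>C" for y e e'
        proof -
          obtain Z where "Z \<in> C" "(y, e) \<in> Z" "(y, e') \<in> Z" using two[OF u] by blast
          then show ?thesis using PC[of Z] by (auto simp: P_def)
        qed
      qed
      then show "\<Union>C \<in> Collect P" by simp
    qed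
    then obtain M where PM: "P M" and max: "\<And>Z. P Z \<Longrightarrow> M \<subseteq> Z \<Longrightarrow> Z = M" by auto
    have Mc: "y \<in> carrier Y" "e \<in> carrier E" if "(y, e) \<in> M" for y e
      using PM that by (auto simp: P_def)
    have Madd: "(y \<oplus>\<^bsub>Y\<^esub> y', e \<oplus>\<^bsub>E\<^esub> e') \<in> M" if "(y, e) \<in> M" "(y', e') \<in> M" for y e y' e'
      using PM that by (auto simp: P_def)
    have Mmul: "(r \<odot>\<^bsub>Y\<^esub> y, r \<odot>\<^bsub>E\<^esub> e) \<in> M" if "r \<in> carrier R" "(y, e) \<in> M" for r y e
      using PM that by (auto simp: P_def)
    have Mfun: "e = e'" if "(y, e) \<in> M" "(y, e') \<in> M" for y e e'
      using PM that by (auto simp: P_def)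
    have M0: "(\<zero>\<^bsub>Y\<^esub>, \<zero>\<^bsub>E\<^esub>) \<in> M"
    proof -
      have "(i \<zero>\<^bsub>X\<^esub>, f \<zero>\<^bsub>X\<^esub>) \<in> M" using PM by (auto simp: P_def G0_def)
      from Mmul[OF E.R.zero_closed this] show ?thesis
        using zeroE zeroY fm[of "\<zero>\<^bsub>X\<^esub>"] by simp
    qed
    have total: "\<exists>e. (y0, e) \<in> M" if y0: "y0 \<in> carrier Y" for y0
    proof -
      define L where "L = {r \<in> carrier R. \<exists>e. (r \<odot>\<^bsub>Y\<^esub> y0, e) \<in> M}"
      define h where "h = (\<lambda>r. THE e. (r \<odot>\<^bsub>Y\<^esub> y0, e) \<in> M)"
      have hI: "h r = e" if "(r \<odot>\<^bsub>Y\<^esub> y0, e) \<in> M" for r e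
        unfolding h_def using that Mfun by blast
      have "\<exists>e\<in>carrier E. \<forall>r\<in>L. h r = r \<odot>\<^bsub>E\<^esub> e"
      proof (rule ideals)
        show "L \<subseteq> carrier R" by (auto simp: L_def)
        show "\<zero>\<^bsub>R\<^esub> \<in> L" using M0 zeroY[OF y0] by (auto simp: L_def)
      next
        fix r s assume "r \<in> L" "s \<in> L"
        then obtain u v where rs: "r \<in> carrier R" "s \<in> carrier R"
            and uv: "(r \<odot>\<^bsub>Y\<^esub> y0, u) \<in> M" "(s \<odot>\<^bsub>Y\<^esub> y0, v) \<in> M" by (auto simp: L_def)
        have *: "((r \<oplus>\<^bsub>R\<^esub> s) \<odot>\<^bsub>Y\<^esub> y0, u \<oplus>\<^bsub>E\<^esub> v) \<in> M"
          using Madd[OF uv] rs y0 by (simp add: Y.smult_l_distr)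
        then show "r \<oplus>\<^bsub>R\<^esub> s \<in> L" using rs by (auto simp: L_def)
        show "h (r \<oplus>\<^bsub>R\<^esub> s) = h r \<oplus>\<^bsub>E\<^esub> h s" using hI[OF *] hI[OF uv(1)] hI[OF uv(2)] by simp
      next
        fix r s assume r: "r \<in> carrier R" and "s \<in> L"
        then obtain v where s: "s \<in> carrier R" and v: "(s \<odot>\<^bsub>Y\<^esub> y0, v) \<in> M" by (auto simp: L_def)
        have *: "((r \<otimes>\<^bsub>R\<^esub> s) \<odot>\<^bsub>Y\<^esub> y0, r \<odot>\<^bsub>E\<^esub> v) \<in> M"
          using Mmul[OF r v] r s y0 by (simp add: Y.smult_assoc)
        then show "r \<otimes>\<^bsub>R\<^esub> s \<in> L" using r s by (auto simp: L_def)
        show "h (r \<otimes>\<^bsub>R\<^esub> s) = r \<odot>\<^bsub>E\<^esub> h s" using hI[OF *] hI[OF v] by simp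
      next
        fix r assume "r \<in> L"
        then show "h r \<in> carrier E" using hI Mc by (auto simp: L_def)
      qed
      then obtain e0 where e0: "e0 \<in> carrier E" and he: "\<And>r. r \<in> L \<Longrightarrow> h r = r \<odot>\<^bsub>E\<^esub> e0" by blast
      have key: "e = r \<odot>\<^bsub>E\<^esub> e0" if "r \<in> carrier R" "(r \<odot>\<^bsub>Y\<^esub> y0, e) \<in> M" for r e
        using he[of r] hI[OF that(2)] that by (auto simp: L_def)
      define M' where "M' = {(y \<oplus>\<^bsub>Y\<^esub> r \<odot>\<^bsub>Y\<^esub> y0, e \<oplus>\<^bsub>E\<^esub> r \<odot>\<^bsub>E\<^esub> e0) | y e r. (y, e) \<in> M \<and> r \<in> carrier R}"
      have MM': "M \<subseteq> M'"
      proof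
        fix p assume "p \<in> M"
        then obtain y e where p: "p = (y, e)" "(y, e) \<in> M" by (cases p) auto
        have "p = (y \<oplus>\<^bsub>Y\<^esub> \<zero>\<^bsub>R\<^esub> \<odot>\<^bsub>Y\<^esub> y0, e \<oplus>\<^bsub>E\<^esub> \<zero>\<^bsub>R\<^esub> \<odot>\<^bsub>E\<^esub> e0)"
          using p Mc[OF p(2)] zeroY[OF y0] zeroE[OF e0] by simp
        then show "p \<in> M'" using p E.R.zero_closed unfolding M'_def by blast
      qed
      have "P M'"
        unfolding P_def
      proof (intro conjI allI impI)
        show "G0 \<subseteq> M'" using PM MM' by (auto simp: P_def)
        show "M' \<subseteq> carrier Y \<times> carrier E"
          using Mc y0 e0 by (auto simp: M'_def Y.smult_closed E.smult_closed)
      next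
        fix y e y' e' assume "(y, e) \<in> M'" "(y', e') \<in> M'"
        then obtain u p r v q s where a: "(u, p) \<in> M" "r \<in> carrier R" "(v, q) \<in> M" "s \<in> carrier R"
          and b: "y = u \<oplus>\<^bsub>Y\<^esub> r \<odot>\<^bsub>Y\<^esub> y0" "e = p \<oplus>\<^bsub>E\<^esub> r \<odot>\<^bsub>E\<^esub> e0"
            "y' = v \<oplus>\<^bsub>Y\<^esub> s \<odot>\<^bsub>Y\<^esub> y0" "e' = q \<oplus>\<^bsub>E\<^esub> s \<odot>\<^bsub>E\<^esub> e0"
          by (auto simp: M'_def)
        have "y \<oplus>\<^bsub>Y\<^esub> y' = (u \<oplus>\<^bsub>Y\<^esub> v) \<oplus>\<^bsub>Y\<^esub> (r \<oplus>\<^bsub>R\<^esub> s) \<odot>\<^bsub>Y\<^esub> y0"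
          using a Mc y0 by (simp add: b Y.smult_l_distr Y.smult_closed Y.M.a_ac)
        moreover have "e \<oplus>\<^bsub>E\<^esub> e' = (p \<oplus>\<^bsub>E\<^esub> q) \<oplus>\<^bsub>E\<^esub> (r \<oplus>\<^bsub>R\<^esub> s) \<odot>\<^bsub>E\<^esub> e0"
          using a Mc e0 by (simp add: b E.smult_l_distr E.smult_closed E.M.a_ac)
        ultimately show "(y \<oplus>\<^bsub>Y\<^esub> y', e \<oplus>\<^bsub>E\<^esub> e') \<in> M'"
          using Madd[OF a(1,3)] a(2,4) E.R.add.m_closed unfolding M'_def by blast
      next
        fix t y e assume t: "t \<in> carrier R" and "(y, e) \<in> M'"
        then obtain u p r where a: "(u, p) \<in> M" "r \<in> carrier R"
          and b: "y = u \<oplus>\<^bsub>Y\<^esub> r \<odot>\<^bsub>Y\<^esub> y0" "e = p \<oplus>\<^bsub>E\<^esub> r \<odot>\<^bsub>E\<^esub> e0"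
          by (auto simp: M'_def)
        have "t \<odot>\<^bsub>Y\<^esub> y = t \<odot>\<^bsub>Y\<^esub> u \<oplus>\<^bsub>Y\<^esub> (t \<otimes>\<^bsub>R\<^esub> r) \<odot>\<^bsub>Y\<^esub> y0"
          using a t Mc y0 by (simp add: b Y.smult_r_distr Y.smult_closed Y.smult_assoc)
        moreover have "t \<odot>\<^bsub>E\<^esub> e = t \<odot>\<^bsub>E\<^esub> p \<oplus>\<^bsub>E\<^esub> (t \<otimes>\<^bsub>R\<^esub> r) \<odot>\<^bsub>E\<^esub> e0"
          using a t Mc e0 by (simp add: b E.smult_r_distr E.smult_closed E.smult_assoc)
        ultimately show "(t \<odot>\<^bsub>Y\<^esub> y, t \<odot>\<^bsub>E\<^esub> e) \<in> M'"
          using Mmul[OF t a(1)] t a(2) E.R.m_closed unfolding M'_def by blast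
      next
        fix y e e' assume "(y, e) \<in> M'" "(y, e') \<in> M'"
        then obtain u p r v q s where a: "(u, p) \<in> M" "r \<in> carrier R" "(v, q) \<in> M" "s \<in> carrier R"
          and b: "y = u \<oplus>\<^bsub>Y\<^esub> r \<odot>\<^bsub>Y\<^esub> y0" "e = p \<oplus>\<^bsub>E\<^esub> r \<odot>\<^bsub>E\<^esub> e0"
            "y = v \<oplus>\<^bsub>Y\<^esub> s \<odot>\<^bsub>Y\<^esub> y0" "e' = q \<oplus>\<^bsub>E\<^esub> s \<odot>\<^bsub>E\<^esub> e0"
          unfolding M'_def by blast
        define w where "w = (\<ominus>\<^bsub>R\<^esub> \<one>\<^bsub>R\<^esub>) \<odot>\<^bsub>Y\<^esub> v"
        define w' where "w' = (\<ominus>\<^bsub>R\<^esub> \<one>\<^bsub>R\<^esub>) \<odot>\<^bsub>E\<^esub> q"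
        have m1: "\<ominus>\<^bsub>R\<^esub> \<one>\<^bsub>R\<^esub> \<in> carrier R" by simp
        have w: "w \<in> carrier Y" "w \<oplus>\<^bsub>Y\<^esub> v = \<zero>\<^bsub>Y\<^esub>" "w' \<in> carrier E" "w' \<oplus>\<^bsub>E\<^esub> q = \<zero>\<^bsub>E\<^esub>"
          using Mc[OF a(3)] Y.smult_l_distr[OF m1 E.R.one_closed, of v]
            E.smult_l_distr[OF m1 E.R.one_closed, of q]
          by (auto simp: w_def w'_def Y.smult_closed E.smult_closed Y.smult_one E.smult_one
              zeroY zeroE E.R.l_neg)
        define t where "t = s \<oplus>\<^bsub>R\<^esub> (\<ominus>\<^bsub>R\<^esub> r)"
        have t: "t \<in> carrier R" "s = r \<oplus>\<^bsub>R\<^esub> t"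
          using a E.R.a_lcomm[of r s "\<ominus>\<^bsub>R\<^esub> r"] by (auto simp: t_def E.R.r_neg)
        have uc: "u \<in> carrier Y" "v \<in> carrier Y" "p \<in> carrier E" "q \<in> carrier E"
          using Mc a by auto
        have ry: "r \<odot>\<^bsub>Y\<^esub> y0 \<in> carrier Y" "t \<odot>\<^bsub>Y\<^esub> y0 \<in> carrier Y" "r \<odot>\<^bsub>E\<^esub> e0 \<in> carrier E" "t \<odot>\<^bsub>E\<^esub> e0 \<in> carrier E"
          using a t y0 e0 by (auto simp: Y.smult_closed E.smult_closed)
        have "u \<oplus>\<^bsub>Y\<^esub> r \<odot>\<^bsub>Y\<^esub> y0 = (v \<oplus>\<^bsub>Y\<^esub> t \<odot>\<^bsub>Y\<^esub> y0) \<oplus>\<^bsub>Y\<^esub> r \<odot>\<^bsub>Y\<^esub> y0"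
          using b t a y0 uc ry by (simp add: Y.smult_l_distr Y.M.a_ac)
        then have "u = v \<oplus>\<^bsub>Y\<^esub> t \<odot>\<^bsub>Y\<^esub> y0" using uc ry by simp
        then have "w \<oplus>\<^bsub>Y\<^esub> u = t \<odot>\<^bsub>Y\<^esub> y0" using w uc ry by (simp flip: Y.M.a_assoc)
        moreover have "(w \<oplus>\<^bsub>Y\<^esub> u, w' \<oplus>\<^bsub>E\<^esub> p) \<in> M"
          using Madd[OF Mmul[OF m1 a(3)] a(1)] by (simp add: w_def w'_def)
        ultimately have te: "w' \<oplus>\<^bsub>E\<^esub> p = t \<odot>\<^bsub>E\<^esub> e0" using key t by simp
        have "e' = (q \<oplus>\<^bsub>E\<^esub> (w' \<oplus>\<^bsub>E\<^esub> p)) \<oplus>\<^bsub>E\<^esub> r \<odot>\<^bsub>E\<^esub> e0"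
          using b t a e0 uc ry te by (simp add: E.smult_l_distr E.M.a_ac)
        also have "q \<oplus>\<^bsub>E\<^esub> (w' \<oplus>\<^bsub>E\<^esub> p) = p"
          using w uc by (metis E.M.a_assoc E.M.a_comm E.M.l_zero)
        finally show "e = e'" using b by simp
      qed
      from max[OF this MM'] have "M' = M" .
      moreover have "(\<zero>\<^bsub>Y\<^esub> \<oplus>\<^bsub>Y\<^esub> \<one>\<^bsub>R\<^esub> \<odot>\<^bsub>Y\<^esub> y0, \<zero>\<^bsub>E\<^esub> \<oplus>\<^bsub>E\<^esub> \<one>\<^bsub>R\<^esub> \<odot>\<^bsub>E\<^esub> e0) \<in> M'"
        using M0 E.R.one_closed unfolding M'_def by blast
      ultimately show ?thesis using y0 by (auto simp: Y.smult_one)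
    qed
    define g where "g = (\<lambda>y\<in>carrier Y. THE e. (y, e) \<in> M)"
    have gI: "g y = e" if "(y, e) \<in> M" for y e
      unfolding g_def using that Mfun Mc(1) by auto
    have gM: "(y, g y) \<in> M" if "y \<in> carrier Y" for y
      using total[OF that] gI by auto
    have "g \<in> Hom_mod R Y E"
      unfolding Hom_mod_def
    proof (intro CollectI conjI ballI)
      show "g \<in> carrier Y \<rightarrow>\<^sub>E carrier E" using Mc(2)[OF gM] by (auto simp: PiE_iff) (simp add: g_def)
    qed (auto intro!: gI Madd Mmul gM)
    moreover have "g (i x) = f x" if "x \<in> carrier X" for x
      using PM that by (intro gI) (auto simp: P_def G0_def)
    ultimately show "\<exists>g\<in>Hom_mod R Y E. \<forall>x\<in>carrier X. g (i x) = f x" by blast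
  qed
qed

text \<open>\<open>j\<close> is the embedding of \<open>M\<close> into its injective hull \<open>E\<close>.\<close>

definition injective_hull ::
    "('r, 'p) ring_scheme \<Rightarrow> ('r, 'm) module \<Rightarrow> ('r, 'e) module \<Rightarrow> ('m \<Rightarrow> 'e) \<Rightarrow> bool" where
  "injective_hull R M E j \<longleftrightarrow> injective_module R E \<and> j \<in> Hom_mod R M E \<and>
     inj_on j (carrier M) \<and> essential_submodule R E (j ` carrier M)"

definition k_subalgebra :: "('k, 'p) ring_scheme \<Rightarrow> ('k, 's) module \<Rightarrow> 's set \<Rightarrow> bool" where
  "k_subalgebra k S X \<longleftrightarrow> subring X S \<and> (\<forall>c\<in>carrier k. \<forall>x\<in>X. c \<odot>\<^bsub>S\<^esub> x \<in> X)"

definition k_alg_hom ::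
    "('k, 'p) ring_scheme \<Rightarrow> ('k, 's) module \<Rightarrow> ('k, 't) module \<Rightarrow> ('s \<Rightarrow> 't) set" where
  "k_alg_hom k S T = {h \<in> ring_hom S T.
     \<forall>c\<in>carrier k. \<forall>x\<in>carrier S. h (c \<odot>\<^bsub>S\<^esub> x) = c \<odot>\<^bsub>T\<^esub> h x}"

definition l_ann :: "('s, 'p) ring_scheme \<Rightarrow> 's set \<Rightarrow> 's set" where
  "l_ann S I = {x \<in> carrier S. \<forall>y\<in>I. x \<otimes>\<^bsub>S\<^esub> y = \<zero>\<^bsub>S\<^esub>}"

definition r_ann :: "('s, 'p) ring_scheme \<Rightarrow> 's set \<Rightarrow> 's set" where
  "r_ann S I = {x \<in> carrier S. \<forall>y\<in>I. y \<otimes>\<^bsub>S\<^esub> x = \<zero>\<^bsub>S\<^esub>}"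


section \<open>Tensor products\<close>

text \<open>
  Tensor product over \<open>Z\<close> of a right module \<open>X\<close> with action \<open>ract x z\<close> and a left module \<open>Y\<close>
  with action \<open>lact z y\<close>: the free abelian group on \<open>X \<times> Y\<close> modulo the usual relations.
\<close>

definition tensor_relations ::
    "'z set \<Rightarrow> ('x, 'p) ring_scheme \<Rightarrow> ('y, 'q) ring_scheme \<Rightarrow> ('x \<Rightarrow> 'z \<Rightarrow> 'x) \<Rightarrow> ('z \<Rightarrow> 'y \<Rightarrow> 'y)
      \<Rightarrow> ('x \<times> 'y \<Rightarrow>\<^sub>0 int) set" where
  "tensor_relations Z X Y ract lact =
     {frag_of (x \<oplus>\<^bsub>X\<^esub> x', y) - frag_of (x, y) - frag_of (x', y) | x x' y.
        x \<in> carrier X \<and> x' \<in> carrier X \<and> y \<in> carrier Y} \<union>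
     {frag_of (x, y \<oplus>\<^bsub>Y\<^esub> y') - frag_of (x, y) - frag_of (x, y') | x y y'.
        x \<in> carrier X \<and> y \<in> carrier Y \<and> y' \<in> carrier Y} \<union>
     {frag_of (ract x z, y) - frag_of (x, lact z y) | x y z.
        x \<in> carrier X \<and> y \<in> carrier Y \<and> z \<in> Z}"

definition tensor_kernel ::
    "'z set \<Rightarrow> ('x, 'p) ring_scheme \<Rightarrow> ('y, 'q) ring_scheme \<Rightarrow> ('x \<Rightarrow> 'z \<Rightarrow> 'x) \<Rightarrow> ('z \<Rightarrow> 'y \<Rightarrow> 'y)
      \<Rightarrow> ('x \<times> 'y \<Rightarrow>\<^sub>0 int) set" where
  "tensor_kernel Z X Y ract lact =
     generate (free_Abelian_group (carrier X \<times> carrier Y)) (tensor_relations Z X Y ract lact)"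

definition tensor_product ::
    "'z set \<Rightarrow> ('x, 'p) ring_scheme \<Rightarrow> ('y, 'q) ring_scheme \<Rightarrow> ('x \<Rightarrow> 'z \<Rightarrow> 'x) \<Rightarrow> ('z \<Rightarrow> 'y \<Rightarrow> 'y)
      \<Rightarrow> ('x \<times> 'y \<Rightarrow>\<^sub>0 int) set monoid" where
  "tensor_product Z X Y ract lact =
     free_Abelian_group (carrier X \<times> carrier Y) Mod tensor_kernel Z X Y ract lact"

definition pure_tensor ::
    "'z set \<Rightarrow> ('x, 'p) ring_scheme \<Rightarrow> ('y, 'q) ring_scheme \<Rightarrow> ('x \<Rightarrow> 'z \<Rightarrow> 'x) \<Rightarrow> ('z \<Rightarrow> 'y \<Rightarrow> 'y)
      \<Rightarrow> 'x \<Rightarrow> 'y \<Rightarrow> ('x \<times> 'y \<Rightarrow>\<^sub>0 int) set" where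
  "pure_tensor Z X Y ract lact x y =
     tensor_kernel Z X Y ract lact #>\<^bsub>free_Abelian_group (carrier X \<times> carrier Y)\<^esub> frag_of (x, y)"


section \<open>The algebra \<open>A\<close> as a module over \<open>B \<subseteq> End\<^sub>k(A)\<close>\<close>

definition L_map :: "('k, 'a) module \<Rightarrow> 'a \<Rightarrow> 'a \<Rightarrow> 'a" where
  "L_map A a = (\<lambda>x\<in>carrier A. a \<otimes>\<^bsub>A\<^esub> x)"

definition R_map :: "('k, 'a) module \<Rightarrow> 'a \<Rightarrow> 'a \<Rightarrow> 'a" where
  "R_map A a = (\<lambda>x\<in>carrier A. x \<otimes>\<^bsub>A\<^esub> a)"

definition mult_algebra :: "('k, 'p) ring_scheme \<Rightarrow> ('k, 'a) module \<Rightarrow> ('a \<Rightarrow> 'a) set" where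
  "mult_algebra k A = \<Inter>{C. k_subalgebra k (End_mod k A) C \<and>
     L_map A ` carrier A \<subseteq> C \<and> R_map A ` carrier A \<subseteq> C}"

definition B_ring ::
    "('k, 'p) ring_scheme \<Rightarrow> ('k, 'a) module \<Rightarrow> ('a \<Rightarrow> 'a) set \<Rightarrow> ('k, 'a \<Rightarrow> 'a) module" where
  "B_ring k A B = (End_mod k A)\<lparr>carrier := B\<rparr>"

definition A_mod :: "('k, 'a) module \<Rightarrow> ('a \<Rightarrow> 'a, 'a) module" where
  "A_mod A = \<lparr>carrier = carrier A, mult = mult A, one = one A, ring.zero = ring.zero A, add = add A,
     smult = (\<lambda>b x. b x)\<rparr>"

abbreviation B_stable ::
    "('k, 'p) ring_scheme \<Rightarrow> ('k, 'a) module \<Rightarrow> ('a \<Rightarrow> 'a) set \<Rightarrow> 'a set \<Rightarrow> bool" where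
  "B_stable k A B I \<equiv> submodule I (B_ring k A B) (A_mod A)"

definition B_semiprime ::
    "('k, 'p) ring_scheme \<Rightarrow> ('k, 'a) module \<Rightarrow> ('a \<Rightarrow> 'a) set \<Rightarrow> bool" where
  "B_semiprime k A B \<longleftrightarrow>
     (\<forall>K. B_stable k A B K \<longrightarrow> ideal_prod A K K = {\<zero>\<^bsub>A\<^esub>} \<longrightarrow> K = {\<zero>\<^bsub>A\<^esub>})"

definition B_invariants ::
    "('k, 'a) module \<Rightarrow> ('a \<Rightarrow> 'a) set \<Rightarrow> ('a \<Rightarrow> 'a, 'n) module \<Rightarrow> 'n set" where
  "B_invariants A B N =
     {m \<in> carrier N. \<forall>b\<in>B. b \<odot>\<^bsub>N\<^esub> m = L_map A (b \<one>\<^bsub>A\<^esub>) \<odot>\<^bsub>N\<^esub> m}"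


section \<open>The central closure\<close>

text \<open>
  In this section \<open>E\<close> is an injective hull of the \<open>B\<close>-module \<open>A\<close>, with embedding \<open>j\<close>.
  The sum of the images is the subgroup generated by their union.
\<close>

definition hat_mod ::
    "('k, 'p) ring_scheme \<Rightarrow> ('k, 'a) module \<Rightarrow> ('a \<Rightarrow> 'a) set \<Rightarrow> ('a \<Rightarrow> 'a, 'e) module
      \<Rightarrow> ('a \<Rightarrow> 'a, 'e) module" where
  "hat_mod k A B E = E\<lparr>carrier :=
     generate (add_monoid E) (\<Union>f\<in>Hom_mod (B_ring k A B) (A_mod A) E. f ` carrier A)\<rparr>"

abbreviation End_hat ::
    "('k, 'p) ring_scheme \<Rightarrow> ('k, 'a) module \<Rightarrow> ('a \<Rightarrow> 'a) set \<Rightarrow> ('a \<Rightarrow> 'a, 'e) module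
      \<Rightarrow> ('a \<Rightarrow> 'a, 'e \<Rightarrow> 'e) module" where
  "End_hat k A B E \<equiv> End_mod (B_ring k A B) (hat_mod k A B E)"

text \<open>
  The product of \<open>x = \<Sum> a\<^sub>p s\<^sub>p\<close> and \<open>y = \<Sum> b\<^sub>q t\<^sub>q\<close> is \<open>\<Sum> (a\<^sub>p b\<^sub>q) (s\<^sub>p t\<^sub>q)\<close>. Here \<open>s\<^sub>p\<close> stands for
  \<open>f\<^sub>p(1)\<close> and \<open>t\<^sub>q\<close> for \<open>g\<^sub>q(1)\<close> with \<open>f\<^sub>p\<close>, \<open>g\<^sub>q\<close> endomorphisms, so that \<open>a\<^sub>p s\<^sub>p = f\<^sub>p(a\<^sub>p)\<close> and
  \<open>(a\<^sub>p b\<^sub>q) (s\<^sub>p t\<^sub>q) = f\<^sub>p(g\<^sub>q(a\<^sub>p b\<^sub>q))\<close>.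
\<close>

definition hat_mult ::
    "('k, 'p) ring_scheme \<Rightarrow> ('k, 'a) module \<Rightarrow> ('a \<Rightarrow> 'a) set \<Rightarrow> ('a \<Rightarrow> 'a, 'e) module
      \<Rightarrow> ('a \<Rightarrow> 'e) \<Rightarrow> 'e \<Rightarrow> 'e \<Rightarrow> 'e" where
  "hat_mult k A B E j x y = (THE z. \<exists>(m::nat) (n::nat) a f b g.
     (\<forall>p<m. a p \<in> carrier A \<and> f p \<in> carrier (End_hat k A B E)) \<and>
     (\<forall>q<n. b q \<in> carrier A \<and> g q \<in> carrier (End_hat k A B E)) \<and>
     x = (\<Oplus>\<^bsub>E\<^esub>p\<in>{..<m}. f p (j (a p))) \<and>
     y = (\<Oplus>\<^bsub>E\<^esub>q\<in>{..<n}. g q (j (b q))) \<and>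
     z = (\<Oplus>\<^bsub>E\<^esub>p\<in>{..<m}. \<Oplus>\<^bsub>E\<^esub>q\<in>{..<n}. f p (g q (j (a p \<otimes>\<^bsub>A\<^esub> b q)))))"

text \<open>As a \<open>k\<close>-module, the central closure has the action of \<open>c \<cdot> id\<^sub>A \<in> B\<close>.\<close>

definition hat_alg ::
    "('k, 'p) ring_scheme \<Rightarrow> ('k, 'a) module \<Rightarrow> ('a \<Rightarrow> 'a) set \<Rightarrow> ('a \<Rightarrow> 'a, 'e) module
      \<Rightarrow> ('a \<Rightarrow> 'e) \<Rightarrow> ('k, 'e) module" where
  "hat_alg k A B E j = \<lparr>carrier = carrier (hat_mod k A B E),
     mult = hat_mult k A B E j,
     one = j \<one>\<^bsub>A\<^esub>,
     ring.zero = \<zero>\<^bsub>E\<^esub>,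
     add = add E,
     smult = (\<lambda>c x. (c \<odot>\<^bsub>End_mod k A\<^esub> \<one>\<^bsub>End_mod k A\<^esub>) \<odot>\<^bsub>E\<^esub> x)\<rparr>"

text \<open>
  The tensor product of \<open>A\<close> and \<open>End\<^sub>B(hat A)\<close> over \<open>A\<^sup>B\<close>, where \<open>z \<in> A\<^sup>B\<close> acts on the
  endomorphisms by \<open>(z f)(x) = z f(x) = L\<^sub>z \<cdot> f(x)\<close>.
\<close>

definition hat_tensor ::
    "('k, 'p) ring_scheme \<Rightarrow> ('k, 'a) module \<Rightarrow> ('a \<Rightarrow> 'a) set \<Rightarrow> ('a \<Rightarrow> 'a, 'e) module
      \<Rightarrow> ('a \<times> ('e \<Rightarrow> 'e) \<Rightarrow>\<^sub>0 int) set monoid" where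
  "hat_tensor k A B E = tensor_product (B_invariants A B (A_mod A)) A (End_hat k A B E)
     (mult A) (\<lambda>z f. L_map A z \<odot>\<^bsub>End_hat k A B E\<^esub> f)"

definition hat_pure ::
    "('k, 'p) ring_scheme \<Rightarrow> ('k, 'a) module \<Rightarrow> ('a \<Rightarrow> 'a) set \<Rightarrow> ('a \<Rightarrow> 'a, 'e) module
      \<Rightarrow> 'a \<Rightarrow> ('e \<Rightarrow> 'e) \<Rightarrow> ('a \<times> ('e \<Rightarrow> 'e) \<Rightarrow>\<^sub>0 int) set" where
  "hat_pure k A B E = pure_tensor (B_invariants A B (A_mod A)) A (End_hat k A B E)
     (mult A) (\<lambda>z f. L_map A z \<odot>\<^bsub>End_hat k A B E\<^esub> f)"

definition \<phi>_map ::
    "('k, 'p) ring_scheme \<Rightarrow> ('k, 'a) module \<Rightarrow> ('a \<Rightarrow> 'a) set \<Rightarrow> ('a \<Rightarrow> 'a, 'e) module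
      \<Rightarrow> ('a \<Rightarrow> 'e) \<Rightarrow> ('a \<times> ('e \<Rightarrow> 'e) \<Rightarrow>\<^sub>0 int) set \<Rightarrow> 'e" where
  "\<phi>_map k A B E j = (THE F.
     F \<in> hom (hat_tensor k A B E) (add_monoid (hat_alg k A B E j)) \<and>
     F \<in> extensional (carrier (hat_tensor k A B E)) \<and>
     (\<forall>a\<in>carrier A. \<forall>f\<in>carrier (End_hat k A B E). F (hat_pure k A B E a f) = f (j a)))"


section \<open>The ring of quotients \<open>Q\<^sub>0(A)\<close>\<close>

definition F_B ::
    "('k, 'p) ring_scheme \<Rightarrow> ('k, 'a) module \<Rightarrow> ('a \<Rightarrow> 'a) set \<Rightarrow> 'a set set" where
  "F_B k A B = {I. B_stable k A B I \<and> l_ann A I = {\<zero>\<^bsub>A\<^esub>} \<and> r_ann A I = {\<zero>\<^bsub>A\<^esub>}}"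

definition Hom_right :: "('k, 'a) module \<Rightarrow> 'a set \<Rightarrow> ('a \<Rightarrow> 'a) set" where
  "Hom_right A I = {f \<in> I \<rightarrow>\<^sub>E carrier A.
     (\<forall>x\<in>I. \<forall>y\<in>I. f (x \<oplus>\<^bsub>A\<^esub> y) = f x \<oplus>\<^bsub>A\<^esub> f y) \<and>
     (\<forall>x\<in>I. \<forall>a\<in>carrier A. f (x \<otimes>\<^bsub>A\<^esub> a) = f x \<otimes>\<^bsub>A\<^esub> a)}"

definition Q0_pre ::
    "('k, 'p) ring_scheme \<Rightarrow> ('k, 'a) module \<Rightarrow> ('a \<Rightarrow> 'a) set \<Rightarrow> ('a set \<times> ('a \<Rightarrow> 'a)) set" where
  "Q0_pre k A B = (SIGMA I : F_B k A B. Hom_right A I)"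

definition Q0_rel ::
    "('k, 'p) ring_scheme \<Rightarrow> ('k, 'a) module \<Rightarrow> ('a \<Rightarrow> 'a) set
      \<Rightarrow> (('a set \<times> ('a \<Rightarrow> 'a)) \<times> ('a set \<times> ('a \<Rightarrow> 'a))) set" where
  "Q0_rel k A B = {((I, f), (J, g)). (I, f) \<in> Q0_pre k A B \<and> (J, g) \<in> Q0_pre k A B \<and>
     (\<exists>K\<in>F_B k A B. K \<subseteq> I \<inter> J \<and> (\<forall>x\<in>K. f x = g x))}"

definition Q0_class ::
    "('k, 'p) ring_scheme \<Rightarrow> ('k, 'a) module \<Rightarrow> ('a \<Rightarrow> 'a) set \<Rightarrow> 'a set \<Rightarrow> ('a \<Rightarrow> 'a)
      \<Rightarrow> ('a set \<times> ('a \<Rightarrow> 'a)) set" where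
  "Q0_class k A B I f = Q0_rel k A B `` {(I, f)}"

text \<open>
  The product \<open>[f][g] = [f g : J I \<rightarrow> A]\<close> consists of the maps \<open>h : K \<rightarrow> A\<close> with \<open>K \<in> F_B\<close> that agree
  with \<open>f g\<close> on \<open>K \<inter> J I\<close>. If \<open>J I\<close> is \<open>B\<close>-stable, hence in \<open>F_B\<close>, this is the class of \<open>f g\<close>
  (lemma \<open>Q0_comp_eq_class\<close> below). For an arbitrary \<open>B\<close> the ideal \<open>J I\<close> need not be \<open>B\<close>-stable,
  and \<open>f g\<close> restricted to \<open>J I\<close> may or may not extend to some ideal in \<open>F_B\<close>; if it does not, the
  set is empty.
\<close>

definition Q0_comp ::
    "('k, 'p) ring_scheme \<Rightarrow> ('k, 'a) module \<Rightarrow> ('a \<Rightarrow> 'a) set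
      \<Rightarrow> 'a set \<Rightarrow> ('a \<Rightarrow> 'a) \<Rightarrow> 'a set \<Rightarrow> ('a \<Rightarrow> 'a) \<Rightarrow> ('a set \<times> ('a \<Rightarrow> 'a)) set" where
  "Q0_comp k A B I f J g =
     {(K, h) \<in> Q0_pre k A B. \<forall>x \<in> K \<inter> ideal_prod A J I. h x = f (g x)}"

lemma B_stable_imp_ideal:
  assumes A: "assoc_algebra k A" and B: "mult_algebra k A \<subseteq> B" and I: "B_stable k A B I"
  shows "ideal I A"
proof -
  interpret A: assoc_algebra k A by fact
  interpret I: submodule I "B_ring k A B" "A_mod A" by fact
  have sub: "I \<subseteq> carrier A" using I.subset by (simp add: A_mod_def)
  have LR: "L_map A a \<in> B" "R_map A a \<in> B" if "a \<in> carrier A" for a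
    using B that by (auto simp: mult_algebra_def)
  have "L_map A a x \<in> I" "R_map A a x \<in> I" if "a \<in> carrier A" "x \<in> I" for a x
    using I.smult_closed[of "L_map A a" x] I.smult_closed[of "R_map A a" x] LR that
    by (auto simp: B_ring_def A_mod_def)
  then have mul: "a \<otimes>\<^bsub>A\<^esub> x \<in> I" "x \<otimes>\<^bsub>A\<^esub> a \<in> I" if "a \<in> carrier A" "x \<in> I" for a x
    using that sub by (force simp: L_map_def R_map_def)+
  have "subgroup I (add_monoid A)"
  proof (rule A.add.subgroupI)
    show "I \<noteq> {}" using I.one_closed by auto
    show "\<ominus>\<^bsub>A\<^esub> a \<in> I" if "a \<in> I" for a
      using mul(1)[of "\<ominus>\<^bsub>A\<^esub> \<one>\<^bsub>A\<^esub>" a] that sub by (auto simp: A.l_minus subset_iff)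
    show "a \<oplus>\<^bsub>A\<^esub> b \<in> I" if "a \<in> I" "b \<in> I" for a b
      using I.m_closed[of a b] that by (simp add: A_mod_def)
  qed (use sub in auto)
  then show ?thesis by (intro idealI A.ring_axioms mul)
qed

lemma F_B_Int:
  assumes A: "assoc_algebra k A" and B: "mult_algebra k A \<subseteq> B"
    and I: "I \<in> F_B k A B" and J: "J \<in> F_B k A B"
  shows "I \<inter> J \<in> F_B k A B"
proof -
  interpret A: assoc_algebra k A by fact
  interpret I: ideal I A using B_stable_imp_ideal[OF A B] I by (simp add: F_B_def)
  interpret J: ideal J A using B_stable_imp_ideal[OF A B] J by (simp add: F_B_def)
  have anns: "l_ann A I = {\<zero>\<^bsub>A\<^esub>}" "r_ann A I = {\<zero>\<^bsub>A\<^esub>}" "l_ann A J = {\<zero>\<^bsub>A\<^esub>}" "r_ann A J = {\<zero>\<^bsub>A\<^esub>}"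
    using I J by (auto simp: F_B_def)
  interpret SI: submodule I "B_ring k A B" "A_mod A" using I by (simp add: F_B_def)
  interpret SJ: submodule J "B_ring k A B" "A_mod A" using J by (simp add: F_B_def)
  have "subgroup (I \<inter> J) (add_monoid (A_mod A))"
    by (rule subgroup.intro)
      (use SI.subset SI.m_closed SJ.m_closed SI.m_inv_closed SJ.m_inv_closed SI.one_closed SJ.one_closed
        in auto)
  then have "B_stable k A B (I \<inter> J)"
    using SI.smult_closed SJ.smult_closed by (auto simp: submodule_def submodule_axioms_def)
  moreover have "x = \<zero>\<^bsub>A\<^esub>" if x: "x \<in> l_ann A (I \<inter> J)" for x
  proof -
    have xc: "x \<in> carrier A" using x by (simp add: l_ann_def)
    have "x \<otimes>\<^bsub>A\<^esub> b = \<zero>\<^bsub>A\<^esub>" if b: "b \<in> J" for b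
    proof -
      have "x \<otimes>\<^bsub>A\<^esub> b \<in> l_ann A I"
        using x xc b J.Icarr I.Icarr I.I_l_closed J.I_r_closed
        by (auto simp: l_ann_def A.m_assoc)
      then show ?thesis using anns by simp
    qed
    then have "x \<in> l_ann A J" using xc by (simp add: l_ann_def)
    then show ?thesis using anns by simp
  qed
  moreover have "x = \<zero>\<^bsub>A\<^esub>" if x: "x \<in> r_ann A (I \<inter> J)" for x
  proof -
    have xc: "x \<in> carrier A" using x by (simp add: r_ann_def)
    have "b \<otimes>\<^bsub>A\<^esub> x = \<zero>\<^bsub>A\<^esub>" if b: "b \<in> J" for b
    proof -
      have "a \<otimes>\<^bsub>A\<^esub> (b \<otimes>\<^bsub>A\<^esub> x) = \<zero>\<^bsub>A\<^esub>" if a: "a \<in> I" for a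
        using x xc a b J.Icarr I.Icarr I.I_r_closed J.I_l_closed
        by (auto simp: r_ann_def simp flip: A.m_assoc)
      then have "b \<otimes>\<^bsub>A\<^esub> x \<in> r_ann A I" using xc b J.Icarr by (simp add: r_ann_def)
      then show ?thesis using anns by simp
    qed
    then have "x \<in> r_ann A J" using xc by (simp add: r_ann_def)
    then show ?thesis using anns by simp
  qed
  moreover have "\<zero>\<^bsub>A\<^esub> \<in> l_ann A (I \<inter> J)" "\<zero>\<^bsub>A\<^esub> \<in> r_ann A (I \<inter> J)"
    using I.Icarr by (auto simp: l_ann_def r_ann_def)
  ultimately have "B_stable k A B (I \<inter> J)"
      "l_ann A (I \<inter> J) = {\<zero>\<^bsub>A\<^esub>}" "r_ann A (I \<inter> J) = {\<zero>\<^bsub>A\<^esub>}" by blast+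
  then show ?thesis by (simp add: F_B_def)
qed

lemma Q0_comp_eq_class:
  assumes A: "assoc_algebra k A" and B: "mult_algebra k A \<subseteq> B"
    and f: "(I, f) \<in> Q0_pre k A B" and g: "(J, g) \<in> Q0_pre k A B"
    and stable: "B_stable k A B (ideal_prod A J I)"
  shows "Q0_comp k A B I f J g = Q0_class k A B (ideal_prod A J I) (\<lambda>x\<in>ideal_prod A J I. f (g x))"
proof -
  interpret A: assoc_algebra k A by fact
  have IF: "I \<in> F_B k A B" and JF: "J \<in> F_B k A B" using f g by (auto simp: Q0_pre_def)
  interpret I: ideal I A using B_stable_imp_ideal[OF A B] IF by (simp add: F_B_def)
  interpret J: ideal J A using B_stable_imp_ideal[OF A B] JF by (simp add: F_B_def)
  define D where "D = ideal_prod A J I"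
  interpret D: ideal D A using B_stable_imp_ideal[OF A B stable] by (simp add: D_def)
  have anns: "l_ann A I = {\<zero>\<^bsub>A\<^esub>}" "r_ann A I = {\<zero>\<^bsub>A\<^esub>}" "l_ann A J = {\<zero>\<^bsub>A\<^esub>}" "r_ann A J = {\<zero>\<^bsub>A\<^esub>}"
    using IF JF by (auto simp: F_B_def)
  have DI: "D \<subseteq> J" using A.ideal_prod_inter[OF J.ideal_axioms I.ideal_axioms] by (auto simp: D_def)
  have fc: "f x \<in> carrier A" "f (x \<otimes>\<^bsub>A\<^esub> a) = f x \<otimes>\<^bsub>A\<^esub> a" if "x \<in> I" "a \<in> carrier A" for x a
    using f that by (auto simp: Q0_pre_def Hom_right_def)
  have fa: "f (x \<oplus>\<^bsub>A\<^esub> y) = f x \<oplus>\<^bsub>A\<^esub> f y" if "x \<in> I" "y \<in> I" for x y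
    using f that by (auto simp: Q0_pre_def Hom_right_def)
  have gc: "g x \<in> carrier A" "g (x \<otimes>\<^bsub>A\<^esub> a) = g x \<otimes>\<^bsub>A\<^esub> a" if "x \<in> J" "a \<in> carrier A" for x a
    using g that by (auto simp: Q0_pre_def Hom_right_def)
  have ga: "g (x \<oplus>\<^bsub>A\<^esub> y) = g x \<oplus>\<^bsub>A\<^esub> g y" if "x \<in> J" "y \<in> J" for x y
    using g that by (auto simp: Q0_pre_def Hom_right_def)
  have gD: "g x \<in> I" if "x \<in> D" for x
    using that unfolding D_def
  proof (induction x rule: ideal_prod.induct)
    case (prod u v)
    then show ?case using gc[of u v] I.Icarr[of v] I.I_l_closed[of v "g u"] by simp
  next
    case (sum s t)
    then have "s \<in> J" "t \<in> J" using DI by (auto simp: D_def)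
    then show ?case using ga[of s t] sum I.a_closed[of "g s" "g t"] by simp
  qed
  have DF: "D \<in> F_B k A B"
  proof -
    have "x = \<zero>\<^bsub>A\<^esub>" if x: "x \<in> l_ann A D" for x
    proof -
      have xc: "x \<in> carrier A" using x by (simp add: l_ann_def)
      have "x \<otimes>\<^bsub>A\<^esub> b = \<zero>\<^bsub>A\<^esub>" if b: "b \<in> J" for b
      proof -
        have "x \<otimes>\<^bsub>A\<^esub> b \<in> l_ann A I"
          using x xc b J.Icarr I.Icarr
          by (auto simp: l_ann_def A.m_assoc D_def intro: ideal_prod.prod)
        then show ?thesis using anns by simp
      qed
      then have "x \<in> l_ann A J" using xc by (simp add: l_ann_def)
      then show ?thesis using anns by simp
    qed
    moreover have "x = \<zero>\<^bsub>A\<^esub>" if x: "x \<in> r_ann A D" for x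
    proof -
      have xc: "x \<in> carrier A" using x by (simp add: r_ann_def)
      have "b \<otimes>\<^bsub>A\<^esub> x = \<zero>\<^bsub>A\<^esub>" if b: "b \<in> I" for b
      proof -
        have "a \<otimes>\<^bsub>A\<^esub> (b \<otimes>\<^bsub>A\<^esub> x) = \<zero>\<^bsub>A\<^esub>" if a: "a \<in> J" for a
          using x xc a b J.Icarr I.Icarr
          by (auto simp: r_ann_def D_def intro: ideal_prod.prod simp flip: A.m_assoc)
        then have "b \<otimes>\<^bsub>A\<^esub> x \<in> r_ann A J" using xc b I.Icarr by (simp add: r_ann_def)
        then show ?thesis using anns by simp
      qed
      then have "x \<in> r_ann A I" using xc by (simp add: r_ann_def)
      then show ?thesis using anns by simp
    qed
    moreover have "\<zero>\<^bsub>A\<^esub> \<in> l_ann A D" "\<zero>\<^bsub>A\<^esub> \<in> r_ann A D"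
      using D.Icarr by (auto simp: l_ann_def r_ann_def)
    ultimately have "l_ann A D = {\<zero>\<^bsub>A\<^esub>}" "r_ann A D = {\<zero>\<^bsub>A\<^esub>}" by blast+
    then show ?thesis using stable by (simp add: F_B_def D_def)
  qed
  have fg: "(D, \<lambda>x\<in>D. f (g x)) \<in> Q0_pre k A B"
  proof -
    have "f (g x) \<in> carrier A" if "x \<in> D" for x
      using fc(1)[OF gD[OF that] A.zero_closed] .
    moreover have "f (g (x \<oplus>\<^bsub>A\<^esub> y)) = f (g x) \<oplus>\<^bsub>A\<^esub> f (g y)" if "x \<in> D" "y \<in> D" for x y
      using ga[OF subsetD[OF DI that(1)] subsetD[OF DI that(2)]] fa[OF gD[OF that(1)] gD[OF that(2)]]
      by simp
    moreover have "f (g (x \<otimes>\<^bsub>A\<^esub> a)) = f (g x) \<otimes>\<^bsub>A\<^esub> a" if "x \<in> D" "a \<in> carrier A" for x a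
      using gc(2)[OF subsetD[OF DI that(1)] that(2)] fc(2)[OF gD[OF that(1)] that(2)] by simp
    ultimately show ?thesis
      using DF D.a_closed D.I_r_closed by (simp add: Q0_pre_def Hom_right_def)
  qed
  show ?thesis
    unfolding D_def[symmetric]
  proof (intro equalityI subsetI)
    fix p assume "p \<in> Q0_comp k A B I f J g"
    then obtain K h where p: "p = (K, h)" "(K, h) \<in> Q0_pre k A B"
        and eq: "\<And>x. x \<in> K \<inter> D \<Longrightarrow> h x = f (g x)"
      by (auto simp: Q0_comp_def D_def)
    have "D \<inter> K \<in> F_B k A B" using p DF by (intro F_B_Int[OF A B]) (auto simp: Q0_pre_def)
    then show "p \<in> Q0_class k A B D (\<lambda>x\<in>D. f (g x))"
      using p fg eq by (auto simp: Q0_class_def Q0_rel_def intro!: bexI[of _ "D \<inter> K"])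
  next
    fix p assume "p \<in> Q0_class k A B D (\<lambda>x\<in>D. f (g x))"
    then obtain K h N where p: "p = (K, h)" "(K, h) \<in> Q0_pre k A B" and N: "N \<in> F_B k A B" "N \<subseteq> D \<inter> K"
        and eq: "\<And>x. x \<in> N \<Longrightarrow> (if x \<in> D then f (g x) else undefined) = h x"
      by (auto simp: Q0_class_def Q0_rel_def restrict_def)
    interpret K: ideal K A using B_stable_imp_ideal[OF A B] p by (auto simp: Q0_pre_def F_B_def)
    interpret N: ideal N A using B_stable_imp_ideal[OF A B] N by (auto simp: F_B_def)
    have hc: "h x \<in> carrier A" "h (x \<otimes>\<^bsub>A\<^esub> a) = h x \<otimes>\<^bsub>A\<^esub> a" if "x \<in> K" "a \<in> carrier A" for x a
      using p that by (auto simp: Q0_pre_def Hom_right_def)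
    have "h x = f (g x)" if x: "x \<in> K" "x \<in> D" for x
    proof -
      have xc: "x \<in> carrier A" "x \<in> J" using x K.Icarr DI by auto
      have c: "h x \<in> carrier A" "f (g x) \<in> carrier A"
        using hc[of x "\<zero>\<^bsub>A\<^esub>"] fc[of "g x" "\<zero>\<^bsub>A\<^esub>"] gD x by auto
      have "(h x \<ominus>\<^bsub>A\<^esub> f (g x)) \<otimes>\<^bsub>A\<^esub> n = \<zero>\<^bsub>A\<^esub>" if n: "n \<in> N" for n
      proof -
        have nc: "n \<in> carrier A" using n N.Icarr by simp
        have xn: "x \<otimes>\<^bsub>A\<^esub> n \<in> N" using N.I_l_closed n xc by simp
        have "h (x \<otimes>\<^bsub>A\<^esub> n) = f (g (x \<otimes>\<^bsub>A\<^esub> n))" using eq[OF xn] xn N by auto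
        then have "h x \<otimes>\<^bsub>A\<^esub> n = f (g x) \<otimes>\<^bsub>A\<^esub> n"
          using hc[OF x(1) nc] gc[OF xc(2) nc] fc[OF gD[OF x(2)] nc] by simp
        then show ?thesis using c nc
          by (simp add: A.minus_eq A.l_distr A.l_minus A.r_neg)
      qed
      then have "h x \<ominus>\<^bsub>A\<^esub> f (g x) \<in> l_ann A N" using c by (simp add: l_ann_def)
      then have "h x \<ominus>\<^bsub>A\<^esub> f (g x) = \<zero>\<^bsub>A\<^esub>" using N by (auto simp: F_B_def)
      then show ?thesis using c by (simp add: A.r_right_minus_eq)
    qed
    then show "p \<in> Q0_comp k A B I f J g" using p by (auto simp: Q0_comp_def D_def)
  qed
qed

definition Q0 ::
    "('k, 'p) ring_scheme \<Rightarrow> ('k, 'a) module \<Rightarrow> ('a \<Rightarrow> 'a) set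
      \<Rightarrow> ('k, ('a set \<times> ('a \<Rightarrow> 'a)) set) module" where
  "Q0 k A B = \<lparr>carrier = Q0_pre k A B // Q0_rel k A B,
     mult = (\<lambda>X Y. \<Union>(I, f)\<in>X. \<Union>(J, g)\<in>Y. Q0_comp k A B I f J g),
     one = Q0_class k A B (carrier A) (\<lambda>x\<in>carrier A. x),
     ring.zero = Q0_class k A B (carrier A) (\<lambda>x\<in>carrier A. \<zero>\<^bsub>A\<^esub>),
     add = (\<lambda>X Y. \<Union>(I, f)\<in>X. \<Union>(J, g)\<in>Y. Q0_class k A B (I \<inter> J) (\<lambda>x\<in>I \<inter> J. f x \<oplus>\<^bsub>A\<^esub> g x)),
     smult = (\<lambda>c X. \<Union>(I, f)\<in>X. Q0_class k A B I (\<lambda>x\<in>I. c \<odot>\<^bsub>A\<^esub> f x))\<rparr>"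

definition \<iota>_map ::
    "('k, 'p) ring_scheme \<Rightarrow> ('k, 'a) module \<Rightarrow> ('a \<Rightarrow> 'a) set \<Rightarrow> 'a
      \<Rightarrow> ('a set \<times> ('a \<Rightarrow> 'a)) set" where
  "\<iota>_map k A B a = Q0_class k A B (carrier A) (L_map A a)"


section \<open>The map from the central closure to \<open>Q\<^sub>0(A)\<close>\<close>

text \<open>\<open>I\<^sub>f = f\<^sup>-\<^sup>1(A) \<inter> A\<close>, as a subset of \<open>A\<close>.\<close>

definition I_of :: "('k, 'a) module \<Rightarrow> ('a \<Rightarrow> 'e) \<Rightarrow> ('e \<Rightarrow> 'e) \<Rightarrow> 'a set" where
  "I_of A j f = {a \<in> carrier A. f (j a) \<in> j ` carrier A}"

definition \<psi>_map ::
    "('k, 'p) ring_scheme \<Rightarrow> ('k, 'a) module \<Rightarrow> ('a \<Rightarrow> 'a) set \<Rightarrow> ('a \<Rightarrow> 'e) \<Rightarrow> ('e \<Rightarrow> 'e)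
      \<Rightarrow> ('a set \<times> ('a \<Rightarrow> 'a)) set" where
  "\<psi>_map k A B j f =
     Q0_class k A B (I_of A j f) (\<lambda>x\<in>I_of A j f. inv_into (carrier A) j (f (j x)))"

definition \<psi>_star ::
    "('k, 'p) ring_scheme \<Rightarrow> ('k, 'a) module \<Rightarrow> ('a \<Rightarrow> 'a) set \<Rightarrow> ('a \<Rightarrow> 'a, 'e) module
      \<Rightarrow> ('a \<Rightarrow> 'e) \<Rightarrow> ('a \<times> ('e \<Rightarrow> 'e) \<Rightarrow>\<^sub>0 int) set \<Rightarrow> ('a set \<times> ('a \<Rightarrow> 'a)) set" where
  "\<psi>_star k A B E j = (THE F.
     F \<in> hom (hat_tensor k A B E) (add_monoid (Q0 k A B)) \<and>
     F \<in> extensional (carrier (hat_tensor k A B E)) \<and>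
     (\<forall>a\<in>carrier A. \<forall>f\<in>carrier (End_hat k A B E).
        F (hat_pure k A B E a f) = \<iota>_map k A B a \<otimes>\<^bsub>Q0 k A B\<^esub> \<psi>_map k A B j f))"

definition \<psi>_bar ::
    "('k, 'p) ring_scheme \<Rightarrow> ('k, 'a) module \<Rightarrow> ('a \<Rightarrow> 'a) set \<Rightarrow> ('a \<Rightarrow> 'a, 'e) module
      \<Rightarrow> ('a \<Rightarrow> 'e) \<Rightarrow> 'e \<Rightarrow> ('a set \<times> ('a \<Rightarrow> 'a)) set" where
  "\<psi>_bar k A B E j x = (THE q. \<exists>\<gamma>\<in>carrier (hat_tensor k A B E).
     \<phi>_map k A B E j \<gamma> = x \<and> \<psi>_star k A B E j \<gamma> = q)"

end

theory Submission
  imports Defs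
begin

text \<open>
  Every element \<open>x\<close> of the central closure acts on \<open>A\<close> by left multiplication \<open>c \<mapsto> xc\<close>, with values in
  the central closure. On a suitable ideal \<open>I\<close> in \<open>F\<^sub>B\<close> the values lie in \<open>A\<close>, and \<open>c \<mapsto> xc\<close> is a right
  \<open>A\<close>-linear map \<open>I \<rightarrow> A\<close>. The map of the theorem sends \<open>x\<close> to the class of this map. Once it is
  described like this, without tensors, it is multiplicative because \<open>(xy)c = x(yc)\<close>, and it is
  injective because \<open>xI = 0\<close> forces \<open>x = 0\<close>.

  The description rests on three facts. First, an essential \<open>B\<close>-stable ideal \<open>I\<close> belongs to \<open>F\<^sub>B\<close>
  (\<open>essential_in_F_B\<close>): by (i), the intersection of \<open>I\<close> with either of its annihilators is a
  \<open>B\<close>-stable ideal of square zero. Second, a homomorphism from \<open>A\<close> to its injective hull with an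
  essential kernel vanishes (\<open>Hom_essential_kernel\<close>). It follows that the endomorphism ring of the
  central closure is commutative (\<open>End_commute\<close>), and commutativity is what makes the product of the
  central closure well defined (\<open>hat_mult_eq\<close>). This product satisfies \<open>xc = R\<^sub>c \<cdot> x\<close> for \<open>c \<in> A\<close>.
  Third, an element of the central closure that is annihilated by an ideal \<open>I\<close> in \<open>F\<^sub>B\<close> is zero
  (\<open>hat_ann_zero\<close>): by (ii) these elements form a \<open>B\<close>-submodule, it meets \<open>A\<close> in the left
  annihilator of \<open>I\<close>, which is zero, and \<open>A\<close> is essential in the central closure.

  Let \<open>\<Psi> x\<close> be the set of all pairs \<open>(I, h)\<close> with \<open>I\<close> in \<open>F\<^sub>B\<close> and \<open>h(c) = xc\<close> on \<open>I\<close>. By the third fact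
  it is a whole equivalence class, so it is an element of \<open>Q\<^sub>0(A)\<close>, and its algebraic properties can
  be read off from representatives. The composite of \<open>\<phi>\<close> with \<open>\<Psi>\<close> has the values that define \<open>\<psi>\<^sup>*\<close> on
  pure tensors, hence it is \<open>\<psi>\<^sup>*\<close>, and since \<open>\<phi>\<close> is surjective, the induced map is \<open>\<Psi>\<close>.
\<close>

section \<open>Modules over noncommutative rings\<close>

context left_module
begin

lemma smult_r_zero: "a \<in> carrier R \<Longrightarrow> a \<odot>\<^bsub>M\<^esub> \<zero>\<^bsub>M\<^esub> = \<zero>\<^bsub>M\<^esub>"
  using smult_r_distr[of a "\<zero>\<^bsub>M\<^esub>" "\<zero>\<^bsub>M\<^esub>"] smult_closed[of a "\<zero>\<^bsub>M\<^esub>"]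
  by (simp add: M.add.r_cancel_one')

lemma smult_l_zero: "x \<in> carrier M \<Longrightarrow> \<zero>\<^bsub>R\<^esub> \<odot>\<^bsub>M\<^esub> x = \<zero>\<^bsub>M\<^esub>"
  using smult_l_distr[of "\<zero>\<^bsub>R\<^esub>" "\<zero>\<^bsub>R\<^esub>" x] smult_closed[of "\<zero>\<^bsub>R\<^esub>" x]
  by (simp add: M.add.r_cancel_one')

lemma smult_minus_one:
  assumes "x \<in> carrier M"
  shows "(\<ominus>\<^bsub>R\<^esub> \<one>\<^bsub>R\<^esub>) \<odot>\<^bsub>M\<^esub> x = \<ominus>\<^bsub>M\<^esub> x"
proof -
  have "(\<ominus>\<^bsub>R\<^esub> \<one>\<^bsub>R\<^esub>) \<odot>\<^bsub>M\<^esub> x \<oplus>\<^bsub>M\<^esub> x = \<zero>\<^bsub>M\<^esub>"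
    using smult_l_distr[of "\<ominus>\<^bsub>R\<^esub> \<one>\<^bsub>R\<^esub>" "\<one>\<^bsub>R\<^esub>" x] assms
    by (simp add: smult_one smult_l_zero R.l_neg)
  then show ?thesis
    using M.minus_equality[of "(\<ominus>\<^bsub>R\<^esub> \<one>\<^bsub>R\<^esub>) \<odot>\<^bsub>M\<^esub> x" x] assms smult_closed by simp
qed

lemma smult_r_minus:
  assumes "a \<in> carrier R" "x \<in> carrier M"
  shows "a \<odot>\<^bsub>M\<^esub> (\<ominus>\<^bsub>M\<^esub> x) = \<ominus>\<^bsub>M\<^esub> (a \<odot>\<^bsub>M\<^esub> x)"
proof -
  have "a \<odot>\<^bsub>M\<^esub> (\<ominus>\<^bsub>M\<^esub> x) \<oplus>\<^bsub>M\<^esub> a \<odot>\<^bsub>M\<^esub> x = \<zero>\<^bsub>M\<^esub>"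
    using smult_r_distr[of a "\<ominus>\<^bsub>M\<^esub> x" x] assms by (simp add: smult_r_zero M.l_neg)
  then show ?thesis
    using M.minus_equality[of "a \<odot>\<^bsub>M\<^esub> (\<ominus>\<^bsub>M\<^esub> x)" "a \<odot>\<^bsub>M\<^esub> x"] assms smult_closed by simp
qed

lemma submoduleI:
  assumes "N \<subseteq> carrier M" "\<zero>\<^bsub>M\<^esub> \<in> N"
    and "\<And>x y. \<lbrakk>x \<in> N; y \<in> N\<rbrakk> \<Longrightarrow> x \<oplus>\<^bsub>M\<^esub> y \<in> N"
    and smult: "\<And>a x. \<lbrakk>a \<in> carrier R; x \<in> N\<rbrakk> \<Longrightarrow> a \<odot>\<^bsub>M\<^esub> x \<in> N"
  shows "submodule N R M"
proof (intro submodule.intro submodule_axioms.intro M.add.subgroupI smult)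
  show "\<ominus>\<^bsub>M\<^esub> x \<in> N" if "x \<in> N" for x
    using smult[of "\<ominus>\<^bsub>R\<^esub> \<one>\<^bsub>R\<^esub>" x] smult_minus_one[of x] that assms(1) by auto
qed (use assms in auto)

lemma submoduleD:
  assumes "submodule N R M"
  shows "N \<subseteq> carrier M" "\<zero>\<^bsub>M\<^esub> \<in> N"
    and "\<And>x y. \<lbrakk>x \<in> N; y \<in> N\<rbrakk> \<Longrightarrow> x \<oplus>\<^bsub>M\<^esub> y \<in> N"
    and "\<And>x. x \<in> N \<Longrightarrow> \<ominus>\<^bsub>M\<^esub> x \<in> N"
    and "\<And>a x. \<lbrakk>a \<in> carrier R; x \<in> N\<rbrakk> \<Longrightarrow> a \<odot>\<^bsub>M\<^esub> x \<in> N"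
proof -
  interpret N: submodule N R M by fact
  show "N \<subseteq> carrier M" "\<zero>\<^bsub>M\<^esub> \<in> N" "\<And>x y. \<lbrakk>x \<in> N; y \<in> N\<rbrakk> \<Longrightarrow> x \<oplus>\<^bsub>M\<^esub> y \<in> N"
    "\<And>x. x \<in> N \<Longrightarrow> \<ominus>\<^bsub>M\<^esub> x \<in> N" "\<And>a x. \<lbrakk>a \<in> carrier R; x \<in> N\<rbrakk> \<Longrightarrow> a \<odot>\<^bsub>M\<^esub> x \<in> N"
    using N.subset N.one_closed N.m_closed N.m_inv_closed N.smult_closed by (auto simp: a_inv_def)
qed

lemma submodule_Int:
  assumes "submodule N R M" "submodule N' R M"
  shows "submodule (N \<inter> N') R M"
  using submoduleD[OF assms(1)] submoduleD[OF assms(2)] by (intro submoduleI) auto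

lemma left_module_submodule:
  assumes "submodule N R M"
  shows "left_module R (M\<lparr>carrier := N\<rparr>)"
proof -
  note N = submoduleD[OF assms]
  have "abelian_group (M\<lparr>carrier := N\<rparr>)"
  proof (rule abelian_groupI)
    show "\<exists>y\<in>carrier (M\<lparr>carrier := N\<rparr>). y \<oplus>\<^bsub>M\<lparr>carrier := N\<rparr>\<^esub> x = \<zero>\<^bsub>M\<lparr>carrier := N\<rparr>\<^esub>"
      if "x \<in> carrier (M\<lparr>carrier := N\<rparr>)" for x
      using that N(1,4) M.l_neg by (intro bexI[of _ "\<ominus>\<^bsub>M\<^esub> x"]) auto
  qed (use N in \<open>auto simp: M.a_ac subset_iff\<close>)
  then show ?thesis
    using N(1,5)
    by (auto simp: left_module_def left_module_axioms_def R.ring_axioms subset_iff smult_l_distr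
        smult_r_distr smult_assoc smult_one)
qed

end

lemma Hom_modD:
  assumes "f \<in> Hom_mod R M N"
  shows "\<And>x. x \<in> carrier M \<Longrightarrow> f x \<in> carrier N"
    and "\<And>x y. \<lbrakk>x \<in> carrier M; y \<in> carrier M\<rbrakk> \<Longrightarrow> f (x \<oplus>\<^bsub>M\<^esub> y) = f x \<oplus>\<^bsub>N\<^esub> f y"
    and "\<And>r x. \<lbrakk>r \<in> carrier R; x \<in> carrier M\<rbrakk> \<Longrightarrow> f (r \<odot>\<^bsub>M\<^esub> x) = r \<odot>\<^bsub>N\<^esub> f x"
    and "f \<in> extensional (carrier M)"
  using assms by (auto simp: Hom_mod_def PiE_iff)

text \<open>
  Homomorphisms are extensional functions here, so a formula that has the right properties on the
  carrier becomes a homomorphism after restriction.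
\<close>

lemma Hom_modI:
  assumes "\<And>x. x \<in> carrier M \<Longrightarrow> f x \<in> carrier N"
    and "\<And>x y. \<lbrakk>x \<in> carrier M; y \<in> carrier M\<rbrakk> \<Longrightarrow> f (x \<oplus>\<^bsub>M\<^esub> y) = f x \<oplus>\<^bsub>N\<^esub> f y"
    and "\<And>r x. \<lbrakk>r \<in> carrier R; x \<in> carrier M\<rbrakk> \<Longrightarrow> f (r \<odot>\<^bsub>M\<^esub> x) = r \<odot>\<^bsub>N\<^esub> f x"
    and "left_module R M"
  shows "(\<lambda>x\<in>carrier M. f x) \<in> Hom_mod R M N"
proof -
  interpret M: left_module R M by fact
  show ?thesis
    unfolding Hom_mod_def using assms(1-3) M.smult_closed M.M.a_closed by auto
qed

locale left_module_pair = M: left_module R M + N: left_module R N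
  for R :: "('r, 'p) ring_scheme" and M :: "('r, 'm) module" and N :: "('r, 'n) module"
begin

lemma Hom_mod_zero:
  assumes f: "f \<in> Hom_mod R M N"
  shows "f \<zero>\<^bsub>M\<^esub> = \<zero>\<^bsub>N\<^esub>"
proof -
  have "f \<zero>\<^bsub>M\<^esub> \<oplus>\<^bsub>N\<^esub> f \<zero>\<^bsub>M\<^esub> = f \<zero>\<^bsub>M\<^esub>"
    using Hom_modD(2)[OF f M.M.zero_closed M.M.zero_closed] by simp
  then show ?thesis using Hom_modD(1)[OF f M.M.zero_closed] by (simp add: N.M.add.r_cancel_one)
qed

lemma Hom_mod_minus:
  assumes "f \<in> Hom_mod R M N" "x \<in> carrier M"
  shows "f (\<ominus>\<^bsub>M\<^esub> x) = \<ominus>\<^bsub>N\<^esub> f x"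
  using Hom_modD(1,3)[OF assms(1)] assms(2) M.smult_minus_one[of x] N.smult_minus_one[of "f x"]
    M.R.add.inv_closed[OF M.R.one_closed] by metis

lemma submodule_image:
  assumes f: "f \<in> Hom_mod R M N" and L: "submodule L R M"
  shows "submodule (f ` L) R N"
proof -
  note L = M.submoduleD[OF L] and f = Hom_modD[OF f] Hom_mod_zero[OF f]
  show ?thesis
  proof (rule N.submoduleI)
    show "f ` L \<subseteq> carrier N" using f(1) L(1) by auto
    show "\<zero>\<^bsub>N\<^esub> \<in> f ` L" using f(5) L(2) by (metis image_eqI)
    show "x \<oplus>\<^bsub>N\<^esub> y \<in> f ` L" if xy: "x \<in> f ` L" "y \<in> f ` L" for x y
    proof -
      from xy obtain u v where uv: "x = f u" "y = f v" "u \<in> L" "v \<in> L" by blast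
      then show ?thesis
        using f(2)[OF subsetD[OF L(1) uv(3)] subsetD[OF L(1) uv(4)]] L(3) by (intro image_eqI[of _ _ "u \<oplus>\<^bsub>M\<^esub> v"]) auto
    qed
    show "a \<odot>\<^bsub>N\<^esub> x \<in> f ` L" if a: "a \<in> carrier R" "x \<in> f ` L" for a x
    proof -
      from a obtain u where u: "x = f u" "u \<in> L" by blast
      then show ?thesis
        using f(3)[OF a(1) subsetD[OF L(1) u(2)]] a L(5) by (intro image_eqI[of _ _ "a \<odot>\<^bsub>M\<^esub> u"]) auto
    qed
  qed
qed

lemma submodule_vimage:
  assumes f: "f \<in> Hom_mod R M N" and L: "submodule L R N"
  shows "submodule {x \<in> carrier M. f x \<in> L} R M"
  using Hom_modD[OF f] Hom_mod_zero[OF f] N.submoduleD[OF L]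
  by (intro M.submoduleI) (auto simp: M.smult_closed)

lemma submodule_equalizer:
  assumes f: "f \<in> Hom_mod R M N" and g: "g \<in> Hom_mod R M N"
  shows "submodule {x \<in> carrier M. f x = g x} R M"
  using Hom_modD[OF f] Hom_mod_zero[OF f] Hom_modD[OF g] Hom_mod_zero[OF g]
  by (intro M.submoduleI) (auto simp: M.smult_closed)

text \<open>
  A submodule \<open>L\<close> that meets the preimage of \<open>N'\<close> trivially has an image that meets \<open>N'\<close> trivially,
  because only \<open>0\<close> in \<open>L\<close> is mapped into \<open>N'\<close>. So the image of \<open>L\<close> is zero, which puts \<open>L\<close> inside the
  preimage.
\<close>

lemma essential_vimage:
  assumes f: "f \<in> Hom_mod R M N" and ess: "essential_submodule R N N'"
  shows "essential_submodule R M {x \<in> carrier M. f x \<in> N'}"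
  unfolding essential_submodule_def
proof (intro conjI allI impI)
  note N' = ess[unfolded essential_submodule_def, THEN conjunct1]
  show "submodule {x \<in> carrier M. f x \<in> N'} R M" using submodule_vimage[OF f N'] .
  fix L assume L: "submodule L R M \<and> L \<inter> {x \<in> carrier M. f x \<in> N'} = {\<zero>\<^bsub>M\<^esub>}"
  have sL: "submodule L R M" and disj: "L \<inter> {x \<in> carrier M. f x \<in> N'} \<subseteq> {\<zero>\<^bsub>M\<^esub>}"
    using L by simp_all
  note Ls = M.submoduleD[OF sL] and f0 = Hom_mod_zero[OF f]
  have zero: "x = \<zero>\<^bsub>M\<^esub>" if "x \<in> L" "f x \<in> N'" for x
    using subsetD[OF disj, of x] subsetD[OF Ls(1), of x] that by simp
  have "f ` L \<inter> N' = {\<zero>\<^bsub>N\<^esub>}"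
  proof (intro equalityI subsetI)
    show "y \<in> {\<zero>\<^bsub>N\<^esub>}" if y: "y \<in> f ` L \<inter> N'" for y
    proof -
      from y obtain x where x: "y = f x" "x \<in> L" "f x \<in> N'" by blast
      then show ?thesis using zero[of x] f0 by simp
    qed
    show "y \<in> f ` L \<inter> N'" if "y \<in> {\<zero>\<^bsub>N\<^esub>}" for y
      using that imageI[OF Ls(2), of f] f0 N.submoduleD(2)[OF N'] by simp
  qed
  then have fL: "f ` L = {\<zero>\<^bsub>N\<^esub>}"
    using ess submodule_image[OF f sL] unfolding essential_submodule_def by meson
  have "x = \<zero>\<^bsub>M\<^esub>" if "x \<in> L" for x
  proof (rule zero[OF that])
    have "f x = \<zero>\<^bsub>N\<^esub>" using imageI[OF that, of f] fL by simp
    then show "f x \<in> N'" using N.submoduleD(2)[OF N'] by simp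
  qed
  then show "L = {\<zero>\<^bsub>M\<^esub>}" using Ls(2) by blast
qed

end

lemma (in left_module) essential_Int:
  assumes "essential_submodule R M N" "essential_submodule R M N'"
  shows "essential_submodule R M (N \<inter> N')"
  unfolding essential_submodule_def
proof (intro conjI allI impI)
  have s: "submodule N R M" "submodule N' R M" using assms by (auto simp: essential_submodule_def)
  show "submodule (N \<inter> N') R M" using submodule_Int[OF s] .
  fix L assume L: "submodule L R M \<and> L \<inter> (N \<inter> N') = {\<zero>\<^bsub>M\<^esub>}"
  then have "L \<inter> N = {\<zero>\<^bsub>M\<^esub>}"
    using assms(2) submodule_Int[OF _ s(1), of L] unfolding essential_submodule_def
    by (metis Int_assoc)
  then show "L = {\<zero>\<^bsub>M\<^esub>}" using assms(1) L by (auto simp: essential_submodule_def)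
qed


section \<open>The universal property of the tensor product\<close>

text \<open>
  The four closure conditions are exactly what is needed for the defining relations of the tensor
  product to lie in the free abelian group, so that they generate a subgroup of it.
\<close>

locale tensor_setup =
  fixes Z :: "'z set" and X :: "('x, 'p) ring_scheme" and Y :: "('y, 'q) ring_scheme"
    and ract :: "'x \<Rightarrow> 'z \<Rightarrow> 'x" and lact :: "'z \<Rightarrow> 'y \<Rightarrow> 'y"
  assumes X_add: "\<lbrakk>x \<in> carrier X; x' \<in> carrier X\<rbrakk> \<Longrightarrow> x \<oplus>\<^bsub>X\<^esub> x' \<in> carrier X"
    and Y_add: "\<lbrakk>y \<in> carrier Y; y' \<in> carrier Y\<rbrakk> \<Longrightarrow> y \<oplus>\<^bsub>Y\<^esub> y' \<in> carrier Y"
    and ract_closed: "\<lbrakk>x \<in> carrier X; z \<in> Z\<rbrakk> \<Longrightarrow> ract x z \<in> carrier X"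
    and lact_closed: "\<lbrakk>y \<in> carrier Y; z \<in> Z\<rbrakk> \<Longrightarrow> lact z y \<in> carrier Y"
begin

abbreviation "Free \<equiv> free_Abelian_group (carrier X \<times> carrier Y)"
abbreviation "Ker \<equiv> tensor_kernel Z X Y ract lact"
abbreviation "T \<equiv> tensor_product Z X Y ract lact"
abbreviation "pure \<equiv> pure_tensor Z X Y ract lact"

sublocale Free: comm_group Free by (rule abelian_free_Abelian_group)

lemma frag_in_Free: "\<lbrakk>x \<in> carrier X; y \<in> carrier Y\<rbrakk> \<Longrightarrow> frag_of (x, y) \<in> carrier Free"
  by simp

lemma Free_diff: "\<lbrakk>u \<in> carrier Free; v \<in> carrier Free\<rbrakk> \<Longrightarrow> u - v \<in> carrier Free"
  using keys_diff[of u v] by (force simp del: frag_of_in_free_Abelian_group)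

lemma relations_subset: "tensor_relations Z X Y ract lact \<subseteq> carrier Free"
  unfolding tensor_relations_def
  by (auto intro!: Free_diff frag_in_Free X_add Y_add ract_closed lact_closed
      simp del: carrier_free_Abelian_group_iff)

lemma Ker_normal: "Ker \<lhd> Free"
  unfolding tensor_kernel_def
  using Free.generate_is_subgroup[OF relations_subset] Free.normal_iff_subgroup by blast

lemma T_carrier: "carrier T = (\<lambda>w. Ker #>\<^bsub>Free\<^esub> w) ` carrier Free"
  by (simp add: tensor_product_def carrier_FactGroup)

lemma pure_eq: "pure x y = Ker #>\<^bsub>Free\<^esub> frag_of (x, y)"
  by (simp add: pure_tensor_def)

lemma pure_in_T: "\<lbrakk>x \<in> carrier X; y \<in> carrier Y\<rbrakk> \<Longrightarrow> pure x y \<in> carrier T"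
  unfolding pure_eq T_carrier by (intro imageI frag_in_Free)

lemma T_group: "group T"
  unfolding tensor_product_def using Ker_normal by (simp add: normal.factorgroup_is_group)

lemma class_diff:
  assumes "u \<in> carrier Free" "v \<in> carrier Free"
  shows "Ker #>\<^bsub>Free\<^esub> (u - v) = (Ker #>\<^bsub>Free\<^esub> u) \<otimes>\<^bsub>T\<^esub> inv\<^bsub>T\<^esub> (Ker #>\<^bsub>Free\<^esub> v)"
proof -
  interpret T: group_hom Free T "\<lambda>w. Ker #>\<^bsub>Free\<^esub> w"
    using T_group normal.r_coset_hom_Mod[OF Ker_normal]
    by (simp add: group_hom_def group_hom_axioms_def Free.group_axioms tensor_product_def)
  have "u - v = u \<otimes>\<^bsub>Free\<^esub> inv\<^bsub>Free\<^esub> v" using assms(2) by simp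
  then show ?thesis
    using T.hom_mult[OF assms(1) Free.inv_closed[OF assms(2)]] T.hom_inv[OF assms(2)] by (simp only:)
qed

text \<open>
  The pure tensors generate the tensor product as a group.
\<close>

lemma hom_unique:
  assumes G: "group G" and F: "F \<in> hom T G" and F': "F' \<in> hom T G"
    and eq: "\<And>x y. \<lbrakk>x \<in> carrier X; y \<in> carrier Y\<rbrakk> \<Longrightarrow> F (pure x y) = F' (pure x y)"
    and t: "t \<in> carrier T"
  shows "F t = F' t"
proof -
  interpret F: group_hom T G F
    using T_group G F by (simp add: group_hom_def group_hom_axioms_def)
  interpret F': group_hom T G F'
    using T_group G F' by (simp add: group_hom_def group_hom_axioms_def)
  have "F (Ker #>\<^bsub>Free\<^esub> w) = F' (Ker #>\<^bsub>Free\<^esub> w)" if "Poly_Mapping.keys w \<subseteq> carrier X \<times> carrier Y" for w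
  proof (rule free_Abelian_group_induct[OF that])
    have "Ker #>\<^bsub>Free\<^esub> 0 = \<one>\<^bsub>T\<^esub>"
      using Free.coset_mult_one[of Ker] subgroup.subset[OF normal_imp_subgroup[OF Ker_normal]]
      by (simp add: tensor_product_def)
    then show "F (Ker #>\<^bsub>Free\<^esub> 0) = F' (Ker #>\<^bsub>Free\<^esub> 0)" using F.hom_one F'.hom_one by simp
  next
    fix u v
    assume uv: "Poly_Mapping.keys u \<subseteq> carrier X \<times> carrier Y" "Poly_Mapping.keys v \<subseteq> carrier X \<times> carrier Y"
      and eq: "F (Ker #>\<^bsub>Free\<^esub> u) = F' (Ker #>\<^bsub>Free\<^esub> u)" "F (Ker #>\<^bsub>Free\<^esub> v) = F' (Ker #>\<^bsub>Free\<^esub> v)"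
    have "Ker #>\<^bsub>Free\<^esub> u \<in> carrier T" "Ker #>\<^bsub>Free\<^esub> v \<in> carrier T"
      using uv by (auto simp: T_carrier)
    then show "F (Ker #>\<^bsub>Free\<^esub> (u - v)) = F' (Ker #>\<^bsub>Free\<^esub> (u - v))"
      using F.hom_mult[of "Ker #>\<^bsub>Free\<^esub> u" "inv\<^bsub>T\<^esub> (Ker #>\<^bsub>Free\<^esub> v)"]
        F'.hom_mult[of "Ker #>\<^bsub>Free\<^esub> u" "inv\<^bsub>T\<^esub> (Ker #>\<^bsub>Free\<^esub> v)"]
        F.hom_inv[of "Ker #>\<^bsub>Free\<^esub> v"] F'.hom_inv[of "Ker #>\<^bsub>Free\<^esub> v"]
        uv eq class_diff[of u v] group.inv_closed[OF T_group]
      by (simp del: F.hom_mult F'.hom_mult F.hom_inv F'.hom_inv)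
  next
    fix p assume "p \<in> carrier X \<times> carrier Y"
    then show "F (Ker #>\<^bsub>Free\<^esub> frag_of p) = F' (Ker #>\<^bsub>Free\<^esub> frag_of p)"
      using eq[of "fst p" "snd p"] by (auto simp: pure_eq)
  qed
  then show ?thesis using t by (auto simp: T_carrier)
qed

lemma hom_exists:
  assumes G: "comm_group G"
    and \<beta>: "\<And>x y. \<lbrakk>x \<in> carrier X; y \<in> carrier Y\<rbrakk> \<Longrightarrow> \<beta> x y \<in> carrier G"
    and add_l: "\<And>x x' y. \<lbrakk>x \<in> carrier X; x' \<in> carrier X; y \<in> carrier Y\<rbrakk> \<Longrightarrow>
      \<beta> (x \<oplus>\<^bsub>X\<^esub> x') y = \<beta> x y \<otimes>\<^bsub>G\<^esub> \<beta> x' y"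
    and add_r: "\<And>x y y'. \<lbrakk>x \<in> carrier X; y \<in> carrier Y; y' \<in> carrier Y\<rbrakk> \<Longrightarrow>
      \<beta> x (y \<oplus>\<^bsub>Y\<^esub> y') = \<beta> x y \<otimes>\<^bsub>G\<^esub> \<beta> x y'"
    and bal: "\<And>x y z. \<lbrakk>x \<in> carrier X; y \<in> carrier Y; z \<in> Z\<rbrakk> \<Longrightarrow> \<beta> (ract x z) y = \<beta> x (lact z y)"
  obtains F where "F \<in> hom T G" "F \<in> extensional (carrier T)"
    "\<And>x y. \<lbrakk>x \<in> carrier X; y \<in> carrier Y\<rbrakk> \<Longrightarrow> F (pure x y) = \<beta> x y"
proof -
  interpret G: comm_group G by fact
  have "(\<lambda>(x, y). \<beta> x y) ` (carrier X \<times> carrier Y) \<subseteq> carrier G" using \<beta> by auto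
  from G.free_Abelian_group_universal[OF this] obtain h where h: "h \<in> hom Free G"
    and h_of: "\<And>p. p \<in> carrier X \<times> carrier Y \<Longrightarrow> h (frag_of p) = (\<lambda>(x, y). \<beta> x y) p" by metis
  interpret h: group_hom Free G h
    using h by (simp add: group_hom_def group_hom_axioms_def Free.group_axioms G.group_axioms)
  have hd: "h (u - v) = h u \<otimes>\<^bsub>G\<^esub> inv\<^bsub>G\<^esub> h v" if "u \<in> carrier Free" "v \<in> carrier Free" for u v
  proof -
    have "u - v = u \<otimes>\<^bsub>Free\<^esub> inv\<^bsub>Free\<^esub> v" using that(2) by simp
    then show ?thesis
      using h.hom_mult[OF that(1) Free.inv_closed[OF that(2)]] h.hom_inv[OF that(2)] by (simp only:)
  qed
  \<comment> \<open>Each of the three kinds of relations expresses one of the hypotheses on \<open>\<beta>\<close>.\<close>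
  have rel: "tensor_relations Z X Y ract lact \<subseteq> kernel Free G h"
  proof
    fix r assume r: "r \<in> tensor_relations Z X Y ract lact"
    then have rc: "r \<in> carrier Free" using relations_subset by blast
    from r consider
        (l) x x' y where "r = frag_of (x \<oplus>\<^bsub>X\<^esub> x', y) - frag_of (x, y) - frag_of (x', y)"
            "x \<in> carrier X" "x' \<in> carrier X" "y \<in> carrier Y"
      | (r) x y y' where "r = frag_of (x, y \<oplus>\<^bsub>Y\<^esub> y') - frag_of (x, y) - frag_of (x, y')"
            "x \<in> carrier X" "y \<in> carrier Y" "y' \<in> carrier Y"
      | (b) x y z where "r = frag_of (ract x z, y) - frag_of (x, lact z y)"
            "x \<in> carrier X" "y \<in> carrier Y" "z \<in> Z"
      unfolding tensor_relations_def by blast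
    then have "h r = \<one>\<^bsub>G\<^esub>"
    proof cases
      case l
      note m = frag_in_Free[OF X_add[OF l(2,3)] l(4)] frag_in_Free[OF l(2,4)] frag_in_Free[OF l(3,4)]
      have "h r = (\<beta> x y \<otimes>\<^bsub>G\<^esub> \<beta> x' y \<otimes>\<^bsub>G\<^esub> inv\<^bsub>G\<^esub> \<beta> x y) \<otimes>\<^bsub>G\<^esub> inv\<^bsub>G\<^esub> \<beta> x' y"
        unfolding l(1) using m l X_add
        by (simp add: hd[OF Free_diff[OF m(1,2)] m(3)] hd[OF m(1,2)] h_of add_l del: carrier_free_Abelian_group_iff)
      then show ?thesis using \<beta>[OF l(2,4)] \<beta>[OF l(3,4)] by (simp add: G.m_ac)
    next
      case r
      note m = frag_in_Free[OF r(2) Y_add[OF r(3,4)]] frag_in_Free[OF r(2,3)] frag_in_Free[OF r(2,4)]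
      have "h r = (\<beta> x y \<otimes>\<^bsub>G\<^esub> \<beta> x y' \<otimes>\<^bsub>G\<^esub> inv\<^bsub>G\<^esub> \<beta> x y) \<otimes>\<^bsub>G\<^esub> inv\<^bsub>G\<^esub> \<beta> x y'"
        unfolding r(1) using m r Y_add
        by (simp add: hd[OF Free_diff[OF m(1,2)] m(3)] hd[OF m(1,2)] h_of add_r del: carrier_free_Abelian_group_iff)
      then show ?thesis using \<beta>[OF r(2,3)] \<beta>[OF r(2,4)] by (simp add: G.m_ac)
    next
      case b
      note m = frag_in_Free[OF ract_closed[OF b(2,4)] b(3)] frag_in_Free[OF b(2) lact_closed[OF b(3,4)]]
      have "h r = \<beta> x (lact z y) \<otimes>\<^bsub>G\<^esub> inv\<^bsub>G\<^esub> \<beta> x (lact z y)"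
        unfolding b(1) using m b ract_closed lact_closed
        by (simp add: hd[OF m] h_of bal del: carrier_free_Abelian_group_iff)
      then show ?thesis using \<beta>[OF b(2) lact_closed[OF b(3,4)]] by simp
    qed
    then show "r \<in> kernel Free G h" using rc by (simp add: kernel_def)
  qed
  have "Ker \<subseteq> kernel Free G h"
    unfolding tensor_kernel_def by (rule Free.generate_subgroup_incl[OF rel h.subgroup_kernel])
  from h.FactGroup_universal_kernel[OF Ker_normal this] obtain g
    where g: "g \<in> hom T G" "\<And>w. w \<in> carrier Free \<Longrightarrow> g (Ker #>\<^bsub>Free\<^esub> w) = h w"
    unfolding tensor_product_def by metis
  interpret T: group T by (rule T_group)
  show thesis
  proof (rule that[of "restrict g (carrier T)"])
    show "restrict g (carrier T) \<in> hom T G" using g(1) by (auto simp: hom_def Pi_iff)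
    fix x y assume xy: "x \<in> carrier X" "y \<in> carrier Y"
    then show "restrict g (carrier T) (pure x y) = \<beta> x y"
      using pure_in_T g(2)[OF frag_in_Free[OF xy]] h_of[of "(x, y)"] by (simp add: pure_eq)
  qed simp
qed

text \<open>
  In this form uniqueness evaluates the description operators by which maps out of a tensor product
  are introduced.
\<close>

lemma the_hom:
  assumes G: "group G" and F: "F \<in> hom T G" and ext: "F \<in> extensional (carrier T)"
    and \<beta>: "\<And>x y. \<lbrakk>x \<in> carrier X; y \<in> carrier Y\<rbrakk> \<Longrightarrow> F (pure x y) = \<beta> x y"
  shows "(THE F. F \<in> hom T G \<and> F \<in> extensional (carrier T) \<and>
    (\<forall>x\<in>carrier X. \<forall>y\<in>carrier Y. F (pure x y) = \<beta> x y)) = F"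
proof (rule the_equality, intro conjI ballI F ext \<beta>)
  fix F' assume F': "F' \<in> hom T G \<and> F' \<in> extensional (carrier T) \<and>
    (\<forall>x\<in>carrier X. \<forall>y\<in>carrier Y. F' (pure x y) = \<beta> x y)"
  have "F' t = F t" if "t \<in> carrier T" for t
    by (rule hom_unique[OF G conjunct1[OF F'] F _ that]) (use F' \<beta> in simp)
  then show "F' = F" by (rule extensionalityI[OF conjunct1[OF conjunct2[OF F']] ext])
qed

end


section \<open>The central closure of a semiprime algebra\<close>

lemma (in abelian_group) minus_eq_zero_iff:
  assumes "x \<in> carrier G" "y \<in> carrier G"
  shows "x \<ominus> y = \<zero> \<longleftrightarrow> x = y"
  using assms minus_equality[of x "\<ominus> y"] by (auto simp: a_minus_def r_neg)

locale central_closure =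
  fixes k :: "'k ring" and A :: "('k, 'a) module" and B :: "('a \<Rightarrow> 'a) set"
    and E :: "('a \<Rightarrow> 'a, 'e) module" and j :: "'a \<Rightarrow> 'e"
  assumes A_algebra: "assoc_algebra k A"
    and B_subalgebra: "k_subalgebra k (End_mod k A) B"
    and mult_algebra_subset: "mult_algebra k A \<subseteq> B"
    and semiprime: "B_semiprime k A B"
    and hull: "injective_hull (B_ring k A B) (A_mod A) E j"
    and ann_stable: "\<And>I. essential_submodule (B_ring k A B) (A_mod A) I \<Longrightarrow>
           B_stable k A B (l_ann A I) \<and> B_stable k A B (r_ann A I)"
begin

abbreviation "BR \<equiv> B_ring k A B"
abbreviation "AM \<equiv> A_mod A"
abbreviation "hat \<equiv> hat_mod k A B E"
abbreviation "H \<equiv> carrier hat"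
abbreviation "End \<equiv> Hom_mod BR hat hat"

sublocale A: assoc_algebra k A by (rule A_algebra)

sublocale E: left_module BR E
  using hull by (simp add: injective_hull_def injective_module_def)

subsection \<open>The operators in \<open>B\<close>\<close>

lemma carrier_BR [simp]: "carrier BR = B"
  by (simp add: B_ring_def)

lemma AM_simps [simp]:
  "carrier AM = carrier A" "add AM = add A" "\<zero>\<^bsub>AM\<^esub> = \<zero>\<^bsub>A\<^esub>" "b \<odot>\<^bsub>AM\<^esub> x = b x"
  by (simp_all add: A_mod_def)

lemma B_Hom: "b \<in> B \<Longrightarrow> b \<in> Hom_mod k A A"
  using B_subalgebra subringE(1)[of B "End_mod k A"] by (auto simp: k_subalgebra_def End_mod_def)

lemma B_apply:
  assumes "b \<in> B"
  shows "\<And>x. x \<in> carrier A \<Longrightarrow> b x \<in> carrier A"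
    and "\<And>x y. \<lbrakk>x \<in> carrier A; y \<in> carrier A\<rbrakk> \<Longrightarrow> b (x \<oplus>\<^bsub>A\<^esub> y) = b x \<oplus>\<^bsub>A\<^esub> b y"
  using Hom_modD[OF B_Hom[OF assms]] by auto

lemma L_in_B: "a \<in> carrier A \<Longrightarrow> L_map A a \<in> B"
  and R_in_B: "a \<in> carrier A \<Longrightarrow> R_map A a \<in> B"
  using mult_algebra_subset by (auto simp: mult_algebra_def)

lemma scalar_in_B: "c \<in> carrier k \<Longrightarrow> c \<odot>\<^bsub>End_mod k A\<^esub> \<one>\<^bsub>End_mod k A\<^esub> \<in> B"
  using B_subalgebra subringE(3)[of B "End_mod k A"] by (auto simp: k_subalgebra_def)

lemma scalar_apply: "x \<in> carrier A \<Longrightarrow> (c \<odot>\<^bsub>End_mod k A\<^esub> \<one>\<^bsub>End_mod k A\<^esub>) x = c \<odot>\<^bsub>A\<^esub> x"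
  by (simp add: End_mod_def)

lemma BR_mult: "b \<otimes>\<^bsub>BR\<^esub> b' = (\<lambda>x\<in>carrier A. b (b' x))"
  and BR_add: "b \<oplus>\<^bsub>BR\<^esub> b' = (\<lambda>x\<in>carrier A. b x \<oplus>\<^bsub>A\<^esub> b' x)"
  and BR_one: "\<one>\<^bsub>BR\<^esub> = (\<lambda>x\<in>carrier A. x)"
  by (simp_all add: B_ring_def End_mod_def)

lemma L_apply: "x \<in> carrier A \<Longrightarrow> L_map A a x = a \<otimes>\<^bsub>A\<^esub> x"
  and R_apply: "x \<in> carrier A \<Longrightarrow> R_map A a x = x \<otimes>\<^bsub>A\<^esub> a"
  by (simp_all add: L_map_def R_map_def)

sublocale AM: left_module BR AM
proof -
  have "abelian_group AM"
  proof (rule abelian_groupI)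
    show "\<exists>y\<in>carrier AM. y \<oplus>\<^bsub>AM\<^esub> x = \<zero>\<^bsub>AM\<^esub>" if "x \<in> carrier AM" for x
      using that A.l_neg by (intro bexI[of _ "\<ominus>\<^bsub>A\<^esub> x"]) auto
  qed (auto simp: A.a_ac)
  then show "left_module BR AM"
    by (auto simp: left_module_def left_module_axioms_def E.R.ring_axioms B_apply BR_mult BR_add BR_one)
qed

abbreviation ract :: "'e \<Rightarrow> 'a \<Rightarrow> 'e" (infixl "\<triangleleft>" 70) where "x \<triangleleft> a \<equiv> R_map A a \<odot>\<^bsub>E\<^esub> x"
abbreviation lact :: "'a \<Rightarrow> 'e \<Rightarrow> 'e" (infixr "\<triangleright>" 70) where "a \<triangleright> x \<equiv> L_map A a \<odot>\<^bsub>E\<^esub> x"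

lemma act_closed:
  assumes "a \<in> carrier A" "x \<in> carrier E"
  shows "x \<triangleleft> a \<in> carrier E" "a \<triangleright> x \<in> carrier E"
  using assms by (auto intro!: E.smult_closed L_in_B R_in_B)

lemma act_add:
  assumes "a \<in> carrier A" "x \<in> carrier E" "y \<in> carrier E"
  shows "(x \<oplus>\<^bsub>E\<^esub> y) \<triangleleft> a = x \<triangleleft> a \<oplus>\<^bsub>E\<^esub> y \<triangleleft> a" "a \<triangleright> (x \<oplus>\<^bsub>E\<^esub> y) = a \<triangleright> x \<oplus>\<^bsub>E\<^esub> a \<triangleright> y"
  using assms by (auto intro!: E.smult_r_distr L_in_B R_in_B)

lemma ract_add:
  assumes "a \<in> carrier A" "b \<in> carrier A" "x \<in> carrier E"
  shows "x \<triangleleft> (a \<oplus>\<^bsub>A\<^esub> b) = x \<triangleleft> a \<oplus>\<^bsub>E\<^esub> x \<triangleleft> b"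
proof -
  have "R_map A (a \<oplus>\<^bsub>A\<^esub> b) = R_map A a \<oplus>\<^bsub>BR\<^esub> R_map A b"
    using assms by (auto simp: BR_add R_map_def A.r_distr)
  then show ?thesis using assms by (simp add: E.smult_l_distr R_in_B)
qed

lemma ract_assoc:
  assumes "a \<in> carrier A" "b \<in> carrier A" "x \<in> carrier E"
  shows "x \<triangleleft> (a \<otimes>\<^bsub>A\<^esub> b) = x \<triangleleft> a \<triangleleft> b"
proof -
  have "R_map A (a \<otimes>\<^bsub>A\<^esub> b) = R_map A b \<otimes>\<^bsub>BR\<^esub> R_map A a"
    using assms by (auto simp: BR_mult R_map_def A.m_assoc)
  then show ?thesis using assms by (simp add: E.smult_assoc R_in_B)
qed

lemma ract_one: "x \<in> carrier E \<Longrightarrow> x \<triangleleft> \<one>\<^bsub>A\<^esub> = x"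
proof -
  assume "x \<in> carrier E"
  moreover have "R_map A \<one>\<^bsub>A\<^esub> = \<one>\<^bsub>BR\<^esub>" by (auto simp: BR_one R_map_def)
  ultimately show ?thesis using E.smult_one by simp
qed

subsection \<open>The embedding of \<open>A\<close>\<close>

lemma j_Hom: "j \<in> Hom_mod BR AM E"
  using hull by (simp add: injective_hull_def)

lemma j_inj: "inj_on j (carrier A)"
  using hull by (simp add: injective_hull_def)

lemma j_essential: "essential_submodule BR E (j ` carrier A)"
  using hull by (simp add: injective_hull_def)

sublocale AE: left_module_pair BR AM E ..

lemma j_closed: "a \<in> carrier A \<Longrightarrow> j a \<in> carrier E"
  using Hom_modD(1)[OF j_Hom] by simp

lemma j_add: "\<lbrakk>a \<in> carrier A; b \<in> carrier A\<rbrakk> \<Longrightarrow> j (a \<oplus>\<^bsub>A\<^esub> b) = j a \<oplus>\<^bsub>E\<^esub> j b"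
  using Hom_modD(2)[OF j_Hom] by simp

lemma j_smult: "\<lbrakk>b \<in> B; a \<in> carrier A\<rbrakk> \<Longrightarrow> j (b a) = b \<odot>\<^bsub>E\<^esub> j a"
  using Hom_modD(3)[OF j_Hom] by simp

lemma j_zero: "j \<zero>\<^bsub>A\<^esub> = \<zero>\<^bsub>E\<^esub>"
  using AE.Hom_mod_zero[OF j_Hom] by simp

lemma j_eq_iff: "\<lbrakk>a \<in> carrier A; b \<in> carrier A\<rbrakk> \<Longrightarrow> j a = j b \<longleftrightarrow> a = b"
  using j_inj by (auto simp: inj_on_eq_iff)

lemma j_mult:
  assumes "a \<in> carrier A" "b \<in> carrier A"
  shows "j (a \<otimes>\<^bsub>A\<^esub> b) = j a \<triangleleft> b" "j (a \<otimes>\<^bsub>A\<^esub> b) = a \<triangleright> j b"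
  using assms j_smult[OF R_in_B, of b a] j_smult[OF L_in_B, of a b] by (simp_all add: R_apply L_apply)

lemma Hom_mult:
  assumes "h \<in> Hom_mod BR AM E" "a \<in> carrier A" "b \<in> carrier A"
  shows "h (a \<otimes>\<^bsub>A\<^esub> b) = h a \<triangleleft> b" "h (a \<otimes>\<^bsub>A\<^esub> b) = a \<triangleright> h b"
  using assms Hom_modD(3)[OF assms(1), of "R_map A b" a] Hom_modD(3)[OF assms(1), of "L_map A a" b]
  by (simp_all add: R_apply L_apply R_in_B L_in_B)

subsection \<open>Essential ideals\<close>

lemma stable_ideal: "B_stable k A B I \<Longrightarrow> ideal I A"
  using B_stable_imp_ideal[OF A_algebra mult_algebra_subset] .

text \<open>
  Semiprimeness is formulated with ideal products; for applications the elementwise form is handier.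
\<close>

lemma stable_square_zero:
  assumes K: "B_stable k A B K" and sq: "\<And>x y. \<lbrakk>x \<in> K; y \<in> K\<rbrakk> \<Longrightarrow> x \<otimes>\<^bsub>A\<^esub> y = \<zero>\<^bsub>A\<^esub>"
  shows "K = {\<zero>\<^bsub>A\<^esub>}"
proof -
  have z: "\<zero>\<^bsub>A\<^esub> \<in> K" using AM.submoduleD(2)[OF K] by simp
  have "x = \<zero>\<^bsub>A\<^esub>" if "x \<in> ideal_prod A K K" for x
    using that
  proof (induction x rule: ideal_prod.induct)
    case (prod u v)
    then show ?case using sq by simp
  qed simp
  moreover have "\<zero>\<^bsub>A\<^esub> \<in> ideal_prod A K K" using ideal_prod.prod[OF z z, of A] by simp
  ultimately have "ideal_prod A K K = {\<zero>\<^bsub>A\<^esub>}" by blast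
  then show ?thesis using semiprime K by (simp add: B_semiprime_def)
qed

text \<open>
  Let \<open>L\<close> be the left or the right annihilator of \<open>I\<close>. Products of two elements of \<open>L \<inter> I\<close> vanish, so
  \<open>L \<inter> I = 0\<close> by semiprimeness, and then \<open>L = 0\<close> because \<open>I\<close> is essential.
\<close>

lemma essential_in_F_B:
  assumes I: "essential_submodule BR AM I"
  shows "I \<in> F_B k A B"
proof -
  have sI: "B_stable k A B I" using I by (simp add: essential_submodule_def)
  have *: "L = {\<zero>\<^bsub>A\<^esub>}"
    if L: "B_stable k A B L" and sq: "\<And>x y. \<lbrakk>x \<in> L \<inter> I; y \<in> L \<inter> I\<rbrakk> \<Longrightarrow> x \<otimes>\<^bsub>A\<^esub> y = \<zero>\<^bsub>A\<^esub>" for L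
  proof -
    have "L \<inter> I = {\<zero>\<^bsub>A\<^esub>}" by (rule stable_square_zero[OF AM.submodule_Int[OF L sI] sq])
    then show ?thesis using I L by (auto simp: essential_submodule_def)
  qed
  have "l_ann A I = {\<zero>\<^bsub>A\<^esub>}"
    using ann_stable[OF I] by (intro *) (auto simp: l_ann_def)
  moreover have "r_ann A I = {\<zero>\<^bsub>A\<^esub>}"
    using ann_stable[OF I] by (intro *) (auto simp: r_ann_def)
  ultimately show ?thesis using sI by (simp add: F_B_def)
qed

lemma F_B_D:
  assumes "I \<in> F_B k A B"
  shows "I \<subseteq> carrier A" "\<And>x. \<lbrakk>x \<in> carrier A; \<And>c. c \<in> I \<Longrightarrow> x \<otimes>\<^bsub>A\<^esub> c = \<zero>\<^bsub>A\<^esub>\<rbrakk> \<Longrightarrow> x = \<zero>\<^bsub>A\<^esub>"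
    "\<And>a x. \<lbrakk>a \<in> carrier A; x \<in> I\<rbrakk> \<Longrightarrow> a \<otimes>\<^bsub>A\<^esub> x \<in> I"
    "\<And>a x. \<lbrakk>a \<in> carrier A; x \<in> I\<rbrakk> \<Longrightarrow> x \<otimes>\<^bsub>A\<^esub> a \<in> I"
    "\<And>x y. \<lbrakk>x \<in> I; y \<in> I\<rbrakk> \<Longrightarrow> x \<oplus>\<^bsub>A\<^esub> y \<in> I" "\<zero>\<^bsub>A\<^esub> \<in> I"
proof -
  interpret I: ideal I A using stable_ideal assms by (simp add: F_B_def)
  show "I \<subseteq> carrier A" "\<And>a x. \<lbrakk>a \<in> carrier A; x \<in> I\<rbrakk> \<Longrightarrow> a \<otimes>\<^bsub>A\<^esub> x \<in> I"
    "\<And>a x. \<lbrakk>a \<in> carrier A; x \<in> I\<rbrakk> \<Longrightarrow> x \<otimes>\<^bsub>A\<^esub> a \<in> I"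
    "\<And>x y. \<lbrakk>x \<in> I; y \<in> I\<rbrakk> \<Longrightarrow> x \<oplus>\<^bsub>A\<^esub> y \<in> I" "\<zero>\<^bsub>A\<^esub> \<in> I"
    using I.Icarr I.I_l_closed I.I_r_closed by auto
  show "x = \<zero>\<^bsub>A\<^esub>" if "x \<in> carrier A" "\<And>c. c \<in> I \<Longrightarrow> x \<otimes>\<^bsub>A\<^esub> c = \<zero>\<^bsub>A\<^esub>" for x
  proof -
    have "x \<in> l_ann A I" using that by (simp add: l_ann_def)
    then show ?thesis using assms by (simp add: F_B_def)
  qed
qed

lemma F_B_inter: "\<lbrakk>I \<in> F_B k A B; J \<in> F_B k A B\<rbrakk> \<Longrightarrow> I \<inter> J \<in> F_B k A B"
  by (rule F_B_Int[OF A_algebra mult_algebra_subset])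

lemma carrier_in_F_B: "carrier A \<in> F_B k A B"
proof -
  have "essential_submodule BR AM (carrier A)"
    unfolding essential_submodule_def
  proof (intro conjI allI impI)
    show "B_stable k A B (carrier A)" using AM.submoduleI[of "carrier A"] B_apply(1) by simp
    fix L assume L: "B_stable k A B L \<and> L \<inter> carrier A = {\<zero>\<^bsub>AM\<^esub>}"
    then have "L \<subseteq> carrier A" using AM.submoduleD(1)[of L] by simp
    then show "L = {\<zero>\<^bsub>AM\<^esub>}" using L by (simp add: inf.absorb1)
  qed
  then show ?thesis by (rule essential_in_F_B)
qed

text \<open>
  If \<open>h(u) = v\<close> with \<open>v\<close> in \<open>A\<close>, then \<open>vc = h(uc) = 0\<close> for all \<open>c\<close> in the kernel \<open>K\<close>, and \<open>K\<close> has zero left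
  annihilator. So the image of \<open>h\<close> meets \<open>A\<close> trivially, and \<open>A\<close> is essential in \<open>E\<close>.
\<close>

lemma Hom_essential_kernel:
  assumes h: "h \<in> Hom_mod BR AM E" and K: "essential_submodule BR AM K"
    and hK: "\<And>c. c \<in> K \<Longrightarrow> h c = \<zero>\<^bsub>E\<^esub>" and a: "a \<in> carrier A"
  shows "h a = \<zero>\<^bsub>E\<^esub>"
proof -
  note KF = F_B_D[OF essential_in_F_B[OF K]]
  have img: "submodule (h ` carrier A) BR E"
    using AE.submodule_image[OF h, of "carrier A"] AM.submoduleI[of "carrier A"] B_apply(1) by simp
  have "h ` carrier A \<inter> j ` carrier A \<subseteq> {\<zero>\<^bsub>E\<^esub>}"
  proof
    fix y assume "y \<in> h ` carrier A \<inter> j ` carrier A"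
    then obtain u v where uv: "y = h u" "u \<in> carrier A" "y = j v" "v \<in> carrier A" by blast
    have "v = \<zero>\<^bsub>A\<^esub>"
    proof (rule KF(2)[OF uv(4)])
      fix c assume c: "c \<in> K"
      have cc: "c \<in> carrier A" using c KF(1) by blast
      have "j (v \<otimes>\<^bsub>A\<^esub> c) = h (u \<otimes>\<^bsub>A\<^esub> c)"
        using j_mult(1)[OF uv(4) cc] Hom_mult(1)[OF h uv(2) cc] uv by simp
      then have "j (v \<otimes>\<^bsub>A\<^esub> c) = j \<zero>\<^bsub>A\<^esub>" using hK[OF KF(3)[OF uv(2) c]] j_zero by simp
      then show "v \<otimes>\<^bsub>A\<^esub> c = \<zero>\<^bsub>A\<^esub>" using uv cc by (simp add: j_eq_iff)
    qed
    then show "y \<in> {\<zero>\<^bsub>E\<^esub>}" using uv j_zero by simp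
  qed
  then have "h ` carrier A \<inter> j ` carrier A = {\<zero>\<^bsub>E\<^esub>}"
    using E.submoduleD(2)[OF img] j_zero A.zero_closed by (metis IntI empty_iff image_eqI subset_singletonD)
  then have "h ` carrier A = {\<zero>\<^bsub>E\<^esub>}"
    using j_essential img unfolding essential_submodule_def by meson
  then show ?thesis using a by blast
qed

subsection \<open>Elements and endomorphisms of the central closure\<close>

lemma hat_simps [simp]: "add hat = add E" "\<zero>\<^bsub>hat\<^esub> = \<zero>\<^bsub>E\<^esub>" "smult hat = smult E"
  by (simp_all add: hat_mod_def)

text \<open>
  The central closure is generated by images of homomorphisms as a group; negatives need no case of
  their own because \<open>- f(a) = f(- a)\<close>.
\<close>

lemma hat_induct [consumes 1, case_names hom add]:
  assumes x: "x \<in> H"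
    and hom: "\<And>f a. \<lbrakk>f \<in> Hom_mod BR AM E; a \<in> carrier A\<rbrakk> \<Longrightarrow> P (f a)"
    and add: "\<And>x y. \<lbrakk>x \<in> H; y \<in> H; P x; P y\<rbrakk> \<Longrightarrow> P (x \<oplus>\<^bsub>E\<^esub> y)"
  shows "P x"
proof -
  have "x \<in> generate (add_monoid E) (\<Union>f\<in>Hom_mod BR AM E. f ` carrier A)"
    using x by (simp add: hat_mod_def)
  then show ?thesis
  proof (induction x rule: generate.induct)
    case one
    then show ?case using hom[OF j_Hom A.zero_closed] by (simp add: j_zero)
  next
    case (incl x)
    then show ?case using hom by blast
  next
    case (inv x)
    then obtain f a where fa: "x = f a" "f \<in> Hom_mod BR AM E" "a \<in> carrier A" by blast
    then have "f (\<ominus>\<^bsub>AM\<^esub> a) = \<ominus>\<^bsub>E\<^esub> x" using AE.Hom_mod_minus[of f a] by simp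
    then show ?case using hom[OF fa(2), of "\<ominus>\<^bsub>AM\<^esub> a"] fa(3) AM.M.a_inv_closed[of a]
      by (simp add: a_inv_def)
  next
    case (eng x y)
    then show ?case using add[of x y] by (simp add: hat_mod_def)
  qed
qed

lemma Hom_in_hat: "\<lbrakk>f \<in> Hom_mod BR AM E; a \<in> carrier A\<rbrakk> \<Longrightarrow> f a \<in> H"
  by (auto simp: hat_mod_def intro!: generate.incl)

lemma hat_add: "\<lbrakk>x \<in> H; y \<in> H\<rbrakk> \<Longrightarrow> x \<oplus>\<^bsub>E\<^esub> y \<in> H"
  using generate.eng[of x "add_monoid E"] by (simp add: hat_mod_def)

lemma hat_in_E: "x \<in> H \<Longrightarrow> x \<in> carrier E"
proof (induction x rule: hat_induct)
  case (hom f a)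
  then show ?case using Hom_modD(1)[OF hom(1)] by simp
qed simp

lemma j_in_hat: "a \<in> carrier A \<Longrightarrow> j a \<in> H"
  by (rule Hom_in_hat[OF j_Hom])

lemma hat_smult:
  assumes b: "b \<in> B" and x: "x \<in> H"
  shows "b \<odot>\<^bsub>E\<^esub> x \<in> H"
  using x
proof (induction x rule: hat_induct)
  case (hom f a)
  then have "f (b a) \<in> H" using B_apply(1)[OF b] by (intro Hom_in_hat) auto
  then show ?case using Hom_modD(3)[OF hom(1), of b a] b hom(2) by simp
next
  case (add x y)
  then show ?case using E.smult_r_distr[of b x y] b hat_in_E hat_add by simp
qed

lemma hat_submodule: "submodule H BR E"
  by (rule E.submoduleI) (use hat_in_E hat_add hat_smult j_in_hat[OF A.zero_closed] in \<open>auto simp: j_zero\<close>)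

lemma hat_eq: "hat = E\<lparr>carrier := H\<rparr>"
  by (simp add: hat_mod_def)

sublocale hat: left_module BR hat
  by (subst hat_eq) (rule E.left_module_submodule[OF hat_submodule])

sublocale HH: left_module_pair BR hat hat ..

lemma End_closed: "\<lbrakk>f \<in> End; x \<in> H\<rbrakk> \<Longrightarrow> f x \<in> H"
  and End_add: "\<lbrakk>f \<in> End; x \<in> H; y \<in> H\<rbrakk> \<Longrightarrow> f (x \<oplus>\<^bsub>E\<^esub> y) = f x \<oplus>\<^bsub>E\<^esub> f y"
  and End_smult: "\<lbrakk>f \<in> End; b \<in> B; x \<in> H\<rbrakk> \<Longrightarrow> f (b \<odot>\<^bsub>E\<^esub> x) = b \<odot>\<^bsub>E\<^esub> f x"
  and End_zero: "f \<in> End \<Longrightarrow> f \<zero>\<^bsub>E\<^esub> = \<zero>\<^bsub>E\<^esub>"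
  using Hom_modD[of f BR hat hat] HH.Hom_mod_zero[of f] by auto

lemma End_act:
  assumes "f \<in> End" "a \<in> carrier A" "x \<in> H"
  shows "f (x \<triangleleft> a) = f x \<triangleleft> a" "f (a \<triangleright> x) = a \<triangleright> f x"
  using assms by (auto intro!: End_smult L_in_B R_in_B)

lemma hat_act:
  assumes "a \<in> carrier A" "x \<in> H"
  shows "x \<triangleleft> a \<in> H" "a \<triangleright> x \<in> H"
  using assms by (auto intro!: hat_smult L_in_B R_in_B)

lemma End_comp_Hom:
  assumes f: "f \<in> End" and h: "h \<in> Hom_mod BR AM E"
  shows "(\<lambda>a\<in>carrier A. f (h a)) \<in> Hom_mod BR AM E"
proof -
  have "(\<lambda>a\<in>carrier AM. f (h a)) \<in> Hom_mod BR AM E"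
  proof (rule Hom_modI)
    fix a b assume "a \<in> carrier AM" "b \<in> carrier AM"
    then show "f (h (a \<oplus>\<^bsub>AM\<^esub> b)) = f (h a) \<oplus>\<^bsub>E\<^esub> f (h b)"
      using Hom_modD(2)[OF h, of a b] End_add[OF f Hom_in_hat[OF h] Hom_in_hat[OF h], of a b] by simp
  next
    fix b a assume "b \<in> carrier BR" "a \<in> carrier AM"
    then show "f (h (b \<odot>\<^bsub>AM\<^esub> a)) = b \<odot>\<^bsub>E\<^esub> f (h a)"
      using Hom_modD(3)[OF h, of b a] End_smult[OF f _ Hom_in_hat[OF h], of b a] by simp
  qed (use End_closed[OF f Hom_in_hat[OF h]] hat_in_E AM.left_module_axioms in auto)
  then show ?thesis by simp
qed

text \<open>
  Injectivity of \<open>E\<close> extends \<open>g\<close> to an endomorphism of \<open>E\<close>. It maps the central closure into itself,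
  since composing it with a homomorphism from \<open>A\<close> gives another one.
\<close>

lemma End_extends_Hom:
  assumes g: "g \<in> Hom_mod BR AM E"
  obtains f where "f \<in> End" "\<And>a. a \<in> carrier A \<Longrightarrow> f (j a) = g a"
proof -
  have "extends_along_monos BR E AM E"
    using hull AM.left_module_axioms E.left_module_axioms
    by (intro injective_module_extends) (auto simp: injective_hull_def)
  then obtain g' where g': "g' \<in> Hom_mod BR E E" and eq: "\<And>a. a \<in> carrier A \<Longrightarrow> g' (j a) = g a"
    using g j_Hom j_inj unfolding extends_along_monos_def by fastforce
  note g'D = Hom_modD[OF g']
  have closed: "g' x \<in> H" if "x \<in> H" for x
    using that
  proof (induction x rule: hat_induct)
    case (hom h a)
    have "(\<lambda>a\<in>carrier AM. g' (h a)) \<in> Hom_mod BR AM E"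
      using g'D Hom_modD[OF hom(1)] AM.left_module_axioms by (intro Hom_modI) auto
    from Hom_in_hat[OF this hom(2)] hom(2) show ?case by simp
  next
    case (add x y)
    then show ?case using g'D(2) hat_in_E hat_add by simp
  qed
  have "(\<lambda>x\<in>carrier hat. g' x) \<in> End"
    using closed g'D hat_in_E hat.left_module_axioms by (intro Hom_modI) auto
  then show thesis using eq j_in_hat that[of "\<lambda>x\<in>carrier hat. g' x"] by simp
qed

lemma hat_End_induct [consumes 1, case_names End add]:
  assumes "x \<in> H" and *: "\<And>f a. \<lbrakk>f \<in> End; a \<in> carrier A\<rbrakk> \<Longrightarrow> P (f (j a))"
    and "\<And>x y. \<lbrakk>x \<in> H; y \<in> H; P x; P y\<rbrakk> \<Longrightarrow> P (x \<oplus>\<^bsub>E\<^esub> y)"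
  shows "P x"
  using assms(1)
proof (induction x rule: hat_induct)
  case (hom f a)
  then show ?case using End_extends_Hom[OF hom(1)] * by metis
qed (use assms in auto)

lemma I_of_essential:
  assumes "f \<in> End"
  shows "essential_submodule BR AM (I_of A j f)"
proof -
  have "I_of A j f = {a \<in> carrier AM. (\<lambda>a\<in>carrier A. f (j a)) a \<in> j ` carrier A}"
    by (auto simp: I_of_def)
  then show ?thesis using AE.essential_vimage[OF End_comp_Hom[OF assms j_Hom] j_essential] by simp
qed

lemma Hom_equal_on_essential:
  assumes f: "f \<in> Hom_mod BR AM E" and g: "g \<in> Hom_mod BR AM E"
    and K: "essential_submodule BR AM K" and eq: "\<And>c. c \<in> K \<Longrightarrow> f c = g c" and a: "a \<in> carrier A"
  shows "f a = g a"
proof -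
  note fD = Hom_modD[OF f] and gD = Hom_modD[OF g]
  have Kc: "K \<subseteq> carrier A" using F_B_D(1)[OF essential_in_F_B[OF K]] .
  let ?h = "\<lambda>a\<in>carrier AM. f a \<ominus>\<^bsub>E\<^esub> g a"
  have "?h \<in> Hom_mod BR AM E"
  proof (rule Hom_modI)
    fix x y assume "x \<in> carrier AM" "y \<in> carrier AM"
    then show "f (x \<oplus>\<^bsub>AM\<^esub> y) \<ominus>\<^bsub>E\<^esub> g (x \<oplus>\<^bsub>AM\<^esub> y) = (f x \<ominus>\<^bsub>E\<^esub> g x) \<oplus>\<^bsub>E\<^esub> (f y \<ominus>\<^bsub>E\<^esub> g y)"
      using fD(1)[of x] fD(1)[of y] gD(1)[of x] gD(1)[of y] fD(2)[of x y] gD(2)[of x y]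
      by (simp add: a_minus_def E.M.minus_add E.M.a_ac)
  next
    fix b x assume "b \<in> carrier BR" "x \<in> carrier AM"
    then show "f (b \<odot>\<^bsub>AM\<^esub> x) \<ominus>\<^bsub>E\<^esub> g (b \<odot>\<^bsub>AM\<^esub> x) = b \<odot>\<^bsub>E\<^esub> (f x \<ominus>\<^bsub>E\<^esub> g x)"
      using fD(1)[of x] gD(1)[of x] fD(3)[of b x] gD(3)[of b x]
      by (simp add: a_minus_def E.smult_r_distr E.smult_r_minus)
  qed (use fD(1) gD(1) AM.left_module_axioms in auto)
  moreover have "?h c = \<zero>\<^bsub>E\<^esub>" if "c \<in> K" for c
    using that eq[OF that] gD(1)[of c] subsetD[OF Kc that] by (simp add: a_minus_def E.M.r_neg)
  ultimately have "?h a = \<zero>\<^bsub>E\<^esub>" using Hom_essential_kernel K a by blast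
  then show ?thesis using fD(1)[of a] gD(1)[of a] a by (simp add: E.M.minus_eq_zero_iff)
qed

text \<open>
  For \<open>x\<close> and \<open>y\<close> in an ideal \<open>I\<close> on which \<open>f\<close> and \<open>g\<close> take values in \<open>A\<close>, both sides at \<open>xy\<close> equal
  \<open>f(x) g(y)\<close>. The set \<open>K\<close> on which \<open>f g\<close> and \<open>g f\<close> agree therefore contains all products of elements
  of \<open>I\<close>. The ideal generated by these products need not be \<open>B\<close>-stable, but \<open>K\<close> is, and it is
  essential: if \<open>L \<inter> K = 0\<close>, then \<open>L \<inter> I\<close> has square zero, hence \<open>L \<inter> I = 0\<close> and \<open>L = 0\<close>.
\<close>

lemma End_commute_on_A:
  assumes f: "f \<in> End" and g: "g \<in> End" and a: "a \<in> carrier A"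
  shows "f (g (j a)) = g (f (j a))"
proof -
  let ?fg = "\<lambda>a\<in>carrier A. f (g (j a))" and ?gf = "\<lambda>a\<in>carrier A. g (f (j a))"
  have Hom: "?fg \<in> Hom_mod BR AM E" "?gf \<in> Hom_mod BR AM E"
    using End_comp_Hom[OF f End_comp_Hom[OF g j_Hom]] End_comp_Hom[OF g End_comp_Hom[OF f j_Hom]]
    by (simp_all cong: restrict_cong)
  \<comment> \<open>an equalizer, which is \<open>B\<close>-stable\<close>
  define K where "K = {a \<in> carrier A. ?fg a = ?gf a}"
  have sK: "B_stable k A B K" using AE.submodule_equalizer[OF Hom] by (simp add: K_def)
  define I where "I = I_of A j f \<inter> I_of A j g"
  have I: "essential_submodule BR AM I"
    using AM.essential_Int[OF I_of_essential[OF f] I_of_essential[OF g]] by (simp add: I_def)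
  then have sI: "B_stable k A B I" by (simp add: essential_submodule_def)
  have prod: "x \<otimes>\<^bsub>A\<^esub> y \<in> K" if x: "x \<in> I" and y: "y \<in> I" for x y
  proof -
    from x obtain u where u: "x \<in> carrier A" "f (j x) = j u" "u \<in> carrier A" by (auto simp: I_def I_of_def)
    from y obtain v where v: "y \<in> carrier A" "g (j y) = j v" "v \<in> carrier A" by (auto simp: I_def I_of_def)
    have "f (g (j (x \<otimes>\<^bsub>A\<^esub> y))) = f (x \<triangleright> j v)"
      using j_mult(2)[OF u(1) v(1)] End_act(2)[OF g u(1) j_in_hat[OF v(1)]] v by simp
    also have "\<dots> = f (j x \<triangleleft> v)" using j_mult[OF u(1) v(3)] by simp
    also have "\<dots> = j u \<triangleleft> v" using End_act(1)[OF f v(3) j_in_hat[OF u(1)]] u by simp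
    also have "\<dots> = u \<triangleright> g (j y)" using j_mult[OF u(3) v(3)] v by simp
    also have "\<dots> = g (j u \<triangleleft> y)"
      using End_act(2)[OF g u(3) j_in_hat[OF v(1)]] j_mult[OF u(3) v(1)] by simp
    also have "\<dots> = g (f (j (x \<otimes>\<^bsub>A\<^esub> y)))"
      using j_mult(1)[OF u(1) v(1)] End_act(1)[OF f v(1) j_in_hat[OF u(1)]] u by simp
    finally show ?thesis using u v by (simp add: K_def)
  qed
  have "essential_submodule BR AM K"
    unfolding essential_submodule_def
  proof (intro conjI allI impI sK)
    fix L assume L: "B_stable k A B L \<and> L \<inter> K = {\<zero>\<^bsub>AM\<^esub>}"
    interpret L: ideal L A using L stable_ideal by blast
    have "L \<inter> I = {\<zero>\<^bsub>A\<^esub>}"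
    proof (rule stable_square_zero)
      show "B_stable k A B (L \<inter> I)" using AM.submodule_Int L sI by blast
      show "x \<otimes>\<^bsub>A\<^esub> y = \<zero>\<^bsub>A\<^esub>" if "x \<in> L \<inter> I" "y \<in> L \<inter> I" for x y
      proof -
        have "x \<otimes>\<^bsub>A\<^esub> y \<in> L \<inter> K" using that prod L.I_l_closed L.Icarr by auto
        then show ?thesis using L by simp
      qed
    qed
    then show "L = {\<zero>\<^bsub>AM\<^esub>}" using I L by (auto simp: essential_submodule_def)
  qed
  moreover have "?fg c = ?gf c" if "c \<in> K" for c using that unfolding K_def by blast
  ultimately have "?fg a = ?gf a" using Hom_equal_on_essential[OF Hom _ _ a] by blast
  then show ?thesis using a by simp
qed

text \<open>
  On \<open>e(A)\<close>, compare the homomorphisms \<open>f g e\<close> and \<open>g f e\<close> from \<open>A\<close>: they agree where \<open>e\<close> takes values in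
  \<open>A\<close>, which is an essential ideal.
\<close>

lemma End_commute:
  assumes f: "f \<in> End" and g: "g \<in> End" and x: "x \<in> H"
  shows "f (g x) = g (f x)"
  using x
proof (induction x rule: hat_End_induct)
  case (End e a)
  let ?fg = "\<lambda>a\<in>carrier A. f (g (e (j a)))" and ?gf = "\<lambda>a\<in>carrier A. g (f (e (j a)))"
  have Hom: "?fg \<in> Hom_mod BR AM E" "?gf \<in> Hom_mod BR AM E"
    using End_comp_Hom[OF f End_comp_Hom[OF g End_comp_Hom[OF End(1) j_Hom]]]
      End_comp_Hom[OF g End_comp_Hom[OF f End_comp_Hom[OF End(1) j_Hom]]]
    by (simp_all cong: restrict_cong)
  have "?fg c = ?gf c" if "c \<in> I_of A j e" for c
    using that End_commute_on_A[OF f g] by (auto simp: I_of_def)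
  from Hom_equal_on_essential[OF Hom I_of_essential[OF End(1)] this End(2)] End(2)
  show ?case by simp
next
  case (add x y)
  then show ?case using f g by (simp add: End_add End_closed)
qed

subsection \<open>The product of the central closure\<close>

definition represents :: "nat \<Rightarrow> (nat \<Rightarrow> 'a) \<Rightarrow> (nat \<Rightarrow> 'e \<Rightarrow> 'e) \<Rightarrow> 'e \<Rightarrow> bool" where
  "represents m a f x \<longleftrightarrow> (\<forall>p<m. a p \<in> carrier A \<and> f p \<in> End) \<and>
     x = (\<Oplus>\<^bsub>E\<^esub>p\<in>{..<m}. f p (j (a p)))"

lemma finsum_lessThan_Suc:
  assumes "\<And>i. i < Suc n \<Longrightarrow> g i \<in> carrier E"
  shows "finsum E g {..<Suc n} = finsum E g {..<n} \<oplus>\<^bsub>E\<^esub> g n"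
proof -
  have "finsum E g (insert n {..<n}) = g n \<oplus>\<^bsub>E\<^esub> finsum E g {..<n}"
    using assms by (intro E.M.finsum_insert) auto
  then show ?thesis using assms by (simp add: lessThan_Suc E.M.a_comm Pi_iff)
qed

lemma finsum_hom:
  fixes n :: nat
  assumes g: "\<And>i. i < n \<Longrightarrow> g i \<in> H"
    and h: "\<And>x. x \<in> H \<Longrightarrow> h x \<in> H" "h \<zero>\<^bsub>E\<^esub> = \<zero>\<^bsub>E\<^esub>"
      "\<And>x y. \<lbrakk>x \<in> H; y \<in> H\<rbrakk> \<Longrightarrow> h (x \<oplus>\<^bsub>E\<^esub> y) = h x \<oplus>\<^bsub>E\<^esub> h y"
  shows "finsum E g {..<n} \<in> H \<and> h (finsum E g {..<n}) = (\<Oplus>\<^bsub>E\<^esub>i\<in>{..<n}. h (g i))"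
  using g
proof (induction n)
  case 0
  show ?case using E.submoduleD(2)[OF hat_submodule] h(2) by simp
next
  case (Suc n)
  have IH: "finsum E g {..<n} \<in> H" "h (finsum E g {..<n}) = (\<Oplus>\<^bsub>E\<^esub>i\<in>{..<n}. h (g i))"
    using Suc.IH Suc.prems by simp_all
  have "finsum E g {..<Suc n} = finsum E g {..<n} \<oplus>\<^bsub>E\<^esub> g n"
    "(\<Oplus>\<^bsub>E\<^esub>i\<in>{..<Suc n}. h (g i)) = (\<Oplus>\<^bsub>E\<^esub>i\<in>{..<n}. h (g i)) \<oplus>\<^bsub>E\<^esub> h (g n)"
    using Suc.prems h(1) hat_in_E by (auto intro!: finsum_lessThan_Suc)
  then show ?case using IH Suc.prems h(3) hat_add by simp
qed

lemma finsum_in_hat: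
  fixes n :: nat
  assumes "\<And>i. i < n \<Longrightarrow> g i \<in> H"
  shows "finsum E g {..<n} \<in> H"
  using finsum_hom[of n g "\<lambda>x. x"] assms by simp

lemma finsum_swap:
  fixes m n :: nat
  assumes "\<And>p q. \<lbrakk>p < m; q < n\<rbrakk> \<Longrightarrow> g p q \<in> H"
  shows "(\<Oplus>\<^bsub>E\<^esub>p\<in>{..<m}. \<Oplus>\<^bsub>E\<^esub>q\<in>{..<n}. g p q) = (\<Oplus>\<^bsub>E\<^esub>q\<in>{..<n}. \<Oplus>\<^bsub>E\<^esub>p\<in>{..<m}. g p q)"
  using assms
proof (induction m)
  case 0
  show ?case by (simp add: E.M.finsum_zero)
next
  case (Suc m)
  have inner: "(\<Oplus>\<^bsub>E\<^esub>q\<in>{..<n}. g p q) \<in> carrier E" if "p < Suc m" for p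
    using Suc.prems that by (intro hat_in_E finsum_in_hat) auto
  have cols: "(\<Oplus>\<^bsub>E\<^esub>p\<in>{..<m}. g p q) \<in> carrier E" if "q < n" for q
    using Suc.prems that by (intro hat_in_E finsum_in_hat) auto
  have "(\<Oplus>\<^bsub>E\<^esub>p\<in>{..<Suc m}. \<Oplus>\<^bsub>E\<^esub>q\<in>{..<n}. g p q)
      = (\<Oplus>\<^bsub>E\<^esub>q\<in>{..<n}. \<Oplus>\<^bsub>E\<^esub>p\<in>{..<m}. g p q) \<oplus>\<^bsub>E\<^esub> (\<Oplus>\<^bsub>E\<^esub>q\<in>{..<n}. g m q)"
    using Suc.IH Suc.prems by (simp add: finsum_lessThan_Suc[OF inner])
  also have "\<dots> = (\<Oplus>\<^bsub>E\<^esub>q\<in>{..<n}. (\<Oplus>\<^bsub>E\<^esub>p\<in>{..<m}. g p q) \<oplus>\<^bsub>E\<^esub> g m q)"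
    using cols Suc.prems hat_in_E by (intro E.M.finsum_addf[symmetric]) auto
  also have "\<dots> = (\<Oplus>\<^bsub>E\<^esub>q\<in>{..<n}. \<Oplus>\<^bsub>E\<^esub>p\<in>{..<Suc m}. g p q)"
    using Suc.prems hat_in_E cols
    by (intro E.M.finsum_cong') (auto intro!: finsum_lessThan_Suc[symmetric] E.M.finsum_closed)
  finally show ?case .
qed

lemma representsD:
  assumes "represents n b g y"
  shows "\<And>q. q < n \<Longrightarrow> b q \<in> carrier A" "\<And>q. q < n \<Longrightarrow> g q \<in> End"
    "y = (\<Oplus>\<^bsub>E\<^esub>q\<in>{..<n}. g q (j (b q)))" "y \<in> H" "\<And>q. q < n \<Longrightarrow> g q (j (b q)) \<in> H"
proof -
  show *: "\<And>q. q < n \<Longrightarrow> b q \<in> carrier A" "\<And>q. q < n \<Longrightarrow> g q \<in> End"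
    "y = (\<Oplus>\<^bsub>E\<^esub>q\<in>{..<n}. g q (j (b q)))"
    using assms by (auto simp: represents_def)
  show **: "g q (j (b q)) \<in> H" if "q < n" for q
    using End_closed[OF *(2)[OF that] j_in_hat[OF *(1)[OF that]]] .
  show "y \<in> H" unfolding *(3) by (rule finsum_in_hat[OF **])
qed

text \<open>
  Summing two representations would require concatenating two families. Adding \<open>y\<close> to an arbitrary
  represented element avoids this: a generator only appends one term, and sums are added one
  summand after the other.
\<close>

lemma represents_exists:
  assumes "y \<in> H"
  obtains n b g where "represents n b g y"
proof -
  have "\<forall>x m a f. represents m a f x \<longrightarrow> (\<exists>n b g. represents n b g (x \<oplus>\<^bsub>E\<^esub> y))"
    using assms
  proof (induction y rule: hat_End_induct)
    case (End e c)
    show ?case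
    proof (intro allI impI)
      fix x m a f assume r: "represents m a f x"
      let ?a = "a(m := c)" and ?f = "f(m := e)"
      have c: "\<forall>p<Suc m. ?a p \<in> carrier A \<and> ?f p \<in> End"
        using r End by (auto simp: represents_def less_Suc_eq)
      then have "(\<Oplus>\<^bsub>E\<^esub>p\<in>{..<Suc m}. ?f p (j (?a p)))
          = (\<Oplus>\<^bsub>E\<^esub>p\<in>{..<m}. ?f p (j (?a p))) \<oplus>\<^bsub>E\<^esub> ?f m (j (?a m))"
        using End_closed[OF _ j_in_hat] by (intro finsum_lessThan_Suc hat_in_E) blast
      also have "(\<Oplus>\<^bsub>E\<^esub>p\<in>{..<m}. ?f p (j (?a p))) = x"
        unfolding representsD(3)[OF r] using representsD(5)[OF r] hat_in_E
        by (intro E.M.finsum_cong') auto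
      finally have "represents (Suc m) ?a ?f (x \<oplus>\<^bsub>E\<^esub> e (j c))"
        unfolding represents_def using c by simp
      then show "\<exists>n b g. represents n b g (x \<oplus>\<^bsub>E\<^esub> e (j c))" by blast
    qed
  next
    case (add y y')
    show ?case
    proof (intro allI impI)
      fix x m a f assume r: "represents m a f x"
      have xH: "x \<in> carrier E"
        using representsD(4)[OF r] by (rule hat_in_E)
      from r add.IH(1) obtain n b g where "represents n b g (x \<oplus>\<^bsub>E\<^esub> y)" by blast
      with add.IH(2) have "\<exists>n b g. represents n b g ((x \<oplus>\<^bsub>E\<^esub> y) \<oplus>\<^bsub>E\<^esub> y')" by blast
      then show "\<exists>n b g. represents n b g (x \<oplus>\<^bsub>E\<^esub> (y \<oplus>\<^bsub>E\<^esub> y'))"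
        using add.hyps hat_in_E xH by (simp add: E.M.a_assoc)
    qed
  qed
  moreover have "represents 0 a f \<zero>\<^bsub>E\<^esub>" for a f by (simp add: represents_def)
  ultimately have "\<exists>n b g. represents n b g (\<zero>\<^bsub>E\<^esub> \<oplus>\<^bsub>E\<^esub> y)" by blast
  then show thesis using that hat_in_E[OF assms] by auto
qed

text \<open>
  The first formula involves \<open>y\<close> only through its value, the second one \<open>x\<close>. Together they show that the
  double sum depends on neither representation. The second formula uses that \<open>f p\<close> and \<open>g q\<close>
  commute.
\<close>

lemma product_formulas:
  assumes x: "represents m a f x" and y: "represents n b g y"
  defines "z \<equiv> \<Oplus>\<^bsub>E\<^esub>p\<in>{..<m}. \<Oplus>\<^bsub>E\<^esub>q\<in>{..<n}. f p (g q (j (a p \<otimes>\<^bsub>A\<^esub> b q)))"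
  shows "z = (\<Oplus>\<^bsub>E\<^esub>p\<in>{..<m}. f p (a p \<triangleright> y))" "z = (\<Oplus>\<^bsub>E\<^esub>q\<in>{..<n}. g q (x \<triangleleft> b q))"
proof -
  note xD = representsD[OF x] and yD = representsD[OF y]
  have zH: "f p (g q (j (a p \<otimes>\<^bsub>A\<^esub> b q))) \<in> H" if "p < m" "q < n" for p q
    using End_closed[OF xD(2) End_closed[OF yD(2) j_in_hat[OF A.m_closed[OF xD(1) yD(1)]]]] that by simp
  have row: "f p (a p \<triangleright> y) = (\<Oplus>\<^bsub>E\<^esub>q\<in>{..<n}. f p (g q (j (a p \<otimes>\<^bsub>A\<^esub> b q))))" if p: "p < m" for p
  proof -
    have "f p (a p \<triangleright> y) = (\<Oplus>\<^bsub>E\<^esub>q\<in>{..<n}. f p (a p \<triangleright> g q (j (b q))))"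
      unfolding yD(3) using xD(1,2)[OF p] yD(5)
      by (intro finsum_hom[THEN conjunct2, of n "\<lambda>q. g q (j (b q))" "\<lambda>x. f p (a p \<triangleright> x)"])
        (auto simp: End_closed j_in_hat hat_act act_add hat_in_E End_add End_zero E.smult_r_zero L_in_B)
    also have "\<dots> = (\<Oplus>\<^bsub>E\<^esub>q\<in>{..<n}. f p (g q (j (a p \<otimes>\<^bsub>A\<^esub> b q))))"
      using xD(1,2)[OF p] yD(1,2) zH[OF p] hat_in_E
      by (intro E.M.finsum_cong') (auto simp: End_act j_in_hat j_mult(2))
    finally show ?thesis .
  qed
  show "z = (\<Oplus>\<^bsub>E\<^esub>p\<in>{..<m}. f p (a p \<triangleright> y))"
    unfolding z_def using row zH
    by (intro E.M.finsum_cong') (auto intro!: hat_in_E finsum_in_hat simp: row)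
  have col: "g q (x \<triangleleft> b q) = (\<Oplus>\<^bsub>E\<^esub>p\<in>{..<m}. f p (g q (j (a p \<otimes>\<^bsub>A\<^esub> b q))))" if q: "q < n" for q
  proof -
    have "g q (x \<triangleleft> b q) = (\<Oplus>\<^bsub>E\<^esub>p\<in>{..<m}. g q (f p (j (a p)) \<triangleleft> b q))"
      unfolding xD(3) using yD(1,2)[OF q] xD(5)
      by (intro finsum_hom[THEN conjunct2, of m "\<lambda>p. f p (j (a p))" "\<lambda>x. g q (x \<triangleleft> b q)"])
        (auto simp: End_closed j_in_hat hat_act act_add hat_in_E End_add End_zero E.smult_r_zero R_in_B)
    also have "\<dots> = (\<Oplus>\<^bsub>E\<^esub>p\<in>{..<m}. f p (g q (j (a p \<otimes>\<^bsub>A\<^esub> b q))))"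
      using yD(1,2)[OF q] xD(1,2) zH[OF _ q] hat_in_E
      by (intro E.M.finsum_cong')
        (auto simp: End_act(1)[symmetric] End_commute[of "g q"] j_in_hat j_mult(1)[symmetric])
    finally show ?thesis .
  qed
  have "z = (\<Oplus>\<^bsub>E\<^esub>q\<in>{..<n}. \<Oplus>\<^bsub>E\<^esub>p\<in>{..<m}. f p (g q (j (a p \<otimes>\<^bsub>A\<^esub> b q))))"
    unfolding z_def by (rule finsum_swap[OF zH])
  also have "\<dots> = (\<Oplus>\<^bsub>E\<^esub>q\<in>{..<n}. g q (x \<triangleleft> b q))"
    using col hat_in_E[OF finsum_in_hat[OF zH]] by (intro E.M.finsum_cong') auto
  finally show "z = (\<Oplus>\<^bsub>E\<^esub>q\<in>{..<n}. g q (x \<triangleleft> b q))" .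
qed

abbreviation hmult :: "'e \<Rightarrow> 'e \<Rightarrow> 'e" (infixl "\<bullet>" 70) where "x \<bullet> y \<equiv> hat_mult k A B E j x y"

lemma hat_mult_eq:
  assumes x: "x \<in> H" and y: "represents n b g y"
  shows "x \<bullet> y = (\<Oplus>\<^bsub>E\<^esub>q\<in>{..<n}. g q (x \<triangleleft> b q))"
proof -
  have unfold: "x \<bullet> y = (THE z. \<exists>m n a f b g. represents m a f x \<and> represents n b g y \<and>
     z = (\<Oplus>\<^bsub>E\<^esub>p\<in>{..<m}. \<Oplus>\<^bsub>E\<^esub>q\<in>{..<n}. f p (g q (j (a p \<otimes>\<^bsub>A\<^esub> b q)))))"
    unfolding hat_mult_def represents_def
    by (intro arg_cong[of _ _ The] ext iff_exI) (auto simp: End_mod_def)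
  obtain m a f where xr: "represents m a f x" using represents_exists[OF x] .
  define z where "z = (\<Oplus>\<^bsub>E\<^esub>q\<in>{..<n}. g q (x \<triangleleft> b q))"
  show ?thesis
    unfolding unfold z_def[symmetric]
  proof (rule the_equality)
    show "\<exists>m n a f b g. represents m a f x \<and> represents n b g y \<and>
      z = (\<Oplus>\<^bsub>E\<^esub>p\<in>{..<m}. \<Oplus>\<^bsub>E\<^esub>q\<in>{..<n}. f p (g q (j (a p \<otimes>\<^bsub>A\<^esub> b q))))"
      unfolding z_def
      by (intro exI conjI) (rule xr, rule y, rule product_formulas(2)[OF xr y, symmetric])
  next
    fix w assume "\<exists>m n a f b g. represents m a f x \<and> represents n b g y \<and>
      w = (\<Oplus>\<^bsub>E\<^esub>p\<in>{..<m}. \<Oplus>\<^bsub>E\<^esub>q\<in>{..<n}. f p (g q (j (a p \<otimes>\<^bsub>A\<^esub> b q))))"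
    then obtain m' n' a' f' b' g' where x': "represents m' a' f' x" and y': "represents n' b' g' y"
      and w: "w = (\<Oplus>\<^bsub>E\<^esub>p\<in>{..<m'}. \<Oplus>\<^bsub>E\<^esub>q\<in>{..<n'}. f' p (g' q (j (a' p \<otimes>\<^bsub>A\<^esub> b' q))))" by blast
    show "w = z"
      using product_formulas(1)[OF x' y'] product_formulas[OF x' y] w by (simp add: z_def)
  qed
qed

lemma hat_mult_End:
  assumes x: "x \<in> H" and g: "g \<in> End" and b: "b \<in> carrier A"
  shows "x \<bullet> g (j b) = g (x \<triangleleft> b)"
proof -
  have "represents 1 (\<lambda>_. b) (\<lambda>_. g) (g (j b))"
    using g b hat_in_E[OF End_closed[OF g j_in_hat[OF b]]]
    by (simp add: represents_def finsum_lessThan_Suc)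
  moreover have "g (x \<triangleleft> b) \<in> carrier E" using hat_in_E[OF End_closed[OF g hat_act(1)[OF b x]]] .
  ultimately show ?thesis using hat_mult_eq[OF x, of 1 "\<lambda>_. b" "\<lambda>_. g"]
    by (simp add: finsum_lessThan_Suc)
qed

lemma id_End: "(\<lambda>x\<in>H. x) \<in> End"
  using hat.left_module_axioms by (intro Hom_modI) auto

lemma hat_mult_j:
  assumes "x \<in> H" "b \<in> carrier A"
  shows "x \<bullet> j b = x \<triangleleft> b"
  using hat_mult_End[OF assms(1) id_End assms(2)] j_in_hat[OF assms(2)] hat_act(1)[OF assms(2,1)] by simp

text \<open>
  The second part is associativity in the case needed below, where the third factor comes from \<open>A\<close>.
\<close>

lemma hat_mult_closed_ract:
  assumes x: "x \<in> H" and y: "y \<in> H"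
  shows "x \<bullet> y \<in> H" "\<And>c. c \<in> carrier A \<Longrightarrow> (x \<bullet> y) \<triangleleft> c = x \<bullet> (y \<triangleleft> c)"
proof -
  obtain n b g where r: "represents n b g y" using represents_exists[OF y] .
  note rD = representsD[OF r]
  have terms: "g q (x \<triangleleft> b q) \<in> H" if "q < n" for q
    using End_closed[OF rD(2) hat_act(1)[OF rD(1) x]] that by simp
  show "x \<bullet> y \<in> H" unfolding hat_mult_eq[OF x r] using terms by (rule finsum_in_hat)
  fix c assume c: "c \<in> carrier A"
  have act: "(finsum E h {..<n}) \<triangleleft> c = (\<Oplus>\<^bsub>E\<^esub>q\<in>{..<n}. h q \<triangleleft> c)" if "\<And>q. q < n \<Longrightarrow> h q \<in> H" for h
    using that c by (intro finsum_hom[THEN conjunct2])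
      (auto simp: hat_act act_add hat_in_E E.smult_r_zero R_in_B)
  have "represents n (\<lambda>q. b q \<otimes>\<^bsub>A\<^esub> c) g (y \<triangleleft> c)"
    unfolding represents_def
  proof (intro conjI allI impI)
    show "y \<triangleleft> c = (\<Oplus>\<^bsub>E\<^esub>q\<in>{..<n}. g q (j (b q \<otimes>\<^bsub>A\<^esub> c)))"
    proof -
      have "y \<triangleleft> c = (\<Oplus>\<^bsub>E\<^esub>q\<in>{..<n}. g q (j (b q)) \<triangleleft> c)" unfolding rD(3) by (rule act[OF rD(5)])
      also have "\<dots> = (\<Oplus>\<^bsub>E\<^esub>q\<in>{..<n}. g q (j (b q \<otimes>\<^bsub>A\<^esub> c)))"
        using rD(1,2) c hat_in_E[OF End_closed[OF rD(2) j_in_hat]]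
        by (intro E.M.finsum_cong') (auto simp: End_act(1)[symmetric] j_in_hat j_mult(1)[symmetric])
      finally show ?thesis .
    qed
  qed (use rD c in auto)
  from hat_mult_eq[OF x this]
  have "x \<bullet> (y \<triangleleft> c) = (\<Oplus>\<^bsub>E\<^esub>q\<in>{..<n}. g q (x \<triangleleft> (b q \<otimes>\<^bsub>A\<^esub> c)))" .
  also have "\<dots> = (\<Oplus>\<^bsub>E\<^esub>q\<in>{..<n}. g q (x \<triangleleft> b q) \<triangleleft> c)"
  proof (rule E.M.finsum_cong')
    show "(\<lambda>q. g q (x \<triangleleft> b q) \<triangleleft> c) \<in> {..<n} \<rightarrow> carrier E"
      using hat_in_E[OF hat_act(1)[OF c terms]] by auto
    show "g q (x \<triangleleft> (b q \<otimes>\<^bsub>A\<^esub> c)) = g q (x \<triangleleft> b q) \<triangleleft> c" if "q \<in> {..<n}" for q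
      using that rD(1,2) c x hat_in_E[OF x] End_act(1)[OF rD(2) c hat_act(1)[OF rD(1) x], of q q]
      by (simp add: ract_assoc)
  qed simp
  also have "\<dots> = (x \<bullet> y) \<triangleleft> c" unfolding hat_mult_eq[OF x r] by (rule act[OF terms, symmetric])
  finally show "(x \<bullet> y) \<triangleleft> c = x \<bullet> (y \<triangleleft> c)" by simp
qed

end


section \<open>The additive group of \<open>Q\<^sub>0(A)\<close>\<close>

lemma UN_pair_constant:
  assumes "X \<noteq> {}" "\<And>I f. (I, f) \<in> X \<Longrightarrow> F I f = C"
  shows "(\<Union>(I, f)\<in>X. F I f) = C"
  using assms by fast

context central_closure
begin

lemma Q0_preD:
  assumes "(I, h) \<in> Q0_pre k A B"
  shows "I \<in> F_B k A B" "\<And>c. c \<in> I \<Longrightarrow> h c \<in> carrier A"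
    "\<And>c a. \<lbrakk>c \<in> I; a \<in> carrier A\<rbrakk> \<Longrightarrow> h (c \<otimes>\<^bsub>A\<^esub> a) = h c \<otimes>\<^bsub>A\<^esub> a"
    "\<And>c d. \<lbrakk>c \<in> I; d \<in> I\<rbrakk> \<Longrightarrow> h (c \<oplus>\<^bsub>A\<^esub> d) = h c \<oplus>\<^bsub>A\<^esub> h d"
  using assms by (auto simp: Q0_pre_def Hom_right_def)

lemma Q0_relI:
  assumes "(I, f) \<in> Q0_pre k A B" "(J, g) \<in> Q0_pre k A B" "K \<in> F_B k A B" "K \<subseteq> I \<inter> J"
    and "\<And>x. x \<in> K \<Longrightarrow> f x = g x"
  shows "((I, f), (J, g)) \<in> Q0_rel k A B"
  unfolding Q0_rel_def using assms by blast

lemma Q0_relE: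
  assumes "((I, f), (J, g)) \<in> Q0_rel k A B"
  obtains K where "(I, f) \<in> Q0_pre k A B" "(J, g) \<in> Q0_pre k A B" "K \<in> F_B k A B" "K \<subseteq> I \<inter> J"
    "\<And>x. x \<in> K \<Longrightarrow> f x = g x"
  using assms unfolding Q0_rel_def by blast

lemma Q0_rel_equiv: "equiv (Q0_pre k A B) (Q0_rel k A B)"
proof (rule equivI)
  show "Q0_rel k A B \<subseteq> Q0_pre k A B \<times> Q0_pre k A B" unfolding Q0_rel_def by blast
  show "refl_on (Q0_pre k A B) (Q0_rel k A B)"
  proof (rule refl_onI)
    fix p assume p: "p \<in> Q0_pre k A B"
    obtain I f where e: "p = (I, f)" by (cases p)
    show "(p, p) \<in> Q0_rel k A B"
      using Q0_relI[of I f I f I] p Q0_preD(1)[of I f] unfolding e by simp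
  qed
  show "sym (Q0_rel k A B)"
  proof (rule symI)
    fix p q assume pq: "(p, q) \<in> Q0_rel k A B"
    obtain I f J g where e: "p = (I, f)" "q = (J, g)" by (cases p, cases q)
    from pq[unfolded e] show "(q, p) \<in> Q0_rel k A B"
      unfolding e by (elim Q0_relE) (rule Q0_relI, assumption+, auto)
  qed
  show "trans (Q0_rel k A B)"
  proof (rule transI)
    fix p q r assume pq: "(p, q) \<in> Q0_rel k A B" and qr: "(q, r) \<in> Q0_rel k A B"
    obtain I f J g L h where e: "p = (I, f)" "q = (J, g)" "r = (L, h)" by (cases p, cases q, cases r)
    from pq[unfolded e] obtain K where K: "(I, f) \<in> Q0_pre k A B" "(J, g) \<in> Q0_pre k A B" "K \<in> F_B k A B" "K \<subseteq> I \<inter> J"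
        "\<And>x. x \<in> K \<Longrightarrow> f x = g x"
      by (rule Q0_relE) (rule that)
    from qr[unfolded e] obtain K' where K': "(J, g) \<in> Q0_pre k A B" "(L, h) \<in> Q0_pre k A B" "K' \<in> F_B k A B" "K' \<subseteq> J \<inter> L"
        "\<And>x. x \<in> K' \<Longrightarrow> g x = h x"
      by (rule Q0_relE) (rule that)
    show "(p, r) \<in> Q0_rel k A B"
      unfolding e
    proof (rule Q0_relI[OF K(1) K'(2) F_B_inter[OF K(3) K'(3)]])
      show "K \<inter> K' \<subseteq> I \<inter> L" using K(4) K'(4) by blast
      show "f x = h x" if "x \<in> K \<inter> K'" for x using that K(5)[of x] K'(5)[of x] by simp
    qed
  qed
qed

lemma Q0_class_eqI:
  assumes "(I, f) \<in> Q0_pre k A B" "(J, g) \<in> Q0_pre k A B" "K \<in> F_B k A B" "K \<subseteq> I \<inter> J"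
    and "\<And>x. x \<in> K \<Longrightarrow> f x = g x"
  shows "Q0_class k A B I f = Q0_class k A B J g"
  unfolding Q0_class_def using Q0_relI[OF assms] by (intro equiv_class_eq[OF Q0_rel_equiv])

lemma Q0_carrierE:
  assumes "X \<in> carrier (Q0 k A B)"
  obtains I f where "(I, f) \<in> Q0_pre k A B" "X = Q0_class k A B I f"
  using assms by (auto simp: Q0_def Q0_class_def elim!: quotientE)

lemma Q0_class_in_carrier: "(I, f) \<in> Q0_pre k A B \<Longrightarrow> Q0_class k A B I f \<in> carrier (Q0 k A B)"
  by (auto simp: Q0_def Q0_class_def intro: quotientI)

lemma Q0_preI:
  assumes I: "I \<in> F_B k A B" and "\<And>c. c \<in> I \<Longrightarrow> h c \<in> carrier A"
    and "\<And>c a. \<lbrakk>c \<in> I; a \<in> carrier A\<rbrakk> \<Longrightarrow> h (c \<otimes>\<^bsub>A\<^esub> a) = h c \<otimes>\<^bsub>A\<^esub> a"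
    and "\<And>c d. \<lbrakk>c \<in> I; d \<in> I\<rbrakk> \<Longrightarrow> h (c \<oplus>\<^bsub>A\<^esub> d) = h c \<oplus>\<^bsub>A\<^esub> h d"
  shows "(I, \<lambda>c\<in>I. h c) \<in> Q0_pre k A B"
  using assms F_B_D(4,5)[OF I] by (auto simp: Q0_pre_def Hom_right_def)

lemma Q0_pre_add:
  assumes f: "(I, f) \<in> Q0_pre k A B" and g: "(J, g) \<in> Q0_pre k A B"
  shows "(I \<inter> J, \<lambda>c\<in>I \<inter> J. f c \<oplus>\<^bsub>A\<^esub> g c) \<in> Q0_pre k A B"
proof (rule Q0_preI[OF F_B_inter])
  note fD = Q0_preD[OF f] and gD = Q0_preD[OF g]
  show "I \<in> F_B k A B" "J \<in> F_B k A B" using fD gD by auto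
  show "f c \<oplus>\<^bsub>A\<^esub> g c \<in> carrier A" if "c \<in> I \<inter> J" for c using that fD(2) gD(2) by simp
  show "f (c \<otimes>\<^bsub>A\<^esub> a) \<oplus>\<^bsub>A\<^esub> g (c \<otimes>\<^bsub>A\<^esub> a) = (f c \<oplus>\<^bsub>A\<^esub> g c) \<otimes>\<^bsub>A\<^esub> a"
    if "c \<in> I \<inter> J" "a \<in> carrier A" for c a
    using that fD(2,3) gD(2,3) by (simp add: A.l_distr)
  show "f (c \<oplus>\<^bsub>A\<^esub> d) \<oplus>\<^bsub>A\<^esub> g (c \<oplus>\<^bsub>A\<^esub> d) = (f c \<oplus>\<^bsub>A\<^esub> g c) \<oplus>\<^bsub>A\<^esub> (f d \<oplus>\<^bsub>A\<^esub> g d)"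
    if "c \<in> I \<inter> J" "d \<in> I \<inter> J" for c d
    using that fD(2,4) gD(2,4) by (simp add: A.a_ac)
qed

text \<open>
  Addition in \<open>Q\<^sub>0(A)\<close> is a union over all representatives; all of them contribute the same class.
\<close>

lemma Q0_add_class:
  assumes f: "(I, f) \<in> Q0_pre k A B" and g: "(J, g) \<in> Q0_pre k A B"
  shows "Q0_class k A B I f \<oplus>\<^bsub>Q0 k A B\<^esub> Q0_class k A B J g
    = Q0_class k A B (I \<inter> J) (\<lambda>c\<in>I \<inter> J. f c \<oplus>\<^bsub>A\<^esub> g c)" (is "_ = ?C")
proof -
  have "Q0_class k A B (I' \<inter> J') (\<lambda>c\<in>I' \<inter> J'. f' c \<oplus>\<^bsub>A\<^esub> g' c) = ?C"
    if "(I', f') \<in> Q0_class k A B I f" "(J', g') \<in> Q0_class k A B J g" for I' f' J' g'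
  proof -
    from that(1)[unfolded Q0_class_def Image_singleton_iff]
    obtain K where K: "(I, f) \<in> Q0_pre k A B" "(I', f') \<in> Q0_pre k A B" "K \<in> F_B k A B"
        "K \<subseteq> I \<inter> I'" "\<And>x. x \<in> K \<Longrightarrow> f x = f' x"
      by (rule Q0_relE) (rule that)
    from that(2)[unfolded Q0_class_def Image_singleton_iff]
    obtain L where L: "(J, g) \<in> Q0_pre k A B" "(J', g') \<in> Q0_pre k A B" "L \<in> F_B k A B"
        "L \<subseteq> J \<inter> J'" "\<And>x. x \<in> L \<Longrightarrow> g x = g' x"
      by (rule Q0_relE) (rule that)
    show ?thesis
    proof (rule Q0_class_eqI[OF Q0_pre_add[OF K(2) L(2)] Q0_pre_add[OF f g] F_B_inter[OF K(3) L(3)]])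
      show "K \<inter> L \<subseteq> (I' \<inter> J') \<inter> (I \<inter> J)" using K(4) L(4) by blast
      show "(\<lambda>c\<in>I' \<inter> J'. f' c \<oplus>\<^bsub>A\<^esub> g' c) x = (\<lambda>c\<in>I \<inter> J. f c \<oplus>\<^bsub>A\<^esub> g c) x" if "x \<in> K \<inter> L" for x
      proof -
        have "x \<in> I \<inter> J" "x \<in> I' \<inter> J'" using that K(4) L(4) by blast+
        then show ?thesis using that K(5)[of x] L(5)[of x] by simp
      qed
    qed
  qed
  moreover have "(I, f) \<in> Q0_class k A B I f" "(J, g) \<in> Q0_class k A B J g"
    unfolding Q0_class_def by (rule equiv_class_self[OF Q0_rel_equiv f], rule equiv_class_self[OF Q0_rel_equiv g])
  then have "Q0_class k A B I f \<noteq> {}" "Q0_class k A B J g \<noteq> {}" by blast+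
  ultimately show ?thesis by (simp add: Q0_def UN_pair_constant)
qed

lemma Q0_zero_pre: "(carrier A, \<lambda>x\<in>carrier A. \<zero>\<^bsub>A\<^esub>) \<in> Q0_pre k A B"
  by (rule Q0_preI[OF carrier_in_F_B]) auto

lemma Q0_zero: "\<zero>\<^bsub>Q0 k A B\<^esub> = Q0_class k A B (carrier A) (\<lambda>x\<in>carrier A. \<zero>\<^bsub>A\<^esub>)"
  by (simp add: Q0_def)

text \<open>
  The target of \<open>\<psi>\<^sup>*\<close> has to be a group for a homomorphism to be determined by its values on pure
  tensors.
\<close>

lemma Q0_abelian_group: "abelian_group (Q0 k A B)"
proof (rule abelian_groupI)
  fix X Y assume "X \<in> carrier (Q0 k A B)" "Y \<in> carrier (Q0 k A B)"
  then obtain I f J g where f: "(I, f) \<in> Q0_pre k A B" and g: "(J, g) \<in> Q0_pre k A B"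
      and XY: "X = Q0_class k A B I f" "Y = Q0_class k A B J g"
    by (elim Q0_carrierE) blast
  note fD = Q0_preD[OF f] and gD = Q0_preD[OF g]
  show "X \<oplus>\<^bsub>Q0 k A B\<^esub> Y \<in> carrier (Q0 k A B)"
    unfolding XY Q0_add_class[OF f g] by (rule Q0_class_in_carrier[OF Q0_pre_add[OF f g]])
  show "X \<oplus>\<^bsub>Q0 k A B\<^esub> Y = Y \<oplus>\<^bsub>Q0 k A B\<^esub> X"
    unfolding XY Q0_add_class[OF f g] Q0_add_class[OF g f]
    using fD(2) gD(2)
    by (intro Q0_class_eqI[OF Q0_pre_add[OF f g] Q0_pre_add[OF g f] F_B_inter[OF fD(1) gD(1)]])
      (auto simp: A.a_comm)
next
  fix X Y Z assume "X \<in> carrier (Q0 k A B)" "Y \<in> carrier (Q0 k A B)" "Z \<in> carrier (Q0 k A B)"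
  then obtain I f J g L h where f: "(I, f) \<in> Q0_pre k A B" and g: "(J, g) \<in> Q0_pre k A B"
      and h: "(L, h) \<in> Q0_pre k A B"
      and XYZ: "X = Q0_class k A B I f" "Y = Q0_class k A B J g" "Z = Q0_class k A B L h"
    by (elim Q0_carrierE) blast
  note fg = Q0_pre_add[OF f g] and gh = Q0_pre_add[OF g h]
  show "X \<oplus>\<^bsub>Q0 k A B\<^esub> Y \<oplus>\<^bsub>Q0 k A B\<^esub> Z = X \<oplus>\<^bsub>Q0 k A B\<^esub> (Y \<oplus>\<^bsub>Q0 k A B\<^esub> Z)"
    unfolding XYZ Q0_add_class[OF f g] Q0_add_class[OF g h] Q0_add_class[OF fg h] Q0_add_class[OF f gh]
    using Q0_preD(2)[OF f] Q0_preD(2)[OF g] Q0_preD(2)[OF h]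
    by (intro Q0_class_eqI[OF Q0_pre_add[OF fg h] Q0_pre_add[OF f gh],
          of "I \<inter> J \<inter> L"] F_B_inter Q0_preD(1)[OF f] Q0_preD(1)[OF g] Q0_preD(1)[OF h])
      (auto simp: A.a_assoc)
next
  show "\<zero>\<^bsub>Q0 k A B\<^esub> \<in> carrier (Q0 k A B)"
    unfolding Q0_zero by (rule Q0_class_in_carrier[OF Q0_zero_pre])
next
  fix X assume "X \<in> carrier (Q0 k A B)"
  then obtain I f where f: "(I, f) \<in> Q0_pre k A B" and X: "X = Q0_class k A B I f"
    by (elim Q0_carrierE) blast
  note fD = Q0_preD[OF f] and ID = F_B_D(1)[OF Q0_preD(1)[OF f]]
  show "\<zero>\<^bsub>Q0 k A B\<^esub> \<oplus>\<^bsub>Q0 k A B\<^esub> X = X"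
    unfolding X Q0_zero Q0_add_class[OF Q0_zero_pre f]
    using fD(2) ID by (intro Q0_class_eqI[OF Q0_pre_add[OF Q0_zero_pre f] f fD(1)]) auto
  have m: "(I, \<lambda>c\<in>I. \<ominus>\<^bsub>A\<^esub> f c) \<in> Q0_pre k A B"
    using fD ID by (intro Q0_preI) (auto simp: A.l_minus A.minus_add)
  have "Q0_class k A B I (\<lambda>c\<in>I. \<ominus>\<^bsub>A\<^esub> f c) \<oplus>\<^bsub>Q0 k A B\<^esub> X = \<zero>\<^bsub>Q0 k A B\<^esub>"
    unfolding X Q0_zero Q0_add_class[OF m f]
    using fD(2) ID by (intro Q0_class_eqI[OF Q0_pre_add[OF m f] Q0_zero_pre fD(1)]) (auto simp: A.l_neg)
  then show "\<exists>Y\<in>carrier (Q0 k A B). Y \<oplus>\<^bsub>Q0 k A B\<^esub> X = \<zero>\<^bsub>Q0 k A B\<^esub>"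
    using Q0_class_in_carrier[OF m] by blast
qed

end


section \<open>Fractions representing the elements of the central closure\<close>

locale faithful_central_closure = central_closure k A B E j
  for k :: "'k ring" and A :: "('k, 'a) module" and B E and j :: "'a \<Rightarrow> 'e" +
  assumes hat_ann_stable: "\<And>I. submodule I (B_ring k A B) (hat_mod k A B E) \<Longrightarrow>
           submodule (l_ann (hat_alg k A B E j) I) (B_ring k A B) (hat_mod k A B E)"
begin

text \<open>
  The annihilator \<open>L\<close> of \<open>I\<close> is a \<open>B\<close>-submodule by hypothesis (ii), and \<open>L \<inter> A\<close> is the left annihilator
  of \<open>I\<close> in \<open>A\<close>, which is zero. Since \<open>A\<close> is essential in \<open>E\<close>, \<open>L = 0\<close>.
\<close>

lemma hat_ann_zero:
  assumes I: "I \<in> F_B k A B" and x: "x \<in> H" and xI: "\<And>c. c \<in> I \<Longrightarrow> x \<triangleleft> c = \<zero>\<^bsub>E\<^esub>"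
  shows "x = \<zero>\<^bsub>E\<^esub>"
proof -
  note ID = F_B_D[OF I]
  have sI: "B_stable k A B I" using I by (simp add: F_B_def)
  interpret Ahat: left_module_pair BR AM hat ..
  have "j \<in> Hom_mod BR AM hat"
    using Hom_modD[OF j_Hom] j_in_hat by (auto simp: Hom_mod_def PiE_iff)
  then have "submodule (j ` I) BR hat" using Ahat.submodule_image[OF _ sI] by blast
  from hat_ann_stable[OF this]
  have sL: "submodule (l_ann (hat_alg k A B E j) (j ` I)) BR hat" .
  define L where "L = l_ann (hat_alg k A B E j) (j ` I)"
  have L_iff: "y \<in> L \<longleftrightarrow> y \<in> H \<and> (\<forall>c\<in>I. y \<triangleleft> c = \<zero>\<^bsub>E\<^esub>)" for y
    using ID(1) by (auto simp: L_def l_ann_def hat_alg_def hat_mult_j subset_iff)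
  have "submodule L BR E"
    using hat.submoduleD[OF sL] hat_in_E unfolding L_def[symmetric]
    by (intro E.submoduleI) auto
  moreover have "L \<inter> j ` carrier A = {\<zero>\<^bsub>E\<^esub>}"
  proof (intro equalityI subsetI)
    fix y assume y: "y \<in> L \<inter> j ` carrier A"
    then obtain a where a: "y = j a" "a \<in> carrier A" by blast
    have "a = \<zero>\<^bsub>A\<^esub>"
    proof (rule ID(2)[OF a(2)])
      fix c assume c: "c \<in> I"
      then have "j (a \<otimes>\<^bsub>A\<^esub> c) = j \<zero>\<^bsub>A\<^esub>"
        using y a ID(1) j_mult(1)[OF a(2), of c] by (auto simp: L_iff j_zero)
      then show "a \<otimes>\<^bsub>A\<^esub> c = \<zero>\<^bsub>A\<^esub>" using a ID(1) c by (auto simp: j_eq_iff)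
    qed
    then show "y \<in> {\<zero>\<^bsub>E\<^esub>}" using a j_zero by simp
  next
    fix y assume "y \<in> {\<zero>\<^bsub>E\<^esub>}"
    then show "y \<in> L \<inter> j ` carrier A"
      using hat.submoduleD(2)[OF sL] imageI[OF A.zero_closed, of j] by (simp add: j_zero L_def)
  qed
  ultimately have "L = {\<zero>\<^bsub>E\<^esub>}" using j_essential unfolding essential_submodule_def by meson
  then show ?thesis using L_iff[of x] x xI by blast
qed

text \<open>
  All fractions \<open>(I, h)\<close> for which \<open>h\<close> is left multiplication by \<open>x\<close>; recall that \<open>xc = R\<^sub>c \<cdot> x\<close>.
\<close>

definition \<Psi> :: "'e \<Rightarrow> ('a set \<times> ('a \<Rightarrow> 'a)) set" where
  "\<Psi> x = {(I, h) \<in> Q0_pre k A B. \<forall>c\<in>I. j (h c) = x \<triangleleft> c}"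

lemma \<Psi>D:
  assumes "(I, h) \<in> \<Psi> x"
  shows "I \<in> F_B k A B" "\<And>c. c \<in> I \<Longrightarrow> h c \<in> carrier A" "\<And>c. c \<in> I \<Longrightarrow> j (h c) = x \<triangleleft> c"
    "(I, h) \<in> Q0_pre k A B"
  using assms by (auto simp: \<Psi>_def Q0_pre_def Hom_right_def)

lemma \<Psi>I:
  assumes I: "I \<in> F_B k A B" and x: "x \<in> H"
    and h: "\<And>c. c \<in> I \<Longrightarrow> h c \<in> carrier A" "\<And>c. c \<in> I \<Longrightarrow> j (h c) = x \<triangleleft> c"
  shows "(I, \<lambda>c\<in>I. h c) \<in> \<Psi> x"
proof -
  note ID = F_B_D[OF I]
  have xE: "x \<in> carrier E" using hat_in_E[OF x] .
  have "h (c \<oplus>\<^bsub>A\<^esub> d) = h c \<oplus>\<^bsub>A\<^esub> h d" if "c \<in> I" "d \<in> I" for c d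
  proof -
    have cd: "c \<in> carrier A" "d \<in> carrier A" "c \<oplus>\<^bsub>A\<^esub> d \<in> I" using that ID(1,5) by auto
    have "j (h (c \<oplus>\<^bsub>A\<^esub> d)) = j (h c \<oplus>\<^bsub>A\<^esub> h d)"
      using h that cd ract_add[OF cd(1,2) xE] by (simp add: j_add)
    then show ?thesis using h(1) that cd by (simp add: j_eq_iff)
  qed
  moreover have "h (c \<otimes>\<^bsub>A\<^esub> a) = h c \<otimes>\<^bsub>A\<^esub> a" if "c \<in> I" "a \<in> carrier A" for c a
  proof -
    have ca: "c \<in> carrier A" "c \<otimes>\<^bsub>A\<^esub> a \<in> I" using that ID(1,4) by auto
    have "j (h (c \<otimes>\<^bsub>A\<^esub> a)) = j (h c \<otimes>\<^bsub>A\<^esub> a)"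
      using h that ca ract_assoc[OF ca(1) that(2) xE] by (simp add: j_mult(1))
    then show ?thesis using h(1) that ca by (simp add: j_eq_iff)
  qed
  ultimately show ?thesis
    using I h ID(4,5) by (auto simp: \<Psi>_def Q0_pre_def Hom_right_def)
qed

lemma \<Psi>_add_fractions:
  assumes x: "x \<in> H" and y: "y \<in> H" and f: "(I, f) \<in> \<Psi> x" and g: "(J, g) \<in> \<Psi> y"
  shows "(I \<inter> J, \<lambda>c\<in>I \<inter> J. f c \<oplus>\<^bsub>A\<^esub> g c) \<in> \<Psi> (x \<oplus>\<^bsub>E\<^esub> y)"
proof -
  note ID = \<Psi>D[OF f] and JD = \<Psi>D[OF g]
  show ?thesis
  proof (rule \<Psi>I[OF F_B_inter[OF ID(1) JD(1)] hat_add[OF x y]])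
    fix c assume c: "c \<in> I \<inter> J"
    then have cA: "c \<in> carrier A" using F_B_D(1)[OF ID(1)] by auto
    show "f c \<oplus>\<^bsub>A\<^esub> g c \<in> carrier A" using c ID(2) JD(2) by simp
    show "j (f c \<oplus>\<^bsub>A\<^esub> g c) = (x \<oplus>\<^bsub>E\<^esub> y) \<triangleleft> c"
      using c ID(2,3) JD(2,3) cA x y by (simp add: j_add act_add hat_in_E)
  qed
qed

text \<open>
  For \<open>x = f(a)\<close>, left multiplication by \<open>x\<close> is \<open>c \<mapsto> a f(c)\<close>, which takes values in \<open>A\<close> on \<open>I\<^sub>f\<close>.
\<close>

lemma \<Psi>_nonempty:
  assumes "x \<in> H"
  obtains I h where "(I, h) \<in> \<Psi> x"
proof -
  have "\<exists>I h. (I, h) \<in> \<Psi> x"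
    using assms
  proof (induction x rule: hat_End_induct)
    case (End f a)
    let ?I = "I_of A j f" and ?g = "\<lambda>c. inv_into (carrier A) j (f (j c))"
    have I: "?I \<in> F_B k A B" by (rule essential_in_F_B[OF I_of_essential[OF End(1)]])
    have g: "c \<in> carrier A" "?g c \<in> carrier A" "j (?g c) = f (j c)" if "c \<in> ?I" for c
      using that by (auto simp: I_of_def inv_into_into f_inv_into_f)
    have "(?I, \<lambda>c\<in>?I. a \<otimes>\<^bsub>A\<^esub> ?g c) \<in> \<Psi> (f (j a))"
    proof (rule \<Psi>I[OF I End_closed[OF End(1) j_in_hat[OF End(2)]]])
      fix c assume c: "c \<in> ?I"
      show "a \<otimes>\<^bsub>A\<^esub> ?g c \<in> carrier A" using g[OF c] End(2) by simp
      have "j (a \<otimes>\<^bsub>A\<^esub> ?g c) = f (a \<triangleright> j c)"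
        using g[OF c] End j_mult(2)[of a "?g c"] End_act(2)[OF End j_in_hat[OF g(1)[OF c]]] by simp
      also have "\<dots> = f (j a) \<triangleleft> c"
        using g[OF c] End j_mult[of a c] End_act(1)[OF End(1) g(1)[OF c] j_in_hat[OF End(2)]] by simp
      finally show "j (a \<otimes>\<^bsub>A\<^esub> ?g c) = f (j a) \<triangleleft> c" .
    qed
    then show ?case by blast
  next
    case (add x y)
    then obtain I h J g where Ih: "(I, h) \<in> \<Psi> x" and Jg: "(J, g) \<in> \<Psi> y" by blast
    have "(I \<inter> J, \<lambda>c\<in>I \<inter> J. h c \<oplus>\<^bsub>A\<^esub> g c) \<in> \<Psi> (x \<oplus>\<^bsub>E\<^esub> y)"
      by (rule \<Psi>_add_fractions[OF add(1,2) Ih Jg])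
    then show ?case by blast
  qed
  then show thesis using that by blast
qed

text \<open>
  A fraction is already left multiplication by \<open>x\<close> if it is so on a part \<open>D\<close> of its domain that only
  annihilates \<open>0\<close>: for \<open>c \<in> K\<close> and \<open>n \<in> D\<close>, \<open>(h(c) - xc) n = h(cn) - x(cn) = 0\<close>. In the
  application to products \<open>D\<close> is \<open>K \<inter> JI\<close>, which may fail to be \<open>B\<close>-stable.
\<close>

lemma \<Psi>_determined:
  assumes x: "x \<in> H" and Kh: "(K, h) \<in> Q0_pre k A B" and D: "D \<subseteq> K"
    and D_right: "\<And>c n. \<lbrakk>c \<in> K; n \<in> D\<rbrakk> \<Longrightarrow> c \<otimes>\<^bsub>A\<^esub> n \<in> D"
    and D_ann: "\<And>y. \<lbrakk>y \<in> H; \<And>n. n \<in> D \<Longrightarrow> y \<triangleleft> n = \<zero>\<^bsub>E\<^esub>\<rbrakk> \<Longrightarrow> y = \<zero>\<^bsub>E\<^esub>"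
    and eq: "\<And>n. n \<in> D \<Longrightarrow> j (h n) = x \<triangleleft> n"
  shows "(K, h) \<in> \<Psi> x"
proof -
  note KD = Q0_preD[OF Kh] and KF = F_B_D[OF Q0_preD(1)[OF Kh]]
  have "j (h c) = x \<triangleleft> c" if c: "c \<in> K" for c
  proof -
    have cA: "c \<in> carrier A" using c KF(1) by blast
    have H: "j (h c) \<in> H" "x \<triangleleft> c \<in> H" using KD(2)[OF c] j_in_hat hat_act(1)[OF cA x] by auto
    have yH: "j (h c) \<ominus>\<^bsub>E\<^esub> x \<triangleleft> c \<in> H"
      using H E.submoduleD(3,4)[OF hat_submodule] by (simp add: a_minus_def)
    have "j (h c) \<ominus>\<^bsub>E\<^esub> x \<triangleleft> c = \<zero>\<^bsub>E\<^esub>"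
    proof (rule D_ann[OF yH])
      fix n assume n: "n \<in> D"
      have nA: "n \<in> carrier A" using n D KF(1) by blast
      have "j (h c) \<triangleleft> n = j (h (c \<otimes>\<^bsub>A\<^esub> n))"
        using KD(3)[OF c nA] j_mult(1)[OF KD(2)[OF c] nA] by simp
      also have "\<dots> = x \<triangleleft> c \<triangleleft> n"
        using eq[OF D_right[OF c n]] ract_assoc[OF cA nA hat_in_E[OF x]] by simp
      finally have e: "j (h c) \<triangleleft> n = x \<triangleleft> c \<triangleleft> n" .
      have "(j (h c) \<ominus>\<^bsub>E\<^esub> x \<triangleleft> c) \<triangleleft> n = j (h c) \<triangleleft> n \<ominus>\<^bsub>E\<^esub> x \<triangleleft> c \<triangleleft> n"
        using hat_in_E[OF H(1)] hat_in_E[OF H(2)] nA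
        by (simp add: a_minus_def E.smult_r_distr E.smult_r_minus R_in_B)
      then show "(j (h c) \<ominus>\<^bsub>E\<^esub> x \<triangleleft> c) \<triangleleft> n = \<zero>\<^bsub>E\<^esub>"
        using e act_closed(1)[OF nA hat_in_E[OF H(2)]] by (simp add: E.M.minus_eq_zero_iff)
    qed
    then show ?thesis using hat_in_E[OF H(1)] hat_in_E[OF H(2)] by (simp add: E.M.minus_eq_zero_iff)
  qed
  then show ?thesis using Kh by (simp add: \<Psi>_def)
qed

text \<open>
  Two fractions in \<open>\<Psi> x\<close> agree on the intersection of their domains. Conversely, a fraction equivalent
  to one in \<open>\<Psi> x\<close> agrees with left multiplication by \<open>x\<close> on some ideal in \<open>F\<^sub>B\<close>, and this suffices.
\<close>

lemma Q0_class_\<Psi>: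
  assumes x: "x \<in> H" and Ih: "(I, h) \<in> \<Psi> x"
  shows "Q0_class k A B I h = \<Psi> x"
proof (intro equalityI subsetI)
  note ID = \<Psi>D[OF Ih]
  fix p assume "p \<in> Q0_class k A B I h"
  then obtain J g N where p: "p = (J, g)" "(J, g) \<in> Q0_pre k A B" and N: "N \<in> F_B k A B" "N \<subseteq> I \<inter> J"
      and eq: "\<And>c. c \<in> N \<Longrightarrow> h c = g c"
    by (auto simp: Q0_class_def Q0_rel_def)
  have "(J, g) \<in> \<Psi> x"
  proof (rule \<Psi>_determined[OF x p(2), of N])
    show "c \<otimes>\<^bsub>A\<^esub> n \<in> N" if "c \<in> J" "n \<in> N" for c n
      using that F_B_D(3)[OF N(1)] F_B_D(1)[OF Q0_preD(1)[OF p(2)]] by blast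
    show "j (g n) = x \<triangleleft> n" if "n \<in> N" for n using that eq[OF that, symmetric] ID(3) N(2) by auto
  qed (use N hat_ann_zero in auto)
  then show "p \<in> \<Psi> x" using p by simp
next
  note ID = \<Psi>D[OF Ih]
  fix p assume p: "p \<in> \<Psi> x"
  then obtain J g where p': "p = (J, g)" by (cases p) auto
  note JD = \<Psi>D[OF p[unfolded p']]
  have "h c = g c" if "c \<in> I \<inter> J" for c
    using that ID(2,3)[of c] JD(2,3)[of c] j_eq_iff[of "h c" "g c"] by simp
  then show "p \<in> Q0_class k A B I h"
    using p' ID JD F_B_inter[OF ID(1) JD(1)]
    by (auto simp: Q0_class_def Q0_rel_def intro!: bexI[of _ "I \<inter> J"])
qed

lemma \<Psi>_inj: "inj_on \<Psi> H"
proof (rule inj_onI)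
  fix x y assume x: "x \<in> H" and y: "y \<in> H" and eq: "\<Psi> x = \<Psi> y"
  obtain I h where Ih: "(I, h) \<in> \<Psi> x" using \<Psi>_nonempty[OF x] .
  note ID = \<Psi>D[OF Ih] and ID' = \<Psi>D[OF Ih[unfolded eq]]
  have d: "x \<ominus>\<^bsub>E\<^esub> y \<in> H" using x y E.submoduleD(3,4)[OF hat_submodule] by (simp add: a_minus_def)
  have "x \<ominus>\<^bsub>E\<^esub> y = \<zero>\<^bsub>E\<^esub>"
  proof (rule hat_ann_zero[OF ID(1) d])
    fix c assume c: "c \<in> I"
    then have cA: "c \<in> carrier A" using F_B_D(1)[OF ID(1)] by blast
    have "(x \<ominus>\<^bsub>E\<^esub> y) \<triangleleft> c = x \<triangleleft> c \<ominus>\<^bsub>E\<^esub> y \<triangleleft> c"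
      using hat_in_E[OF x] hat_in_E[OF y] cA
      by (simp add: a_minus_def E.smult_r_distr E.smult_r_minus R_in_B)
    then show "(x \<ominus>\<^bsub>E\<^esub> y) \<triangleleft> c = \<zero>\<^bsub>E\<^esub>"
      using ID(3)[OF c] ID'(3)[OF c] act_closed(1)[OF cA hat_in_E[OF y]] by (simp add: E.M.minus_eq_zero_iff)
  qed
  then show "x = y" using hat_in_E[OF x] hat_in_E[OF y] by (simp add: E.M.minus_eq_zero_iff)
qed

lemma \<Psi>_add:
  assumes x: "x \<in> H" and y: "y \<in> H"
  shows "\<Psi> x \<oplus>\<^bsub>Q0 k A B\<^esub> \<Psi> y = \<Psi> (x \<oplus>\<^bsub>E\<^esub> y)"
proof -
  have "Q0_class k A B (I \<inter> J) (\<lambda>c\<in>I \<inter> J. f c \<oplus>\<^bsub>A\<^esub> g c) = \<Psi> (x \<oplus>\<^bsub>E\<^esub> y)"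
    if "(I, f) \<in> \<Psi> x" "(J, g) \<in> \<Psi> y" for I f J g
    by (rule Q0_class_\<Psi>[OF hat_add[OF x y] \<Psi>_add_fractions[OF x y that]])
  moreover have "\<Psi> x \<noteq> {}" "\<Psi> y \<noteq> {}" using \<Psi>_nonempty x y by blast+
  ultimately show ?thesis by (simp add: Q0_def UN_pair_constant)
qed

lemma \<Psi>_smult:
  assumes c: "c \<in> carrier k" and x: "x \<in> H"
  shows "c \<odot>\<^bsub>Q0 k A B\<^esub> \<Psi> x = \<Psi> ((c \<odot>\<^bsub>End_mod k A\<^esub> \<one>\<^bsub>End_mod k A\<^esub>) \<odot>\<^bsub>E\<^esub> x)"
proof -
  let ?c = "c \<odot>\<^bsub>End_mod k A\<^esub> \<one>\<^bsub>End_mod k A\<^esub>"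
  have cB: "?c \<in> B" using scalar_in_B[OF c] .
  have cx: "?c \<odot>\<^bsub>E\<^esub> x \<in> H" using hat_smult[OF cB x] .
  have "Q0_class k A B I (\<lambda>a\<in>I. c \<odot>\<^bsub>A\<^esub> f a) = \<Psi> (?c \<odot>\<^bsub>E\<^esub> x)" if "(I, f) \<in> \<Psi> x" for I f
  proof (rule Q0_class_\<Psi>[OF cx \<Psi>I[OF \<Psi>D(1)[OF that] cx]])
    note ID = \<Psi>D[OF that]
    fix a assume a: "a \<in> I"
    then have aA: "a \<in> carrier A" using F_B_D(1)[OF ID(1)] by blast
    show "c \<odot>\<^bsub>A\<^esub> f a \<in> carrier A" using c ID(2)[OF a] by simp
    have comm: "?c \<otimes>\<^bsub>BR\<^esub> R_map A a = R_map A a \<otimes>\<^bsub>BR\<^esub> ?c"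
      using c aA A.smult_mult_left by (auto simp: BR_mult scalar_apply R_apply)
    have "j (c \<odot>\<^bsub>A\<^esub> f a) = ?c \<odot>\<^bsub>E\<^esub> (x \<triangleleft> a)"
      using j_smult[OF cB ID(2)[OF a]] ID(2,3)[OF a] by (simp add: scalar_apply)
    also have "\<dots> = (?c \<odot>\<^bsub>E\<^esub> x) \<triangleleft> a"
      using comm E.smult_assoc[of ?c "R_map A a" x] E.smult_assoc[of "R_map A a" ?c x] cB R_in_B[OF aA]
        hat_in_E[OF x] by simp
    finally show "j (c \<odot>\<^bsub>A\<^esub> f a) = (?c \<odot>\<^bsub>E\<^esub> x) \<triangleleft> a" .
  qed
  moreover have "\<Psi> x \<noteq> {}" using \<Psi>_nonempty[OF x] by blast
  ultimately show ?thesis by (simp add: Q0_def UN_pair_constant)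
qed

lemma \<Psi>_one: "\<one>\<^bsub>Q0 k A B\<^esub> = \<Psi> (j \<one>\<^bsub>A\<^esub>)"
proof -
  have "(carrier A, \<lambda>x\<in>carrier A. x) \<in> \<Psi> (j \<one>\<^bsub>A\<^esub>)"
  proof (rule \<Psi>I[OF carrier_in_F_B j_in_hat[OF A.one_closed]])
    show "j c = j \<one>\<^bsub>A\<^esub> \<triangleleft> c" if "c \<in> carrier A" for c
      using j_mult(1)[OF A.one_closed that] that by simp
  qed
  then show ?thesis using Q0_class_\<Psi>[OF j_in_hat[OF A.one_closed]] by (simp add: Q0_def)
qed

text \<open>
  Let \<open>f\<close> and \<open>g\<close> be left multiplication by \<open>x\<close> on \<open>I\<close> and by \<open>y\<close> on \<open>J\<close>. On \<open>JI\<close> their composite is left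
  multiplication by \<open>x \<bullet> y\<close>. A fraction on \<open>K\<close> that agrees with the composite on \<open>K \<inter> JI\<close> is in
  \<open>\<Psi> (x \<bullet> y)\<close>, because \<open>K \<inter> JI\<close> contains \<open>KJI\<close>, and an element annihilated by \<open>KJI\<close> is zero by three
  applications of \<open>hat_ann_zero\<close>. So every pair of representatives contributes the set
  \<open>\<Psi> (x \<bullet> y)\<close>, whether or not \<open>JI\<close> is \<open>B\<close>-stable.
\<close>

lemma \<Psi>_mult:
  assumes x: "x \<in> H" and y: "y \<in> H"
  shows "\<Psi> x \<otimes>\<^bsub>Q0 k A B\<^esub> \<Psi> y = \<Psi> (x \<bullet> y)"
proof -
  have xy: "x \<bullet> y \<in> H" using hat_mult_closed_ract(1)[OF x y] .
  have "Q0_comp k A B I f J g = \<Psi> (x \<bullet> y)" if If: "(I, f) \<in> \<Psi> x" and Jg: "(J, g) \<in> \<Psi> y" for I f J g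
  proof -
    note ID = \<Psi>D[OF If] and JD = \<Psi>D[OF Jg] and IF = F_B_D[OF \<Psi>D(1)[OF If]] and JF = F_B_D[OF \<Psi>D(1)[OF Jg]]
    define D where "D = ideal_prod A J I"
    interpret I: ideal I A using ID(1) stable_ideal by (simp add: F_B_def)
    interpret J: ideal J A using JD(1) stable_ideal by (simp add: F_B_def)
    interpret D: ideal D A unfolding D_def by (rule A.ideal_prod_is_ideal[OF J.ideal_axioms I.ideal_axioms])
    have DJ: "D \<subseteq> J" using A.ideal_prod_inter[OF J.ideal_axioms I.ideal_axioms] by (auto simp: D_def)
    have gD: "g c \<in> I" if "c \<in> D" for c
      using that unfolding D_def
    proof (induction c rule: ideal_prod.induct)
      case (prod u v)
      then show ?case
        using Q0_preD(3)[OF JD(4), of u v] JD(2)[of u] IF(1,3)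
        by auto
    next
      case (sum s t)
      then have "s \<in> J" "t \<in> J" using DJ by (auto simp: D_def)
      then show ?case using Q0_preD(4)[OF JD(4), of s t] sum IF(5) by simp
    qed
    have comp: "j (f (g c)) = (x \<bullet> y) \<triangleleft> c" if c: "c \<in> D" for c
    proof -
      have cJ: "c \<in> J" and cA: "c \<in> carrier A" using c DJ JF(1) by auto
      have "(x \<bullet> y) \<triangleleft> c = x \<bullet> j (g c)"
        using hat_mult_closed_ract(2)[OF x y cA] JD(3)[OF cJ] by simp
      also have "\<dots> = x \<triangleleft> g c" using hat_mult_j[OF x JD(2)[OF cJ]] .
      also have "\<dots> = j (f (g c))" using ID(3)[OF gD[OF c]] by simp
      finally show ?thesis by simp
    qed
    show ?thesis
    proof (intro equalityI subsetI)
      fix p assume "p \<in> Q0_comp k A B I f J g"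
      then obtain K h where p: "p = (K, h)" "(K, h) \<in> Q0_pre k A B"
          and eq: "\<And>c. c \<in> K \<inter> D \<Longrightarrow> h c = f (g c)"
        by (auto simp: Q0_comp_def D_def)
      note KF = F_B_D[OF Q0_preD(1)[OF p(2)]]
      have "(K, h) \<in> \<Psi> (x \<bullet> y)"
      proof (rule \<Psi>_determined[OF xy p(2), of "K \<inter> D"])
        show "c \<otimes>\<^bsub>A\<^esub> n \<in> K \<inter> D" if "c \<in> K" "n \<in> K \<inter> D" for c n
          using that KF(1,3) D.I_l_closed by auto
        show "j (h n) = (x \<bullet> y) \<triangleleft> n" if "n \<in> K \<inter> D" for n using eq[OF that] comp that by simp
        \<comment> \<open>\<open>z\<close> annihilates \<open>KJI\<close>; strip off \<open>I\<close>, \<open>J\<close> and \<open>K\<close> one after the other.\<close>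
        fix z assume z: "z \<in> H" and zD: "\<And>n. n \<in> K \<inter> D \<Longrightarrow> z \<triangleleft> n = \<zero>\<^bsub>E\<^esub>"
        show "z = \<zero>\<^bsub>E\<^esub>"
        proof (rule hat_ann_zero[OF Q0_preD(1)[OF p(2)] z])
          fix c assume c: "c \<in> K"
          have cA: "c \<in> carrier A" using c KF(1) by blast
          have zc: "z \<triangleleft> c \<in> H" using hat_act(1)[OF cA z] .
          show "z \<triangleleft> c = \<zero>\<^bsub>E\<^esub>"
          proof (rule hat_ann_zero[OF JD(1) zc])
            fix u assume u: "u \<in> J"
            have uA: "u \<in> carrier A" using u JF(1) by blast
            show "z \<triangleleft> c \<triangleleft> u = \<zero>\<^bsub>E\<^esub>"
            proof (rule hat_ann_zero[OF ID(1) hat_act(1)[OF uA zc]])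
              fix v assume v: "v \<in> I"
              have vA: "v \<in> carrier A" using v IF(1) by blast
              have "u \<otimes>\<^bsub>A\<^esub> v \<in> D" unfolding D_def using u v by (rule ideal_prod.prod)
              then have "c \<otimes>\<^bsub>A\<^esub> (u \<otimes>\<^bsub>A\<^esub> v) \<in> K \<inter> D"
                using D.I_l_closed cA KF(4)[of "u \<otimes>\<^bsub>A\<^esub> v" c] c uA vA by simp
              from zD[OF this] show "z \<triangleleft> c \<triangleleft> u \<triangleleft> v = \<zero>\<^bsub>E\<^esub>"
                using cA uA vA hat_in_E[OF z] hat_in_E[OF zc] by (simp add: ract_assoc)
            qed
          qed
        qed
      qed simp
      then show "p \<in> \<Psi> (x \<bullet> y)" using p by simp
    next
      fix p assume p: "p \<in> \<Psi> (x \<bullet> y)"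
      then obtain K h where p': "p = (K, h)" by (cases p) auto
      note KD = \<Psi>D[OF p[unfolded p']]
      have "h c = f (g c)" if "c \<in> K \<inter> D" for c
        using that KD(2,3)[of c] comp[of c] ID(2)[OF gD[of c]] j_eq_iff[of "h c" "f (g c)"] by simp
      then show "p \<in> Q0_comp k A B I f J g" using KD(4) p' by (auto simp: Q0_comp_def D_def)
    qed
  qed
  moreover have "\<Psi> x \<noteq> {}" "\<Psi> y \<noteq> {}" using \<Psi>_nonempty x y by blast+
  ultimately show ?thesis by (simp add: Q0_def UN_pair_constant)
qed

lemma \<Psi>_in_Q0: "x \<in> H \<Longrightarrow> \<Psi> x \<in> carrier (Q0 k A B)"
proof -
  assume x: "x \<in> H"
  obtain I h where Ih: "(I, h) \<in> \<Psi> x" using \<Psi>_nonempty[OF x] .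
  then show ?thesis
    using \<Psi>D(4)[OF Ih] Q0_class_\<Psi>[OF x Ih] by (auto simp: Q0_def Q0_class_def quotient_def)
qed

end


section \<open>The maps out of the tensor product\<close>

context central_closure
begin

abbreviation "Inv \<equiv> B_invariants A B AM"
abbreviation "Endhat \<equiv> End_mod BR hat"

lemma Endhat_simps [simp]:
  "carrier Endhat = End" "f \<oplus>\<^bsub>Endhat\<^esub> g = (\<lambda>x\<in>H. f x \<oplus>\<^bsub>E\<^esub> g x)"
  by (simp_all add: End_mod_def)

lemma Endhat_smult: "b \<odot>\<^bsub>Endhat\<^esub> f = (\<lambda>x\<in>H. b \<odot>\<^bsub>E\<^esub> f x)"
  by (simp add: End_mod_def)

text \<open>
  Invariants are central: apply the defining property to right multiplications. They act on every
  \<open>B\<close>-module by endomorphisms: apply it to \<open>b R\<^sub>x\<close>, which gives \<open>b(zx) = b(x) z = z b(x)\<close>.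
\<close>

lemma InvD:
  assumes z: "z \<in> Inv"
  shows "z \<in> carrier A" "\<And>a. a \<in> carrier A \<Longrightarrow> z \<otimes>\<^bsub>A\<^esub> a = a \<otimes>\<^bsub>A\<^esub> z"
    "\<And>b. b \<in> B \<Longrightarrow> b \<otimes>\<^bsub>BR\<^esub> L_map A z = L_map A z \<otimes>\<^bsub>BR\<^esub> b"
proof -
  show zA: "z \<in> carrier A" using z by (simp add: B_invariants_def)
  have inv: "b z = b \<one>\<^bsub>A\<^esub> \<otimes>\<^bsub>A\<^esub> z" if "b \<in> B" for b
  proof -
    have "b z = L_map A (b \<one>\<^bsub>A\<^esub>) z" using z that by (simp add: B_invariants_def)
    then show ?thesis by (simp add: L_apply[OF zA])
  qed
  show comm: "z \<otimes>\<^bsub>A\<^esub> a = a \<otimes>\<^bsub>A\<^esub> z" if a: "a \<in> carrier A" for a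
    using inv[OF R_in_B[OF a]] a zA by (simp add: R_apply)
  show "b \<otimes>\<^bsub>BR\<^esub> L_map A z = L_map A z \<otimes>\<^bsub>BR\<^esub> b" if b: "b \<in> B" for b
  proof -
    have "b (z \<otimes>\<^bsub>A\<^esub> x) = z \<otimes>\<^bsub>A\<^esub> b x" if x: "x \<in> carrier A" for x
    proof -
      have "b \<otimes>\<^bsub>BR\<^esub> R_map A x \<in> B" using E.R.m_closed[of b "R_map A x"] b R_in_B[OF x] by simp
      from inv[OF this] have "b (z \<otimes>\<^bsub>A\<^esub> x) = b x \<otimes>\<^bsub>A\<^esub> z" using x zA by (simp add: BR_mult R_apply)
      then show ?thesis using comm[OF B_apply(1)[OF b x]] by simp
    qed
    then show ?thesis using zA B_apply(1)[OF b] by (auto simp: BR_mult L_apply)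
  qed
qed

sublocale tensor: tensor_setup Inv A Endhat "mult A" "\<lambda>z f. L_map A z \<odot>\<^bsub>Endhat\<^esub> f"
proof (rule tensor_setup.intro)
  show "f \<oplus>\<^bsub>Endhat\<^esub> g \<in> carrier Endhat" if "f \<in> carrier Endhat" "g \<in> carrier Endhat" for f g
  proof -
    have fg: "f \<in> End" "g \<in> End" using that by simp_all
    have "(\<lambda>x\<in>carrier hat. f x \<oplus>\<^bsub>E\<^esub> g x) \<in> End"
    proof (rule Hom_modI)
      fix x y assume xy: "x \<in> H" "y \<in> H"
      then show "f (x \<oplus>\<^bsub>hat\<^esub> y) \<oplus>\<^bsub>E\<^esub> g (x \<oplus>\<^bsub>hat\<^esub> y) = (f x \<oplus>\<^bsub>E\<^esub> g x) \<oplus>\<^bsub>hat\<^esub> (f y \<oplus>\<^bsub>E\<^esub> g y)"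
        using End_add[OF fg(1)] End_add[OF fg(2)] hat_in_E End_closed[OF fg(1)] End_closed[OF fg(2)]
        by (simp add: E.M.a_ac)
    next
      fix b x assume "b \<in> carrier BR" "x \<in> H"
      then show "f (b \<odot>\<^bsub>hat\<^esub> x) \<oplus>\<^bsub>E\<^esub> g (b \<odot>\<^bsub>hat\<^esub> x) = b \<odot>\<^bsub>hat\<^esub> (f x \<oplus>\<^bsub>E\<^esub> g x)"
        using End_smult[OF fg(1)] End_smult[OF fg(2)] hat_in_E End_closed[OF fg(1)] End_closed[OF fg(2)]
        by (simp add: E.smult_r_distr)
    qed (use hat_add[OF End_closed[OF fg(1)] End_closed[OF fg(2)]] hat.left_module_axioms in auto)
    then show ?thesis by simp
  qed
  show "L_map A z \<odot>\<^bsub>Endhat\<^esub> f \<in> carrier Endhat" if "f \<in> carrier Endhat" "z \<in> Inv" for f z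
  proof -
    have f: "f \<in> End" using that by simp
    note zD = InvD[OF that(2)]
    have Lz: "L_map A z \<in> B" using L_in_B[OF zD(1)] .
    have "(\<lambda>x\<in>carrier hat. z \<triangleright> f x) \<in> End"
    proof (rule Hom_modI)
      fix x y assume xy: "x \<in> H" "y \<in> H"
      then show "z \<triangleright> f (x \<oplus>\<^bsub>hat\<^esub> y) = z \<triangleright> f x \<oplus>\<^bsub>hat\<^esub> z \<triangleright> f y"
        using End_add[OF f] act_add(2)[OF zD(1)] hat_in_E[OF End_closed[OF f]] by simp
    next
      fix b x assume b: "b \<in> carrier BR" and x: "x \<in> H"
      have "z \<triangleright> (b \<odot>\<^bsub>E\<^esub> f x) = b \<odot>\<^bsub>E\<^esub> (z \<triangleright> f x)"
        using zD(3)[of b] b Lz E.smult_assoc[of b "L_map A z" "f x"] E.smult_assoc[of "L_map A z" b "f x"]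
          hat_in_E[OF End_closed[OF f x]] by simp
      then show "z \<triangleright> f (b \<odot>\<^bsub>hat\<^esub> x) = b \<odot>\<^bsub>hat\<^esub> (z \<triangleright> f x)" using End_smult[OF f] b x by simp
    qed (use hat_act(2)[OF zD(1) End_closed[OF f]] hat.left_module_axioms in auto)
    then show ?thesis by (simp add: Endhat_smult)
  qed
qed (use InvD(1) in auto)

lemma hat_tensor_eq: "hat_tensor k A B E = tensor.T"
  and hat_pure_eq: "hat_pure k A B E = tensor.pure"
  by (simp_all add: hat_tensor_def hat_pure_def)

lemma hat_alg_simps [simp]:
  "carrier (hat_alg k A B E j) = H" "add (hat_alg k A B E j) = add E" "\<zero>\<^bsub>hat_alg k A B E j\<^esub> = \<zero>\<^bsub>E\<^esub>"
  "\<one>\<^bsub>hat_alg k A B E j\<^esub> = j \<one>\<^bsub>A\<^esub>" "x \<otimes>\<^bsub>hat_alg k A B E j\<^esub> y = x \<bullet> y"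
  "c \<odot>\<^bsub>hat_alg k A B E j\<^esub> x = (c \<odot>\<^bsub>End_mod k A\<^esub> \<one>\<^bsub>End_mod k A\<^esub>) \<odot>\<^bsub>E\<^esub> x"
  by (simp_all add: hat_alg_def)

lemma hat_alg_comm_group: "comm_group (add_monoid (hat_alg k A B E j))"
proof -
  have "abelian_group (hat_alg k A B E j)"
  proof (rule abelian_groupI)
    fix x assume "x \<in> carrier (hat_alg k A B E j)"
    then have x: "x \<in> H" by simp
    then show "\<exists>y\<in>carrier (hat_alg k A B E j). y \<oplus>\<^bsub>hat_alg k A B E j\<^esub> x = \<zero>\<^bsub>hat_alg k A B E j\<^esub>"
      using E.submoduleD(4)[OF hat_submodule x] E.M.l_neg[OF hat_in_E[OF x]]
      by (intro bexI[of _ "\<ominus>\<^bsub>E\<^esub> x"]) auto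
  qed (use hat_add hat_in_E E.submoduleD(2)[OF hat_submodule] in \<open>auto simp: E.M.a_ac\<close>)
  then show ?thesis by (rule abelian_group.a_comm_group)
qed

abbreviation "\<phi> \<equiv> \<phi>_map k A B E j"

lemma \<phi>_props:
  shows "\<phi> \<in> hom tensor.T (add_monoid (hat_alg k A B E j))"
    and "\<And>a f. \<lbrakk>a \<in> carrier A; f \<in> End\<rbrakk> \<Longrightarrow> \<phi> (tensor.pure a f) = f (j a)"
proof -
  obtain F where F: "F \<in> hom tensor.T (add_monoid (hat_alg k A B E j))" "F \<in> extensional (carrier tensor.T)"
      "\<And>a f. \<lbrakk>a \<in> carrier A; f \<in> carrier Endhat\<rbrakk> \<Longrightarrow> F (tensor.pure a f) = f (j a)"
  proof (rule tensor.hom_exists[OF hat_alg_comm_group, of "\<lambda>a f. f (j a)"])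
    show "f (j a) \<in> carrier (add_monoid (hat_alg k A B E j))" if "a \<in> carrier A" "f \<in> carrier Endhat" for a f
      using that End_closed[OF _ j_in_hat] by simp
    show "f (j (a \<oplus>\<^bsub>A\<^esub> b)) = f (j a) \<otimes>\<^bsub>add_monoid (hat_alg k A B E j)\<^esub> f (j b)"
      if "a \<in> carrier A" "b \<in> carrier A" "f \<in> carrier Endhat" for a b f
      using that End_add[OF _ j_in_hat j_in_hat] by (simp add: j_add)
    show "(f \<oplus>\<^bsub>Endhat\<^esub> g) (j a) = f (j a) \<otimes>\<^bsub>add_monoid (hat_alg k A B E j)\<^esub> g (j a)"
      if "a \<in> carrier A" "f \<in> carrier Endhat" "g \<in> carrier Endhat" for a f g
      using that by (simp add: j_in_hat)
    show "f (j (a \<otimes>\<^bsub>A\<^esub> z)) = (L_map A z \<odot>\<^bsub>Endhat\<^esub> f) (j a)"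
      if "a \<in> carrier A" "f \<in> carrier Endhat" "z \<in> Inv" for a f z
    proof -
      have "f (j (a \<otimes>\<^bsub>A\<^esub> z)) = f (z \<triangleright> j a)"
        using InvD(1,2)[OF that(3)] that(1) j_mult(2)[of z a] by simp
      also have "\<dots> = z \<triangleright> f (j a)" using End_act(2)[OF _ InvD(1)[OF that(3)] j_in_hat] that by simp
      finally show ?thesis using that by (simp add: j_in_hat Endhat_smult)
    qed
  qed (rule that)
  have "\<phi> = F"
    unfolding \<phi>_map_def hat_tensor_eq hat_pure_eq
    by (rule tensor.the_hom[OF comm_group.axioms(2)[OF hat_alg_comm_group] F])
  then show "\<phi> \<in> hom tensor.T (add_monoid (hat_alg k A B E j))"
    "\<And>a f. \<lbrakk>a \<in> carrier A; f \<in> End\<rbrakk> \<Longrightarrow> \<phi> (tensor.pure a f) = f (j a)" using F by simp_all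
qed

lemma \<phi>_surj:
  assumes "x \<in> H"
  obtains t where "t \<in> carrier tensor.T" "\<phi> t = x"
proof -
  have "\<exists>t\<in>carrier tensor.T. \<phi> t = x"
    using assms
  proof (induction x rule: hat_End_induct)
    case (End f a)
    then show ?case using tensor.pure_in_T[of a f] \<phi>_props(2) by auto
  next
    case (add x y)
    then obtain s t where st: "s \<in> carrier tensor.T" "\<phi> s = x" "t \<in> carrier tensor.T" "\<phi> t = y" by blast
    then have "\<phi> (s \<otimes>\<^bsub>tensor.T\<^esub> t) = x \<oplus>\<^bsub>E\<^esub> y" using hom_mult[OF \<phi>_props(1)] by simp
    then show ?case using monoid.m_closed[OF group.is_monoid[OF tensor.T_group] st(1,3)] by blast
  qed
  then show thesis using that by blast
qed

end

context faithful_central_closure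
begin

lemma \<iota>_eq_\<Psi>:
  assumes a: "a \<in> carrier A"
  shows "\<iota>_map k A B a = \<Psi> (j a)"
proof -
  have "(carrier A, L_map A a) \<in> \<Psi> (j a)"
    unfolding L_map_def using a j_mult(1)[OF a]
    by (intro \<Psi>I[OF carrier_in_F_B j_in_hat[OF a]]) auto
  then show ?thesis unfolding \<iota>_map_def by (rule Q0_class_\<Psi>[OF j_in_hat[OF a]])
qed

text \<open>
  On \<open>I\<^sub>f\<close> the map \<open>f\<close> is left multiplication by \<open>f(1)\<close>.
\<close>

lemma \<psi>_eq_\<Psi>:
  assumes f: "f \<in> End"
  shows "\<psi>_map k A B j f = \<Psi> (f (j \<one>\<^bsub>A\<^esub>))"
proof -
  have f1: "f (j \<one>\<^bsub>A\<^esub>) \<in> H" using End_closed[OF f j_in_hat] by simp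
  have "(I_of A j f, \<lambda>c\<in>I_of A j f. inv_into (carrier A) j (f (j c))) \<in> \<Psi> (f (j \<one>\<^bsub>A\<^esub>))"
  proof (rule \<Psi>I[OF essential_in_F_B[OF I_of_essential[OF f]] f1])
    fix c assume c: "c \<in> I_of A j f"
    then have cA: "c \<in> carrier A" and img: "f (j c) \<in> j ` carrier A" by (auto simp: I_of_def)
    show "inv_into (carrier A) j (f (j c)) \<in> carrier A" using inv_into_into[OF img] .
    show "j (inv_into (carrier A) j (f (j c))) = f (j \<one>\<^bsub>A\<^esub>) \<triangleleft> c"
      using f_inv_into_f[OF img] j_mult(1)[of "\<one>\<^bsub>A\<^esub>" c] End_act(1)[OF f cA j_in_hat[of "\<one>\<^bsub>A\<^esub>"]] cA by simp
  qed
  then show ?thesis unfolding \<psi>_map_def by (rule Q0_class_\<Psi>[OF f1])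
qed

text \<open>
  Both sides are additive, and on \<open>a \<otimes> f\<close> both are \<open>\<Psi> a \<cdot> \<Psi> (f 1) = \<Psi> (a \<bullet> f(1)) = \<Psi> (f a)\<close>.
\<close>

lemma \<psi>_star_eq:
  assumes t: "t \<in> carrier tensor.T"
  shows "\<psi>_star k A B E j t = \<Psi> (\<phi> t)"
proof -
  define G where "G = (\<lambda>t\<in>carrier tensor.T. \<Psi> (\<phi> t))"
  have \<phi>H: "\<phi> t \<in> H" if "t \<in> carrier tensor.T" for t
    using hom_carrier[OF \<phi>_props(1)] that by auto
  have "G \<in> hom tensor.T (add_monoid (Q0 k A B))"
  proof (rule homI)
    show "G t \<in> carrier (add_monoid (Q0 k A B))" if "t \<in> carrier tensor.T" for t
      using that \<Psi>_in_Q0[OF \<phi>H] by (simp add: G_def)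
    fix s t assume st: "s \<in> carrier tensor.T" "t \<in> carrier tensor.T"
    then have "s \<otimes>\<^bsub>tensor.T\<^esub> t \<in> carrier tensor.T"
      using monoid.m_closed[OF group.is_monoid[OF tensor.T_group]] by blast
    then show "G (s \<otimes>\<^bsub>tensor.T\<^esub> t) = G s \<otimes>\<^bsub>add_monoid (Q0 k A B)\<^esub> G t"
      using st hom_mult[OF \<phi>_props(1) st] \<Psi>_add[OF \<phi>H \<phi>H, OF st] by (simp add: G_def)
  qed
  moreover have "G (tensor.pure a f) = \<iota>_map k A B a \<otimes>\<^bsub>Q0 k A B\<^esub> \<psi>_map k A B j f"
    if a: "a \<in> carrier A" and f: "f \<in> End" for a f
  proof -
    have "\<iota>_map k A B a \<otimes>\<^bsub>Q0 k A B\<^esub> \<psi>_map k A B j f = \<Psi> (j a \<bullet> f (j \<one>\<^bsub>A\<^esub>))"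
      using \<iota>_eq_\<Psi>[OF a] \<psi>_eq_\<Psi>[OF f] \<Psi>_mult j_in_hat[OF a] End_closed[OF f j_in_hat] by simp
    also have "j a \<bullet> f (j \<one>\<^bsub>A\<^esub>) = f (j a)"
      using hat_mult_End[OF j_in_hat[OF a] f] ract_one[OF j_closed[OF a]] by simp
    finally show ?thesis using tensor.pure_in_T[of a f] \<phi>_props(2) a f by (simp add: G_def)
  qed
  ultimately have "\<psi>_star k A B E j = G"
    unfolding \<psi>_star_def hat_tensor_eq hat_pure_eq
    by (intro tensor.the_hom abelian_group.a_group[OF Q0_abelian_group]) (simp_all add: G_def)
  then show ?thesis using t by (simp add: G_def)
qed

lemma \<psi>_bar_eq:
  assumes x: "x \<in> H"
  shows "\<psi>_bar k A B E j x = \<Psi> x"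
  unfolding \<psi>_bar_def hat_tensor_eq
proof (rule the_equality)
  obtain t where "t \<in> carrier tensor.T" "\<phi> t = x" using \<phi>_surj[OF x] .
  then show "\<exists>\<gamma>\<in>carrier tensor.T. \<phi> \<gamma> = x \<and> \<psi>_star k A B E j \<gamma> = \<Psi> x" using \<psi>_star_eq by blast
qed (use \<psi>_star_eq in blast)

theorem \<psi>_bar_injective_hom:
  "\<psi>_bar k A B E j \<in> k_alg_hom k (hat_alg k A B E j) (Q0 k A B)"
  "inj_on (\<psi>_bar k A B E j) (carrier (hat_alg k A B E j))"
proof -
  have cl: "x \<bullet> y \<in> H" "x \<oplus>\<^bsub>E\<^esub> y \<in> H" if "x \<in> H" "y \<in> H" for x y
    using hat_mult_closed_ract(1) hat_add that by auto
  have "\<psi>_bar k A B E j \<in> ring_hom (hat_alg k A B E j) (Q0 k A B)"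
    using cl by (intro ring_hom_memI)
      (simp_all add: \<psi>_bar_eq \<Psi>_in_Q0 \<Psi>_mult \<Psi>_add \<Psi>_one j_in_hat)
  moreover have "\<psi>_bar k A B E j (c \<odot>\<^bsub>hat_alg k A B E j\<^esub> x) = c \<odot>\<^bsub>Q0 k A B\<^esub> \<psi>_bar k A B E j x"
    if "c \<in> carrier k" "x \<in> H" for c x
    using that hat_smult[OF scalar_in_B] by (simp add: \<psi>_bar_eq \<Psi>_smult)
  ultimately show "\<psi>_bar k A B E j \<in> k_alg_hom k (hat_alg k A B E j) (Q0 k A B)"
    by (simp add: k_alg_hom_def)
  show "inj_on (\<psi>_bar k A B E j) (carrier (hat_alg k A B E j))"
    using \<Psi>_inj by (simp add: inj_on_def \<psi>_bar_eq)
qed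

end

theorem theorem4p4:
  fixes k :: "'k ring"
    and A :: "('k, 'a) module"
    and B :: "('a \<Rightarrow> 'a) set"
    and E :: "('a \<Rightarrow> 'a, 'e) module"
    and j :: "'a \<Rightarrow> 'e"
  assumes "cring k" and "assoc_algebra k A"
    and "k_subalgebra k (End_mod k A) B" and "mult_algebra k A \<subseteq> B"
    and "\<And>I. B_stable k A B I \<Longrightarrow> B_stable k A B (l_ann A I)"
    and "B_semiprime k A B"
    and "injective_hull (B_ring k A B) (A_mod A) E j"
    and "\<And>I. essential_submodule (B_ring k A B) (A_mod A) I \<Longrightarrow>
           B_stable k A B (l_ann A I) \<and> B_stable k A B (r_ann A I)"
    and "\<And>I. submodule I (B_ring k A B) (hat_mod k A B E) \<Longrightarrow>
           submodule (l_ann (hat_alg k A B E j) I) (B_ring k A B) (hat_mod k A B E)"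
  shows "\<psi>_bar k A B E j \<in> k_alg_hom k (hat_alg k A B E j) (Q0 k A B) \<and>
         inj_on (\<psi>_bar k A B E j) (carrier (hat_alg k A B E j))"
proof -
  interpret faithful_central_closure k A B E j
    by (rule faithful_central_closure.intro[OF central_closure.intro faithful_central_closure_axioms.intro])
      (rule assms; assumption)+
  show ?thesis using \<psi>_bar_injective_hom by blast
qed

end
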